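(* Let $f\in L^1(\mathbb{R}^N)\cap L^\infty(\mathbb{R}^N)$ and let $u,\tilde u\in L^\infty(\mathbb{R}^N)$ be two entropy solutions to $$b(u)+\operatorname{div}(F(u))+(-\Delta)^{\frac s2}u=f\quad\text{in }\mathbb{R}^N$$ such that $b(u),b(\tilde u)\in L^1(\mathbb{R}^N)$. Then $b(u)=b(\tilde u)$ almost everywhere in $\mathbb{R}^N$. If moreover $b$ is strictly monotone, then $u=\tilde u$ almost everywhere in $\mathbb{R}^N$.
   Context: Standing assumptions: $N\in\mathbb{N}$, $s\in(0,1]$; $b:\mathbb{R}\to\mathbb{R}$ is Lipschitz continuous and nondecreasing with $b(0)=0$ and $b(r)r\geq\lambda|r|^2$ for all $r\in\mathbb{R}$, for some $\lambda>0$; $F=(F_1,\dots,F_N):\mathbb{R}\to\mathbb{R}^N$ is locally Lipschitz continuous with $F(0)=0$. The constant is $C(N,s)=\frac{s\,\Gamma(\frac{N+s}{2})}{2\pi^{\frac N2+s}\Gamma(1-\frac s2)}$. $\mathcal{D}(\mathbb{R}^N)=C_c^\infty(\mathbb{R}^N)$. Entropy solution: a function $u\in L^\infty(\mathbb{R}^N)$ is called an entropy solution to $b(u)+\operatorname{div}(F(u))+(-\Delta)^{s/2}u=f$ if for all $r>0$, all $\varphi\in\mathcal{D}(\mathbb{R}^N)$ with $\varphi\geq0$, all convex $\eta\in C^2(\mathbb{R})$ and all $\phi=(\phi_1,\dots,\phi_N):\mathbb{R}\to\mathbb{R}^N$ locally Lipschitz with $\phi_i'=\eta'F_i'$ (a.e.)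 for $i=1,\dots,N$, it holds $$\int_{\mathbb{R}^N}(f(x)-b(u(x)))\eta'(u(x))\varphi(x)+\phi(u(x))\cdot\nabla\varphi(x)\,dx$$ $$+C(N,s)\int_{\mathbb{R}^N}\int_{\{|z|\geq r\}}\eta'(u(x))\frac{u(x+z)-u(x)}{|z|^{N+s}}\varphi(x)\,dz\,dx$$ $$+C(N,s)\int_{\mathbb{R}^N}\int_{\{|z|\leq r\}}\eta(u(x))\frac{\varphi(x+z)-\varphi(x)-\nabla\varphi(x)\cdot z}{|z|^{N+s}}\,dz\,dx\geq0.$$ *)

theory Defs
  imports "HOL-Analysis.Analysis"
begin

text \<open>
  The space \<open>\<real>\<^sup>N\<close> is \<^typ>\<open>real ^ 'n\<close> with \<open>N = CARD('n)\<close>.  Elements of the Lebesgue spaces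
  are represented by real-valued functions, identified only through almost-everywhere equality.
\<close>

definition L_infty :: "('a::euclidean_space \<Rightarrow> real) \<Rightarrow> bool" where
  "L_infty u \<longleftrightarrow> u \<in> borel_measurable lebesgue \<and> (\<exists>K. AE x in lebesgue. \<bar>u x\<bar> \<le> K)"

definition locally_lipschitz :: "('a::metric_space \<Rightarrow> 'b::metric_space) \<Rightarrow> bool" where
  "locally_lipschitz g \<longleftrightarrow> (\<forall>x. \<exists>e>0. \<exists>L. L-lipschitz_on (ball x e) g)"

definition C2_real :: "(real \<Rightarrow> real) \<Rightarrow> bool" where
  "C2_real \<eta> \<longleftrightarrow>
     (\<forall>t. \<eta> field_differentiable at t) \<and>
     (\<forall>t. deriv \<eta> field_differentiable at t) \<and>
     continuous_on UNIV (deriv (deriv \<eta>))"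

definition partial_deriv :: "'n \<Rightarrow> (real ^ 'n \<Rightarrow> real) \<Rightarrow> real ^ 'n \<Rightarrow> real" where
  "partial_deriv i g x = frechet_derivative g (at x) (axis i 1)"

definition grad :: "(real ^ 'n \<Rightarrow> real) \<Rightarrow> real ^ 'n \<Rightarrow> real ^ 'n" where
  "grad g x = (\<chi> i. partial_deriv i g x)"

primrec C_k :: "nat \<Rightarrow> (real ^ 'n \<Rightarrow> real) \<Rightarrow> bool" where
  "C_k 0 g \<longleftrightarrow> continuous_on UNIV g"
| "C_k (Suc k) g \<longleftrightarrow> (\<forall>x. g differentiable (at x)) \<and> (\<forall>i. C_k k (partial_deriv i g))"

definition test_function :: "(real ^ 'n \<Rightarrow> real) \<Rightarrow> bool" where
  "test_function \<phi> \<longleftrightarrow> (\<forall>k. C_k k \<phi>) \<and> compact (closure {x. \<phi> x \<noteq> 0})"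

definition frac_const :: "nat \<Rightarrow> real \<Rightarrow> real" where
  "frac_const N s =
     s * Gamma ((real N + s) / 2) / (2 * pi powr (real N / 2 + s) * Gamma (1 - s / 2))"

text \<open>
  \<open>entropy_flux F \<eta> \<Phi>\<close>: the components satisfy \<open>\<Phi>\<^sub>i' = \<eta>' F\<^sub>i'\<close> almost everywhere, which
  includes the existence of both derivatives at almost every point.
\<close>

definition entropy_flux ::
  "(real \<Rightarrow> real ^ 'n) \<Rightarrow> (real \<Rightarrow> real) \<Rightarrow> (real \<Rightarrow> real ^ 'n) \<Rightarrow> bool" where
  "entropy_flux F \<eta> \<Phi> \<longleftrightarrow>
     locally_lipschitz \<Phi> \<and>
     (\<forall>i. AE t in lebesgue. \<exists>D.
        ((\<lambda>r. F r $ i) has_real_derivative D) (at t) \<and>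
        ((\<lambda>r. \<Phi> r $ i) has_real_derivative deriv \<eta> t * D) (at t))"

text \<open>
  For locally Lipschitz \<open>F\<close>, continuous \<open>b\<close>, bounded \<open>u\<close>, locally integrable \<open>f\<close> and
  \<open>0 < s < 2\<close> all integrals below converge absolutely, so the default value \<open>0\<close> of the Bochner
  integral never intervenes.  At \<open>z = 0\<close> the quotients are \<open>0\<close> by convention, which only concerns
  a null set.
\<close>

definition entropy_solution ::
  "(real \<Rightarrow> real) \<Rightarrow> (real \<Rightarrow> real ^ 'n) \<Rightarrow> real \<Rightarrow> (real ^ 'n \<Rightarrow> real) \<Rightarrow> (real ^ 'n \<Rightarrow> real) \<Rightarrow> bool"
where
  "entropy_solution b F s f u \<longleftrightarrow>
     L_infty u \<and>
     (\<forall>r \<phi> \<eta> \<Phi>.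
        r > 0 \<longrightarrow> test_function \<phi> \<longrightarrow> (\<forall>x. \<phi> x \<ge> 0) \<longrightarrow>
        convex_on UNIV \<eta> \<longrightarrow> C2_real \<eta> \<longrightarrow> entropy_flux F \<eta> \<Phi> \<longrightarrow>
        (LINT x|lebesgue. (f x - b (u x)) * deriv \<eta> (u x) * \<phi> x + \<Phi> (u x) \<bullet> grad \<phi> x)
        + frac_const CARD('n) s *
          (LINT x|lebesgue. (LINT z:{z. norm z \<ge> r}|lebesgue.
             deriv \<eta> (u x) * ((u (x + z) - u x) / norm z powr (real CARD('n) + s)) * \<phi> x))
        + frac_const CARD('n) s *
          (LINT x|lebesgue. (LINT z:{z. norm z \<le> r}|lebesgue.
             \<eta> (u x) * ((\<phi> (x + z) - \<phi> x - grad \<phi> x \<bullet> z) / norm z powr (real CARD('n) + s))))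
        \<ge> 0)"

end

theory Submission
  imports Defs
begin

text \<open>
  The proof is Kruzhkov's doubling of variables. Using the smooth convex functions \<open>sabs d (t - k)\<close>
  as entropies and letting \<open>d\<close> tend to \<open>0\<close> gives the entropy inequality with entropy \<open>|t - k|\<close>
  (\<open>Kruzhkov_inequality\<close>). It is used for \<open>u\<close> as a function of \<open>x\<close> with \<open>k = v y\<close>, and for \<open>v\<close> as a function of
  \<open>y\<close> with \<open>k = u x\<close>, both with the test function \<open>\<rho> (x - y)\<close> where \<open>\<rho>\<close> is an even bump; the two inequalities
  are integrated over the remaining variable and added (\<open>doubling\<close>).

  Everything but \<open>f\<close>, \<open>u\<close> and \<open>v\<close> depends on \<open>x - y\<close> only. The flux terms cancel, because the gradient of \<open>\<rho>\<close> is
  odd. The parts of the fractional Laplacian with \<open>|z| \<ge> r\<close> add up to at most the integral of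
  \<open>(|u (x + z) - v (y + z)| - |u x - v y|) \<rho> (x - y)\<close> against an integrable kernel in \<open>z\<close>, which is \<open>0\<close> by translation
  invariance (\<open>convolution_pair_contraction\<close>). The parts with \<open>|z| \<le> r\<close> only see the second order Taylor
  remainder of \<open>\<rho>\<close> and vanish as \<open>r\<close> tends to \<open>0\<close> (\<open>near_error_tendsto_0\<close>). Since \<open>b\<close> is nondecreasing, what remains is
  that the double integral of \<open>|b (u x) - b (v y)| \<rho> (x - y)\<close> is at most that of \<open>|f x - f y| \<rho> (x - y)\<close>. When the
  support of \<open>\<rho>\<close> shrinks to \<open>0\<close>, continuity of translations in \<open>L\<^sup>1\<close> gives \<open>b (u x) = b (v x)\<close> almost everywhere
  (\<open>L1_contraction\<close>). No cut-off in space is needed: by coercivity of \<open>b\<close> the solutions are integrable, so all the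
  integrals over pairs \<open>(x, y)\<close> converge.

  To be allowed to use an entropy at all one must exhibit a flux for it, whose definition asks for the derivative of
  \<open>F\<close> almost everywhere. Hence Rademacher's theorem for functions on the line (\<open>Lipschitz_AE_differentiable\<close>), which
  is derived from Vitali's covering theorem; the flux itself is then written down by an integration by
  parts (\<open>sabs_entropy_flux\<close>).
\<close>

section \<open>Differentiability of Lipschitz functions on the line\<close>

text \<open>
  Straddling intervals \<open>c < x < e\<close>, rather than one-sided ones, are used because the union of the open
  intervals \<open>]c, e[\<close> with small slope is open: this makes the set of such points a \<open>G\<^sub>\<delta>\<close> set for free, and
  their closures are the balls that a Vitali covering needs.
\<close>

definition small_slopes :: "(real \<Rightarrow> real) \<Rightarrow> real \<Rightarrow> real \<Rightarrow> bool" where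
  "small_slopes g p x \<longleftrightarrow>
     (\<forall>d>0. \<exists>c e. c < x \<and> x < e \<and> e - c < d \<and> g e - g c \<le> p * (e - c))"

text \<open>
  Cover \<open>E\<close> by disjoint short intervals of slope at most \<open>p\<close> inside an open set barely larger than \<open>E\<close>.
  Their images are at most \<open>p\<close> times as long, and what the covering misses is a null set,
  which a Lipschitz function maps to a null set.
\<close>

lemma emeasure_image_small_slopes:
  fixes g :: "real \<Rightarrow> real"
  assumes mono: "strict_mono g" and lip: "L-lipschitz_on UNIV g" and p: "p \<ge> 0"
    and E: "E \<in> sets lebesgue" and gE: "g ` E \<in> sets lebesgue"
    and slopes: "\<And>x. x \<in> E \<Longrightarrow> small_slopes g p x"
  shows "emeasure lebesgue (g ` E) \<le> ennreal p * emeasure lebesgue E"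
proof -
  have *: "emeasure lebesgue (g ` E) \<le> ennreal p * emeasure lebesgue E + ennreal (p * e)"
    if e: "e > 0" for e :: real
  proof -
    obtain U where U: "open U" "E \<subseteq> U" "emeasure lebesgue (U - E) < ennreal e"
      using sets_lebesgue_outer_open[OF E e] by metis
    define K where "K = {(c, e). c < e \<and> g e - g c \<le> p * (e - c) \<and> {c..e} \<subseteq> U}"
    define a r where "a = (\<lambda>(c, e). (c + e) / 2 :: real)" and "r = (\<lambda>(c, e). (e - c) / 2 :: real)"
    have cb: "cball (a i) (r i) = {fst i..snd i}" for i
      by (cases i) (auto simp: a_def r_def cball_eq_atLeastAtMost field_simps)
    have 1: "0 < r i" if "i \<in> K" for i using that by (auto simp: K_def r_def)
    have 2: "\<exists>i. i \<in> K \<and> x \<in> cball (a i) (r i) \<and> r i < d" if x: "x \<in> E" and d: "d > 0" for x d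
    proof -
      from U x obtain d' where d': "d' > 0" "ball x d' \<subseteq> U" by (meson open_contains_ball subsetD)
      from slopes[OF x] d' d have "\<exists>c e. c < x \<and> x < e \<and> e - c < min d d' \<and> g e - g c \<le> p * (e - c)"
        unfolding small_slopes_def by (metis min_less_iff_conj)
      then obtain c e where ce: "c < x" "x < e" "e - c < min d d'" "g e - g c \<le> p * (e - c)" by blast
      have "{c..e} \<subseteq> ball x d'" using ce by (auto simp: dist_real_def)
      with ce d' have "(c, e) \<in> K" unfolding K_def by auto
      moreover have "x \<in> cball (a (c,e)) (r (c,e))" unfolding cb using ce by auto
      moreover have "r (c,e) < d" using ce by (simp add: r_def)
      ultimately show ?thesis by blast
    qed
    obtain C where
      C: "countable C" "C \<subseteq> K"
        "pairwise (\<lambda>i j. disjnt (cball (a i) (r i)) (cball (a j) (r j))) C"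
        "negligible (E - (\<Union>i\<in>C. cball (a i) (r i)))"
      using Vitali_covering_theorem_cballs[of K r E a, OF 1 2] by blast
    have disj: "disjoint_family_on (\<lambda>i. {fst i..snd i}) C"
      using C(3) unfolding cb disjoint_family_on_def pairwise_def disjnt_def by blast
    let ?N = "g ` (E - (\<Union>i\<in>C. {fst i..snd i}))"
    have "\<exists>T B. open T \<and> x \<in> T \<and> (\<forall>y\<in>S \<inter> T. norm (g y - g x) \<le> B * norm (y - x))" for x S
      using lipschitz_onD[OF lip] by (intro exI[of _ UNIV] exI[of _ L]) (auto simp: dist_norm)
    then have N: "negligible ?N"
      using C(4) unfolding cb by (intro negligible_locally_Lipschitz_image) auto
    have sub: "g ` E \<subseteq> (\<Union>i\<in>C. {g (fst i)..g (snd i)}) \<union> ?N"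
    proof
      fix y assume "y \<in> g ` E"
      then obtain x where x: "x \<in> E" "y = g x" by blast
      show "y \<in> (\<Union>i\<in>C. {g (fst i)..g (snd i)}) \<union> ?N"
      proof (cases "x \<in> (\<Union>i\<in>C. {fst i..snd i})")
        case True
        then obtain i where "i \<in> C" "fst i \<le> x" "x \<le> snd i" by auto
        then show ?thesis using x strict_mono_less_eq[OF mono] by (intro UnI1 UN_I[of i]) auto
      next
        case False
        then show ?thesis using x by blast
      qed
    qed
    have disj': "disjoint_family_on (\<lambda>i. {g (fst i)..g (snd i)}) C"
      unfolding disjoint_family_on_def
    proof (intro ballI impI)
      fix i j assume ij: "i \<in> C" "j \<in> C" "i \<noteq> j"
      have "{fst i..snd i} \<inter> {fst j..snd j} = {}" using disj ij unfolding disjoint_family_on_def by blast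
      moreover have "fst i < snd i" "fst j < snd j" using ij C(2) by (auto simp: K_def)
      ultimately have "max (fst i) (fst j) \<notin> {fst i..snd i} \<or> max (fst i) (fst j) \<notin> {fst j..snd j}"
        "fst i < snd i" "fst j < snd j" by blast+
      then have "snd i < fst j \<or> snd j < fst i" by (auto simp: max_def split: if_splits)
      then have "g (snd i) < g (fst j) \<or> g (snd j) < g (fst i)" using strict_monoD[OF mono] by blast
      then show "{g (fst i)..g (snd i)} \<inter> {g (fst j)..g (snd j)} = {}" by auto
    qed
    have msU: "(\<Union>i\<in>C. {g (fst i)..g (snd i)}) \<in> sets lebesgue"
      using C(1) by (intro sets.countable_UN') auto
    have Nn: "?N \<in> null_sets lebesgue" using N by (simp add: negligible_iff_null_sets)
    have "emeasure lebesgue (g ` E) \<le> emeasure lebesgue ((\<Union>i\<in>C. {g (fst i)..g (snd i)}) \<union> ?N)"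
      using sub msU Nn by (intro emeasure_mono) auto
    also have "\<dots> = emeasure lebesgue (\<Union>i\<in>C. {g (fst i)..g (snd i)})"
      using msU Nn by (rule emeasure_Un_null_set)
    also have "\<dots> = (\<integral>\<^sup>+i. emeasure lebesgue {g (fst i)..g (snd i)} \<partial>count_space C)"
      using C(1) disj' by (intro emeasure_UN_countable) auto
    also have "\<dots> \<le> (\<integral>\<^sup>+i. ennreal p * emeasure lebesgue {fst i..snd i} \<partial>count_space C)"
    proof (rule nn_integral_mono)
      fix i assume "i \<in> space (count_space C)"
      then have "i \<in> K" using C(2) by auto
      then have i: "fst i < snd i" "g (snd i) - g (fst i) \<le> p * (snd i - fst i)" by (auto simp: K_def)
      then show "emeasure lebesgue {g (fst i)..g (snd i)} \<le> ennreal p * emeasure lebesgue {fst i..snd i}"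
        using strict_monoD[OF mono i(1)] p by (simp add: ennreal_mult[symmetric] ennreal_leI)
    qed
    also have "\<dots> = ennreal p * emeasure lebesgue (\<Union>i\<in>C. {fst i..snd i})"
      using C(1) disj by (subst emeasure_UN_countable) (auto intro!: nn_integral_cmult)
    also have "(\<Union>i\<in>C. {fst i..snd i}) \<subseteq> U" using C(2) by (fastforce simp: K_def)
    then have "ennreal p * emeasure lebesgue (\<Union>i\<in>C. {fst i..snd i}) \<le> ennreal p * emeasure lebesgue U"
      using U(1) by (intro mult_left_mono emeasure_mono) auto
    also have "emeasure lebesgue U \<le> emeasure lebesgue E + emeasure lebesgue (U - E)"
    proof -
      have "U \<in> sets lebesgue" using U(1) by auto
      then have "emeasure lebesgue E + emeasure lebesgue (U - E) = emeasure lebesgue (E \<union> (U - E))"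
        using E by (intro plus_emeasure) auto
      also have "E \<union> (U - E) = U" using U(2) by auto
      finally show ?thesis by simp
    qed
    also have "\<dots> \<le> emeasure lebesgue E + ennreal e" using U(3) by (simp add: add_left_mono)
    finally show ?thesis using p e
      by (simp add: distrib_left ennreal_mult[symmetric] mult_left_mono)
  qed
  show ?thesis
  proof (rule ennreal_le_epsilon)
    fix e :: real assume e: "e > 0"
    \<comment> \<open>dividing by \<open>p + 1\<close> rather than \<open>p\<close> covers the case \<open>p = 0\<close>\<close>
    have "p * (e / (p + 1)) \<le> e" using p e by (simp add: field_simps)
    moreover have "e / (p + 1) > 0" using p e by simp
    ultimately show "emeasure lebesgue (g ` E) \<le> ennreal p * emeasure lebesgue E + ennreal e"
      using *[of "e / (p+1)"] by (meson add_left_mono ennreal_leI order_trans)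
  qed
qed

lemma small_slopes_measurable: "{x. small_slopes g p x} \<in> sets borel"
proof -
  have "{x. small_slopes g p x} =
     (\<Inter>k::nat. \<Union>{{c<..<e} | c e. e - c < 1 / (real k + 1) \<and> g e - g c \<le> p * (e - c)})"
    (is "_ = ?R")
  proof (intro equalityI subsetI)
    fix x assume x: "x \<in> {x. small_slopes g p x}"
    show "x \<in> ?R"
    proof
      fix k :: nat
      have "1 / (real k + 1) > 0" by simp
      with x obtain c e where "c < x" "x < e" "e - c < 1 / (real k + 1)" "g e - g c \<le> p * (e - c)"
        unfolding small_slopes_def by blast
      then show "x \<in> \<Union>{{c<..<e} | c e. e - c < 1 / (real k + 1) \<and> g e - g c \<le> p * (e - c)}"
        by (intro UnionI[of "{c<..<e}"]) auto
    qed
  next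
    fix x assume x: "x \<in> ?R"
    show "x \<in> {x. small_slopes g p x}" unfolding small_slopes_def mem_Collect_eq
    proof (intro allI impI)
      fix d :: real assume "d > 0"
      then obtain k :: nat where k: "1 / (real k + 1) < d"
        using nat_approx_posE by (metis of_nat_Suc add.commute)
      from x have "x \<in> \<Union>{{c<..<e} | c e. e - c < 1 / (real k + 1) \<and> g e - g c \<le> p * (e - c)}" by blast
      then show "\<exists>c e. c < x \<and> x < e \<and> e - c < d \<and> g e - g c \<le> p * (e - c)"
        using k by fastforce
    qed
  qed
  moreover have "open (\<Union>{{c<..<e} | c e. e - c < 1 / (real k + 1) \<and> g e - g c \<le> p * (e - c)})" for k
    by (rule open_Union) auto
  ultimately show ?thesis by auto
qed

text \<open>
  By the last hypothesis, slopes that are at most \<open>p\<close> arbitrarily close to \<open>x\<close> are eventually at most any \<open>q > p\<close>.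
  Hence the lower limit \<open>D\<close> of the straddling slopes is their limit, and by continuity one end of the interval may move to \<open>x\<close>.
\<close>

lemma strict_mono_lipschitz_differentiable_at:
  fixes g :: "real \<Rightarrow> real"
  assumes lo: "\<And>x y. x < y \<Longrightarrow> y - x \<le> g y - g x"
    and hi: "\<And>x y. x < y \<Longrightarrow> g y - g x \<le> M * (y - x)"
    and nE: "\<And>p q. \<lbrakk>p \<in> \<rat>; q \<in> \<rat>; 0 < p; p < q; small_slopes g p x\<rbrakk> \<Longrightarrow>
      \<exists>d>0. \<forall>c e. c < x \<longrightarrow> x < e \<longrightarrow> e - c < d \<longrightarrow> g e - g c \<le> q * (e - c)"
  shows "\<exists>D. (g has_real_derivative D) (at x)"
proof -
  define A where "A = {p. \<exists>d>0. \<forall>c e. c < x \<longrightarrow> x < e \<longrightarrow> e - c < d \<longrightarrow> p * (e - c) \<le> g e - g c}"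
  have bdd: "p \<le> M" if "p \<in> A" for p
  proof -
    from that obtain d where d: "d > 0" "\<And>c e. c < x \<Longrightarrow> x < e \<Longrightarrow> e - c < d \<Longrightarrow> p * (e - c) \<le> g e - g c"
      unfolding A_def by blast
    have "p * (d/2) \<le> g (x + d/4) - g (x - d/4)" using d(2)[of "x - d/4" "x + d/4"] d(1) by simp
    also have "\<dots> \<le> M * (d/2)" using hi[of "x - d/4" "x + d/4"] d(1) by simp
    finally show ?thesis using d(1) by simp
  qed
  have one: "1 \<in> A" unfolding A_def using lo by (auto intro!: exI[of _ 1] simp: less_trans)
  have bA: "bdd_above A" using bdd by (rule bdd_aboveI)
  define D where "D = Sup A"
  have D1: "D \<ge> 1" unfolding D_def using one bA by (rule cSup_upper)
  have cont: "isCont g x"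
  proof -
    have "M-lipschitz_on UNIV g"
    proof (rule lipschitz_onI)
      fix a b :: real
      show "dist (g a) (g b) \<le> M * dist a b"
        using hi[of a b] hi[of b a] lo[of a b] lo[of b a]
        by (cases a b rule: linorder_cases) (auto simp: dist_real_def abs_if)
      have "1 \<le> M" using bdd one by blast
      then show "0 \<le> M" by simp
    qed
    then show ?thesis using lipschitz_on_continuous_on continuous_on_eq_continuous_at by blast
  qed
  have key: "\<exists>d>0. \<forall>c e. c < x \<longrightarrow> x < e \<longrightarrow> e - c < d \<longrightarrow> \<bar>g e - g c - D * (e - c)\<bar> \<le> \<epsilon> * (e - c)"
    if eps: "\<epsilon> > 0" for \<epsilon>
  proof -
    have "D - \<epsilon> < Sup A" using eps by (simp add: D_def)
    then obtain p0 where p0: "p0 \<in> A" "D - \<epsilon> < p0" using less_cSupE one by (metis empty_iff)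
    then obtain d1 where d1: "d1 > 0" "\<And>c e. c < x \<Longrightarrow> x < e \<Longrightarrow> e - c < d1 \<Longrightarrow> p0 * (e - c) \<le> g e - g c"
      unfolding A_def by blast
    \<comment> \<open>two rationals above \<open>D\<close>: the slopes are infinitely often below \<open>p\<close>, hence eventually at most \<open>q\<close>\<close>
    obtain p where p: "p \<in> \<rat>" "D < p" "p < D + \<epsilon>" using Rats_dense_in_real[of D "D + \<epsilon>"] eps by auto
    obtain q where q: "q \<in> \<rat>" "p < q" "q < D + \<epsilon>" using Rats_dense_in_real[of p "D + \<epsilon>"] p by auto
    have "p \<notin> A" using p bA unfolding D_def using cSup_upper by (metis leD)
    then have "small_slopes g p x" unfolding A_def small_slopes_def by (force simp: not_le)
    from nE[OF p(1) q(1) _ q(2) this] p D1 obtain d2 where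
      d2: "d2 > 0" "\<And>c e. c < x \<Longrightarrow> x < e \<Longrightarrow> e - c < d2 \<Longrightarrow> g e - g c \<le> q * (e - c)" by auto
    have "\<bar>g e - g c - D * (e - c)\<bar> \<le> \<epsilon> * (e - c)" if "c < x" "x < e" "e - c < min d1 d2" for c e
    proof -
      have "p0 * (e - c) \<le> g e - g c" "g e - g c \<le> q * (e - c)" using d1 d2 that by auto
      moreover have "(D - \<epsilon>) * (e - c) \<le> p0 * (e - c)" "q * (e - c) \<le> (D + \<epsilon>) * (e - c)"
        using p0 q that by (auto intro!: mult_right_mono)
      ultimately show ?thesis by (simp add: abs_le_iff algebra_simps)
    qed
    then show ?thesis using d1 d2 by (intro exI[of _ "min d1 d2"]) auto
  qed
  have "(g has_derivative (\<lambda>h. D * h)) (at x)"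
    unfolding has_derivative_at_alt
  proof (intro conjI allI impI bounded_linear_mult_right)
    fix \<epsilon> :: real assume "\<epsilon> > 0"
    from key[OF this] obtain d where d: "d > 0"
      "\<And>c e. c < x \<Longrightarrow> x < e \<Longrightarrow> e - c < d \<Longrightarrow> \<bar>g e - g c - D * (e - c)\<bar> \<le> \<epsilon> * (e - c)" by blast
    have "\<bar>g y - g x - D * (y - x)\<bar> \<le> \<epsilon> * \<bar>y - x\<bar>" if y: "\<bar>y - x\<bar> < d" for y
    proof (cases y x rule: linorder_cases)
      case greater
      have "((\<lambda>c. \<epsilon> * (y - c) - \<bar>g y - g c - D * (y - c)\<bar>) \<longlongrightarrow>
              \<epsilon> * (y - x) - \<bar>g y - g x - D * (y - x)\<bar>) (at_left x)"
        using cont unfolding isCont_def by (intro tendsto_intros) (auto simp: filterlim_at_split)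
      moreover have "eventually (\<lambda>c. 0 \<le> \<epsilon> * (y - c) - \<bar>g y - g c - D * (y - c)\<bar>) (at_left x)"
        unfolding eventually_at_left_field
        using greater y d by (intro exI[of _ "y - d"]) auto
      ultimately have "0 \<le> \<epsilon> * (y - x) - \<bar>g y - g x - D * (y - x)\<bar>"
        by (intro tendsto_lowerbound) auto
      then show ?thesis using greater by simp
    next
      case less
      have "((\<lambda>e. \<epsilon> * (e - y) - \<bar>g e - g y - D * (e - y)\<bar>) \<longlongrightarrow>
              \<epsilon> * (x - y) - \<bar>g x - g y - D * (x - y)\<bar>) (at_right x)"
        using cont unfolding isCont_def by (intro tendsto_intros) (auto simp: filterlim_at_split)
      moreover have "eventually (\<lambda>e. 0 \<le> \<epsilon> * (e - y) - \<bar>g e - g y - D * (e - y)\<bar>) (at_right x)"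
        unfolding eventually_at_right_field
        using less y d by (intro exI[of _ "y + d"]) auto
      ultimately have "0 \<le> \<epsilon> * (x - y) - \<bar>g x - g y - D * (x - y)\<bar>"
        by (intro tendsto_lowerbound) auto
      moreover have "\<bar>g y - g x - D * (y - x)\<bar> = \<bar>g x - g y - D * (x - y)\<bar>"
        by (simp add: algebra_simps abs_if)
      ultimately show ?thesis using less by simp
    qed auto
    then show "\<exists>d>0. \<forall>y. norm (y - x) < d \<longrightarrow> norm (g y - g x - D * (y - x)) \<le> \<epsilon> * norm (y - x)"
      using d by auto
  qed
  then show ?thesis by (auto simp: has_field_derivative_def)
qed

text \<open>
  Rademacher's theorem on the line. A linear function is added to make all slopes lie between \<open>1\<close> and
  \<open>M\<close>; the sum \<open>g\<close> is a bi-Lipschitz homeomorphism with inverse \<open>h\<close>. At a point where the slopes of \<open>g\<close>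
  oscillate between \<open>p\<close> and \<open>q > p\<close>, those of \<open>h\<close> are infinitely often at most \<open>1/q\<close>, so that the covering
  estimate applies to \<open>g\<close> on \<open>E\<close> and to \<open>h\<close> on \<open>g ` E\<close>: together \<open>|E| \<le> (p/q) |E|\<close>, hence \<open>|E| = 0\<close>.
\<close>

lemma Lipschitz_AE_differentiable:
  fixes f :: "real \<Rightarrow> real"
  assumes lip: "L-lipschitz_on UNIV f"
  shows "AE x in lebesgue. \<exists>D. (f has_real_derivative D) (at x)"
proof -
  define M where "M = 2 * L + 1"
  have L0: "L \<ge> 0" using lip by (rule lipschitz_on_nonneg)
  define g where "g x = f x + (L + 1) * x" for x
  have fb: "\<bar>f y - f x\<bar> \<le> L * \<bar>y - x\<bar>" for x y
    using lipschitz_onD[OF lip, of y x] by (simp add: dist_real_def)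
  have lo: "y - x \<le> g y - g x" if "x < y" for x y
    using fb[of y x] that by (simp add: g_def abs_le_iff algebra_simps)
  have hi: "g y - g x \<le> M * (y - x)" if "x < y" for x y
    using fb[of y x] that by (simp add: g_def M_def abs_le_iff algebra_simps)
  have mono: "strict_mono g" unfolding strict_mono_def using lo by force
  have glip: "M-lipschitz_on UNIV g"
  proof (rule lipschitz_onI)
    fix a b :: real
    show "dist (g a) (g b) \<le> M * dist a b"
      using hi[of a b] hi[of b a] lo[of a b] lo[of b a]
      by (cases a b rule: linorder_cases) (auto simp: dist_real_def abs_if)
  qed (use L0 in \<open>simp add: M_def\<close>)
  have gcont: "continuous_on UNIV g" using glip by (rule lipschitz_on_continuous_on)
  have surj: "surj g"
  proof (unfold surj_def, intro allI)
    fix y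
    define K where "K = \<bar>y - g 0\<bar> + 1"
    have "g (-K) \<le> y" "y \<le> g K" using lo[of "-K" 0] lo[of 0 K] by (auto simp: K_def abs_if)
    then obtain x where "g x = y"
      using IVT'[of g "-K" y K] continuous_on_subset[OF gcont] by (force simp: K_def)
    then show "\<exists>x. y = g x" by blast
  qed
  define h where "h = inv g"
  have hg: "h (g x) = x" for x using strict_mono_imp_inj_on[OF mono] by (simp add: h_def)
  have gh: "g (h x) = x" for x using surj by (simp add: h_def surj_f_inv_f)
  have hmono: "strict_mono h" unfolding strict_mono_def
    by (metis gh strict_mono_less[OF mono])
  have hlip: "1-lipschitz_on UNIV h"
  proof (rule lipschitz_onI)
    fix a b :: real
    show "dist (h a) (h b) \<le> 1 * dist a b"
      using lo[of "h a" "h b"] lo[of "h b" "h a"]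
      by (cases "h a" "h b" rule: linorder_cases) (auto simp: dist_real_def gh abs_if)
  qed simp
  \<comment> \<open>bounded pieces, so that \<open>|E| \<le> (p/q) |E|\<close> forces \<open>|E| = 0\<close>\<close>
  define E where "E p q n = {x. small_slopes g p x} \<inter> {x. small_slopes h (1/q) (g x)} \<inter> {-real n..real n}"
    for p q n
  have Eborel: "E p q n \<in> sets borel" for p q n
  proof -
    have [measurable]: "g \<in> borel_measurable borel"
      using gcont by (rule borel_measurable_continuous_onI)
    have "{x. small_slopes h (1/q) (g x)} = g -` {x. small_slopes h (1/q) x} \<inter> space borel" by auto
    also have "\<dots> \<in> sets borel" by (rule measurable_sets[OF _ small_slopes_measurable]) simp
    finally show ?thesis unfolding E_def using small_slopes_measurable by auto
  qed
  have Enull: "E p q n \<in> null_sets lebesgue" if pq: "0 < p" "p < q" for p q n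
  proof -
    let ?E = "E p q n"
    have Es: "?E \<in> sets lebesgue" using Eborel by auto
    have "g ` ?E = h -` ?E \<inter> space borel"
    proof (intro equalityI subsetI)
      fix y assume "y \<in> h -` ?E \<inter> space borel"
      then have "h y \<in> ?E" by simp
      then show "y \<in> g ` ?E" using gh[of y] by (intro image_eqI[of _ _ "h y"]) simp_all
    qed (auto simp: hg)
    also have "\<dots> \<in> sets borel"
      using borel_measurable_continuous_onI[OF lipschitz_on_continuous_on[OF hlip]] Eborel
      by (rule measurable_sets)
    finally have gEs: "g ` ?E \<in> sets lebesgue" by auto
    have 1: "emeasure lebesgue (g ` ?E) \<le> ennreal p * emeasure lebesgue ?E"
      using emeasure_image_small_slopes[OF mono glip _ Es gEs] pq by (auto simp: E_def)
    have hgE: "h ` (g ` ?E) = ?E" using hg by (auto simp: image_image)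
    have 2: "emeasure lebesgue (h ` (g ` ?E)) \<le> ennreal (1/q) * emeasure lebesgue (g ` ?E)"
      using pq Es hgE by (intro emeasure_image_small_slopes[OF hmono hlip _ gEs]) (auto simp: E_def)
    have "emeasure lebesgue ?E \<le> emeasure lebesgue (cbox (-real n) (real n))"
      by (rule emeasure_mono) (auto simp: E_def)
    also have "\<dots> < \<infinity>" by simp
    finally have fin: "emeasure lebesgue ?E < \<infinity>" .
    then obtain m where m: "emeasure lebesgue ?E = ennreal m" "m \<ge> 0"
      by (cases "emeasure lebesgue ?E") auto
    have "ennreal m \<le> ennreal (1/q) * (ennreal p * ennreal m)"
      using 2 mult_left_mono[OF 1, of "ennreal (1/q)"] unfolding hgE m by (metis order_trans zero_le)
    also have "\<dots> = ennreal (1/q * (p * m))" using pq m by (simp add: ennreal_mult[symmetric])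
    finally have "m \<le> 1/q * (p * m)" using pq m by (simp add: ennreal_le_iff)
    then have "q * m \<le> p * m" using pq by (simp add: field_simps)
    then have "m = 0" using pq m by (simp add: mult_le_cancel_right)
    then show ?thesis using m Es by (auto simp: null_sets_def)
  qed
  define B where "B = (\<Union>p\<in>\<rat> \<inter> {0<..}. \<Union>q\<in>\<rat> \<inter> {p<..}. \<Union>n. E p q n)"
  have cQ: "countable (\<rat> \<inter> X)" for X :: "real set" by (rule countable_Int1[OF countable_rat])
  have "B \<in> null_sets lebesgue" unfolding B_def
    by (intro null_sets_UN' cQ Enull) auto
  moreover have "\<exists>D. (f has_real_derivative D) (at x)" if x: "x \<notin> B" for x
  proof -
    have "\<exists>D. (g has_real_derivative D) (at x)"
    proof (rule strict_mono_lipschitz_differentiable_at[OF lo hi])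
      fix p q :: real
      assume pq: "p \<in> \<rat>" "q \<in> \<rat>" "0 < p" "p < q" "small_slopes g p x"
      obtain n :: nat where n: "\<bar>x\<bar> \<le> real n" using real_arch_simple by blast
      have "x \<notin> E p q n" using x pq unfolding B_def by auto
      then have "\<not> small_slopes h (1/q) (g x)" using pq n by (auto simp: E_def)
      then obtain d where d: "d > 0"
        "\<And>c e. c < g x \<Longrightarrow> g x < e \<Longrightarrow> e - c < d \<Longrightarrow> \<not> h e - h c \<le> 1/q * (e - c)"
        unfolding small_slopes_def by blast
      have M: "M > 0" using L0 by (simp add: M_def)
      have "g e - g c \<le> q * (e - c)" if ce: "c < x" "x < e" "e - c < d / M" for c e
      proof -
        have "g e - g c \<le> M * (e - c)" using hi ce by auto
        also have "\<dots> < d" using ce M by (simp add: field_simps)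
        finally have "\<not> h (g e) - h (g c) \<le> 1/q * (g e - g c)"
          using ce strict_monoD[OF mono] by (intro d) auto
        then show ?thesis using pq by (simp add: hg field_simps)
      qed
      then show "\<exists>d>0. \<forall>c e. c < x \<longrightarrow> x < e \<longrightarrow> e - c < d \<longrightarrow> g e - g c \<le> q * (e - c)"
        using d M by (intro exI[of _ "d / M"]) auto
    qed auto
    then obtain D where D: "(g has_real_derivative D) (at x)" by blast
    have "((\<lambda>x. g x - (L + 1) * x) has_real_derivative D - (L + 1)) (at x)"
      using D by (auto intro!: derivative_eq_intros)
    then show ?thesis by (auto simp: g_def)
  qed
  ultimately show ?thesis by (intro AE_I'[of B]) auto
qed

section \<open>Kruzhkov entropies and their fluxes\<close>

text \<open>
  Smooth convex approximation of the absolute value; \<open>sabs d (t - k)\<close> plays the role of the entropy.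
\<close>

definition sabs :: "real \<Rightarrow> real \<Rightarrow> real" where "sabs d t = sqrt (t\<^sup>2 + d\<^sup>2)"

lemma sabs_pos: "d > 0 \<Longrightarrow> sabs d t > 0"
  by (simp add: sabs_def add_nonneg_pos)

lemma sabs_squared: "(sabs d t)\<^sup>2 = t\<^sup>2 + d\<^sup>2" by (simp add: sabs_def)

lemma sabs_ge: "d > 0 \<Longrightarrow> d \<le> sabs d t"
  unfolding sabs_def by (rule real_le_rsqrt) simp

lemma sabs_ge_abs: "\<bar>t\<bar> \<le> sabs d t"
  unfolding sabs_def by (rule real_le_rsqrt) simp

lemma sabs_le: "d > 0 \<Longrightarrow> sabs d t \<le> \<bar>t\<bar> + d"
  unfolding sabs_def by (rule real_le_lsqrt) (auto simp: power2_eq_square algebra_simps)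

lemma DERIV_sabs:
  assumes "d > 0"
  shows "((\<lambda>t. sabs d (t - k)) has_real_derivative (t - k) / sabs d (t - k)) (at t)"
proof -
  have "(t - k)\<^sup>2 + d\<^sup>2 > 0" using assms by (simp add: add_nonneg_pos)
  then show ?thesis unfolding sabs_def
    by (auto intro!: derivative_eq_intros) (simp add: field_simps)
qed

lemma DERIV_sabs':
  assumes "d > 0"
  shows "((\<lambda>t. (t - k) / sabs d (t - k)) has_real_derivative d\<^sup>2 / (sabs d (t - k)) ^ 3) (at t)"
proof -
  have p: "sabs d (t - k) > 0" using assms by (rule sabs_pos)
  have "((\<lambda>t. (t - k) / sabs d (t - k)) has_real_derivative
     (1 * sabs d (t - k) - (t - k) * ((t - k) / sabs d (t - k))) / (sabs d (t - k) * sabs d (t - k))) (at t)"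
    using p by (intro DERIV_divide DERIV_sabs assms) (auto intro!: derivative_eq_intros)
  also have "(1 * sabs d (t - k) - (t - k) * ((t - k) / sabs d (t - k))) / (sabs d (t - k) * sabs d (t - k))
      = ((sabs d (t - k))\<^sup>2 - (t - k)\<^sup>2) / (sabs d (t - k)) ^ 3"
    using p by (simp add: field_simps power2_eq_square power3_eq_cube)
  also have "\<dots> = d\<^sup>2 / (sabs d (t - k)) ^ 3" by (simp add: sabs_squared)
  finally show ?thesis .
qed

lemma deriv_sabs: "d > 0 \<Longrightarrow> deriv (\<lambda>t. sabs d (t - k)) = (\<lambda>t. (t - k) / sabs d (t - k))"
  by (rule ext) (rule DERIV_imp_deriv[OF DERIV_sabs])

lemma deriv_sabs_le_1: "d > 0 \<Longrightarrow> \<bar>t / sabs d t\<bar> \<le> 1"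
  using sabs_ge_abs[of t d] sabs_pos[of d t] by (simp add: abs_divide)

lemma deriv2_sabs_le: "d > 0 \<Longrightarrow> \<bar>d\<^sup>2 / (sabs d t) ^ 3\<bar> \<le> 1 / d"
proof -
  assume d: "d > 0"
  have "d ^ 3 \<le> sabs d t ^ 3" using sabs_ge[OF d, of t] d by (intro power_mono) auto
  then show ?thesis using d sabs_pos[OF d, of t]
    by (simp add: abs_divide field_simps power2_eq_square power3_eq_cube)
qed

lemma continuous_sabs: "continuous_on UNIV (sabs d)"
  unfolding sabs_def[abs_def] by (intro continuous_intros)

lemma C2_real_sabs:
  assumes "d > 0"
  shows "C2_real (\<lambda>t. sabs d (t - k))"
proof -
  have "deriv (\<lambda>t. (t - k) / sabs d (t - k)) = (\<lambda>t. d\<^sup>2 / (sabs d (t - k)) ^ 3)"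
    by (rule ext) (rule DERIV_imp_deriv[OF DERIV_sabs'[OF assms]])
  moreover have "continuous_on UNIV (\<lambda>t. d\<^sup>2 / (sabs d (t - k)) ^ 3)"
    using sabs_pos[OF assms]
    by (intro continuous_intros continuous_on_compose2[OF continuous_sabs]) (auto simp: less_imp_neq[symmetric])
  moreover have "(\<lambda>t. sabs d (t - k)) field_differentiable at t"
    "(\<lambda>t. (t - k) / sabs d (t - k)) field_differentiable at t" for t
    unfolding field_differentiable_def using DERIV_sabs[OF assms] DERIV_sabs'[OF assms] by blast+
  ultimately show ?thesis
    unfolding C2_real_def deriv_sabs[OF assms] by simp
qed

lemma convex_sabs:
  assumes "d > 0"
  shows "convex_on UNIV (\<lambda>t. sabs d (t - k))"
  by (rule f''_ge0_imp_convex[OF _ DERIV_sabs[OF assms] DERIV_sabs'[OF assms]])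
     (use sabs_pos[OF assms] in \<open>auto simp: less_imp_le\<close>)

lemma locally_lipschitz_imp_lipschitz_on_interval:
  fixes F :: "real \<Rightarrow> 'b::metric_space"
  assumes "locally_lipschitz F"
  obtains L where "L-lipschitz_on {a..b} F"
proof -
  have "local_lipschitz {0::real} {a..b} (\<lambda>_. F)"
  proof (rule local_lipschitzI)
    fix t x :: real
    obtain e L where e: "e > 0" "L-lipschitz_on (ball x e) F"
      using assms unfolding locally_lipschitz_def by blast
    have "cball x (e/2) \<inter> {a..b} \<subseteq> ball x e" using e by auto
    then have "L-lipschitz_on (cball x (e/2) \<inter> {a..b}) F" using e(2) lipschitz_on_subset by blast
    then show "\<exists>u>0. \<exists>L. \<forall>t\<in>cball t u \<inter> {0}. L-lipschitz_on (cball x u \<inter> {a..b}) F"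
      using e by (intro exI[of _ "e/2"]) auto
  qed
  from local_lipschitz_compact_implies_lipschitz[OF this] obtain L where "L-lipschitz_on {a..b} F"
    by auto
  then show ?thesis by (rule that)
qed

lemma locally_lipschitz_continuous: "locally_lipschitz F \<Longrightarrow> isCont F x"
proof -
  assume "locally_lipschitz F"
  then obtain e L where "e > 0" "L-lipschitz_on (ball x e) F" unfolding locally_lipschitz_def by blast
  then show ?thesis
    using lipschitz_on_continuous_on continuous_on_interior[of "ball x e" F x] by auto
qed

text \<open>
  Rademacher's theorem is applied to the truncations of \<open>F\<close>, which are globally Lipschitz.
\<close>

lemma locally_lipschitz_AE_differentiable:
  fixes F :: "real \<Rightarrow> real ^ 'n"
  assumes "locally_lipschitz F"
  shows "AE t in lebesgue. \<exists>D. ((\<lambda>r. F r $ i) has_real_derivative D) (at t)"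
proof -
  have "AE t in lebesgue. t \<in> {-real n<..<real n} \<longrightarrow> (\<exists>D. ((\<lambda>r. F r $ i) has_real_derivative D) (at t))" for n :: nat
  proof -
    obtain L where L: "L-lipschitz_on {-real n..real n} F"
      using locally_lipschitz_imp_lipschitz_on_interval[OF assms] .
    define c :: "real \<Rightarrow> real" where "c t = max (- real n) (min (real n) t)" for t
    have "L-lipschitz_on UNIV (\<lambda>t. F (c t) $ i)"
    proof (rule lipschitz_onI)
      fix x y :: real
      have "dist (F (c x) $ i) (F (c y) $ i) \<le> dist (F (c x)) (F (c y))" by (rule dist_vec_nth_le)
      also have "\<dots> \<le> L * dist (c x) (c y)" by (rule lipschitz_onD[OF L]) (auto simp: c_def)
      also have "\<dots> \<le> L * dist x y" using lipschitz_on_nonneg[OF L]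
        by (intro mult_left_mono) (auto simp: c_def dist_real_def max_def min_def)
      finally show "dist (F (c x) $ i) (F (c y) $ i) \<le> L * dist x y" .
    qed (rule lipschitz_on_nonneg[OF L])
    from Lipschitz_AE_differentiable[OF this] show ?thesis
    proof eventually_elim
      case (elim t)
      show ?case
      proof
        assume t: "t \<in> {-real n<..<real n}"
        from elim obtain D where D: "((\<lambda>t. F (c t) $ i) has_real_derivative D) (at t)" by blast
        have "((\<lambda>r. F r $ i) has_real_derivative D) (at t)"
          by (rule has_field_derivative_transform_within_open[OF D open_greaterThanLessThan t])
             (auto simp: c_def max_def min_def)
        then show "\<exists>D. ((\<lambda>r. F r $ i) has_real_derivative D) (at t)" by blast
      qed
    qed
  qed
  then have "AE t in lebesgue. \<forall>n::nat. t \<in> {-real n<..<real n} \<longrightarrow> (\<exists>D. ((\<lambda>r. F r $ i) has_real_derivative D) (at t))"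
    by (simp only: AE_all_countable) simp
  then show ?thesis
  proof eventually_elim
    case (elim t)
    obtain n :: nat where "\<bar>t\<bar> < real n" using reals_Archimedean2 by blast
    then show ?case using elim by (metis abs_less_iff greaterThanLessThan_iff minus_less_iff)
  qed
qed

text \<open>
  Integration by parts turns \<open>\<Phi>(t) = \<integral>\<^sub>k\<^sup>t \<eta>' F'\<close> into \<open>\<eta>'(t) (F(t) - F(k)) - P(t)\<close> with
  \<open>P' = \<eta>'' (F - F(k))\<close>. This formula does not involve \<open>F'\<close>, so that \<open>F\<close> need not be known to be the
  integral of its derivative. Since \<open>|F(t) - F(k)| \<le> L |t - k|\<close>, the correction \<open>P\<close> is at most
  \<open>L \<integral> \<eta>''(w) |w| dw\<close> over a half-line, that is \<open>L d\<close>.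
\<close>

lemma sabs_entropy_flux:
  fixes F :: "real \<Rightarrow> real ^ 'n"
  assumes F: "locally_lipschitz F" and d: "d > 0"
  obtains \<Phi> where "entropy_flux F (\<lambda>t. sabs d (t - k)) \<Phi>"
    "\<And>K L t. \<lbrakk>\<bar>k\<bar> \<le> K; \<bar>t\<bar> \<le> K; L-lipschitz_on {-K..K} F\<rbrakk> \<Longrightarrow>
       norm (\<Phi> t - ((t - k) / sabs d (t - k)) *\<^sub>R (F t - F k)) \<le> L * d"
proof -
  let ?e = "\<lambda>t. (t - k) / sabs d (t - k)" and ?e2 = "\<lambda>t. d\<^sup>2 / (sabs d (t - k)) ^ 3"
  have contF: "continuous_on UNIV F" using locally_lipschitz_continuous[OF F]
    by (simp add: continuous_at_imp_continuous_on)
  have "continuous_on UNIV (\<lambda>t. ?e2 t *\<^sub>R (F t - F k))"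
    using sabs_pos[OF d]
    by (intro continuous_intros continuous_on_compose2[OF continuous_sabs] contF) (auto simp: less_imp_neq[symmetric])
  then have "isCont (\<lambda>t. ?e2 t *\<^sub>R (F t - F k)) x" for x by (simp add: continuous_on_eq_continuous_at)
  then obtain P0 where P0: "\<And>t. (P0 has_vector_derivative ?e2 t *\<^sub>R (F t - F k)) (at t)"
    using einterval_antiderivative[of "-\<infinity>" "\<infinity>" "\<lambda>t. ?e2 t *\<^sub>R (F t - F k)"] by auto
  define P where "P t = P0 t - P0 k" for t
  have P: "(P has_vector_derivative ?e2 t *\<^sub>R (F t - F k)) (at t)" for t
    unfolding P_def using P0[of t] by (auto intro!: derivative_eq_intros)
  have Pcont: "continuous_on S P" for S
    using P has_vector_derivative_continuous continuous_at_imp_continuous_on by blast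
  define \<Phi> where "\<Phi> t = ?e t *\<^sub>R (F t - F k) - P t" for t
  show ?thesis
  proof (rule that[of \<Phi>])
    have "locally_lipschitz \<Phi>" unfolding locally_lipschitz_def
    proof
      fix x
      obtain e L where e: "e > 0" "L-lipschitz_on (ball x e) F"
        using F unfolding locally_lipschitz_def by blast
      have L0: "L \<ge> 0" using e(2) by (rule lipschitz_on_nonneg)
      define B where "B = norm (F x - F k) + L * e"
      have B0: "B \<ge> 0" using L0 e by (simp add: B_def)
      have B: "norm (F t - F k) \<le> B" if t: "t \<in> ball x e" for t
      proof -
        have "norm (F t - F x) \<le> L * dist t x"
          using lipschitz_onD[OF e(2) t, of x] e(1) by (simp add: dist_norm)
        also have "\<dots> \<le> L * e" using t L0 by (intro mult_left_mono) (auto simp: dist_commute)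
        finally show ?thesis using norm_triangle_ineq[of "F t - F x" "F x - F k"] by (simp add: B_def)
      qed
      have e1: "\<bar>?e s - ?e t\<bar> \<le> 1/d * \<bar>s - t\<bar>" for s t
        using field_differentiable_bound[of UNIV ?e ?e2 "1/d" s t] DERIV_sabs'[OF d] deriv2_sabs_le[OF d]
        by (auto simp: real_norm_def)
      have P1: "norm (P s - P t) \<le> (1/d * B) * norm (s - t)" if "s \<in> ball x e" "t \<in> ball x e" for s t
      proof (rule differentiable_bound[of "ball x e" P "\<lambda>t h. h *\<^sub>R (?e2 t *\<^sub>R (F t - F k))"])
        fix t assume t: "t \<in> ball x e"
        show "(P has_derivative (\<lambda>h. h *\<^sub>R (?e2 t *\<^sub>R (F t - F k)))) (at t within ball x e)"
          using P[of t] by (simp add: has_vector_derivative_def has_derivative_at_withinI)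
        have "norm (?e2 t *\<^sub>R (F t - F k)) \<le> 1/d * B"
          using deriv2_sabs_le[OF d, of "t - k"] B[OF t] d
          unfolding norm_scaleR by (intro mult_mono) auto
        then show "onorm (\<lambda>h. h *\<^sub>R (?e2 t *\<^sub>R (F t - F k))) \<le> 1/d * B"
          by (intro onorm_le) (metis mult.commute mult_left_mono norm_ge_zero norm_scaleR real_norm_def)
      qed (use that in auto)
      have "(1/d * B + L + 1/d * B)-lipschitz_on (ball x e) \<Phi>"
      proof (rule lipschitz_onI)
        fix s t assume st: "s \<in> ball x e" "t \<in> ball x e"
        have "?e s *\<^sub>R (F s - F k) - ?e t *\<^sub>R (F t - F k) = (?e s - ?e t) *\<^sub>R (F s - F k) + ?e t *\<^sub>R (F s - F t)"
          by (simp add: algebra_simps)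
        then have "norm (?e s *\<^sub>R (F s - F k) - ?e t *\<^sub>R (F t - F k)) \<le>
            \<bar>?e s - ?e t\<bar> * norm (F s - F k) + \<bar>?e t\<bar> * norm (F s - F t)"
          by (metis norm_scaleR norm_triangle_ineq)
        also have "\<dots> \<le> (1/d * \<bar>s - t\<bar>) * B + 1 * (L * \<bar>s - t\<bar>)"
          using e1 B[OF st(1)] deriv_sabs_le_1[OF d] lipschitz_onD[OF e(2) st] B0 L0 d
          by (intro add_mono mult_mono) (auto simp: dist_norm)
        finally have 1: "norm (?e s *\<^sub>R (F s - F k) - ?e t *\<^sub>R (F t - F k)) \<le> (1/d * B + L) * \<bar>s - t\<bar>"
          by (simp add: algebra_simps)
        have "\<Phi> s - \<Phi> t = (?e s *\<^sub>R (F s - F k) - ?e t *\<^sub>R (F t - F k)) - (P s - P t)"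
          by (simp add: \<Phi>_def)
        then have "norm (\<Phi> s - \<Phi> t) \<le> norm (?e s *\<^sub>R (F s - F k) - ?e t *\<^sub>R (F t - F k)) + norm (P s - P t)"
          by (metis norm_triangle_ineq4)
        also have "\<dots> \<le> (1/d * B + L) * \<bar>s - t\<bar> + (1/d * B) * \<bar>s - t\<bar>"
          using 1 P1[OF st] by simp
        finally show "dist (\<Phi> s) (\<Phi> t) \<le> (1/d * B + L + 1/d * B) * dist s t"
          by (simp add: dist_norm algebra_simps)
      qed (use B0 L0 d in auto)
      then show "\<exists>e>0. \<exists>L. L-lipschitz_on (ball x e) \<Phi>" using e by blast
    qed
    moreover have "AE t in lebesgue. \<exists>D. ((\<lambda>r. F r $ i) has_real_derivative D) (at t) \<and>
        ((\<lambda>r. \<Phi> r $ i) has_real_derivative deriv (\<lambda>t. sabs d (t - k)) t * D) (at t)" for i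
      using locally_lipschitz_AE_differentiable[OF F, of i]
    proof eventually_elim
      case (elim t)
      then obtain D where D: "((\<lambda>r. F r $ i) has_real_derivative D) (at t)" by blast
      have "((\<lambda>t. P t $ i) has_vector_derivative (?e2 t *\<^sub>R (F t - F k)) $ i) (at t)"
        by (rule bounded_linear.has_vector_derivative[OF bounded_linear_vec_nth P])
      then have Pi: "((\<lambda>t. P t $ i) has_real_derivative ?e2 t * (F t $ i - F k $ i)) (at t)"
        by (simp add: has_real_derivative_iff_has_vector_derivative)
      have "((\<lambda>t. ?e t * (F t $ i - F k $ i) - P t $ i) has_real_derivative
          (?e2 t * (F t $ i - F k $ i) + (D - 0) * ?e t) - ?e2 t * (F t $ i - F k $ i)) (at t)"
        by (intro DERIV_diff DERIV_mult DERIV_sabs'[OF d] D Pi DERIV_const)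
      then have "((\<lambda>r. \<Phi> r $ i) has_real_derivative deriv (\<lambda>t. sabs d (t - k)) t * D) (at t)"
        by (simp add: \<Phi>_def deriv_sabs[OF d] mult.commute)
      with D show ?case by blast
    qed
    ultimately show "entropy_flux F (\<lambda>t. sabs d (t - k)) \<Phi>" by (simp add: entropy_flux_def)
  next
    fix K L t assume kt: "\<bar>k\<bar> \<le> K" "\<bar>t\<bar> \<le> K" and L: "L-lipschitz_on {-K..K} F"
    have L0: "L \<ge> 0" using L by (rule lipschitz_on_nonneg)
    have bound: "norm (?e2 s *\<^sub>R (F s - F k)) \<le> L * (d\<^sup>2 * \<bar>s - k\<bar> / (sabs d (s - k)) ^ 3)" if "\<bar>s\<bar> \<le> K" for s
    proof -
      have "norm (F s - F k) \<le> L * \<bar>s - k\<bar>" using lipschitz_onD[OF L, of s k] that kt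
        unfolding dist_norm real_norm_def by (simp add: abs_le_iff[of s] abs_le_iff[of k])
      then have "?e2 s * norm (F s - F k) \<le> ?e2 s * (L * \<bar>s - k\<bar>)"
        using sabs_pos[OF d, of "s - k"] by (intro mult_left_mono) auto
      then show ?thesis using sabs_pos[OF d, of "s - k"] by (simp add: mult_ac)
    qed
    \<comment> \<open>the primitive of the bound for \<open>P'\<close>; the sign \<open>c\<close> is \<open>-1\<close> to the right of \<open>k\<close> and \<open>1\<close> to its left\<close>
    have Q: "((\<lambda>s. c * (L * d\<^sup>2 / sabs d (s - k))) has_vector_derivative - c * (L * (d\<^sup>2 * (s - k) / (sabs d (s - k)) ^ 3))) (at s)" for s c
    proof -
      have "((\<lambda>s. c * (L * d\<^sup>2 / sabs d (s - k))) has_real_derivative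
          c * ((0 * sabs d (s - k) - L * d\<^sup>2 * ((s - k) / sabs d (s - k))) / (sabs d (s - k) * sabs d (s - k)))) (at s)"
        using sabs_pos[OF d, of "s - k"]
        by (intro DERIV_cmult DERIV_divide DERIV_const DERIV_sabs[OF d]) auto
      also have "c * ((0 * sabs d (s - k) - L * d\<^sup>2 * ((s - k) / sabs d (s - k))) / (sabs d (s - k) * sabs d (s - k)))
          = - c * (L * (d\<^sup>2 * (s - k) / (sabs d (s - k)) ^ 3))"
        using sabs_pos[OF d, of "s - k"] by (simp add: field_simps power3_eq_cube)
      finally show ?thesis by (simp add: has_real_derivative_iff_has_vector_derivative)
    qed
    have Qc: "continuous_on S (\<lambda>s. c * (L * d\<^sup>2 / sabs d (s - k)))" for S c
      using Q has_vector_derivative_continuous continuous_at_imp_continuous_on by blast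
    have s0: "sabs d (k - k) = d" using d by (simp add: sabs_def)
    have nn: "L * d\<^sup>2 / sabs d (t - k) \<ge> 0" using L0 sabs_pos[OF d, of "t - k"] by simp
    have d2: "L * d\<^sup>2 / d = L * d" using d by (simp add: power2_eq_square)
    have "norm (P t) \<le> L * d"
    proof (cases t k rule: linorder_cases)
      case greater
      have "norm (P t - P k) \<le> (-1) * (L * d\<^sup>2 / sabs d (t - k)) - (-1) * (L * d\<^sup>2 / sabs d (k - k))"
      proof (rule differentiable_bound_general[OF greater Pcont Qc P Q])
        fix s assume s: "k < s" "s < t"
        then show "norm (?e2 s *\<^sub>R (F s - F k)) \<le> - (-1) * (L * (d\<^sup>2 * (s - k) / (sabs d (s - k)) ^ 3))"
          using bound[of s] kt by simp
      qed
      then show ?thesis using nn d2 unfolding s0 by (simp add: P_def)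
    next
      case less
      have "norm (P k - P t) \<le> 1 * (L * d\<^sup>2 / sabs d (k - k)) - 1 * (L * d\<^sup>2 / sabs d (t - k))"
      proof (rule differentiable_bound_general[OF less Pcont Qc P Q])
        fix s assume s: "t < s" "s < k"
        then have "\<bar>s\<bar> \<le> K" "\<bar>s - k\<bar> = - (s - k)" using kt by auto
        then show "norm (?e2 s *\<^sub>R (F s - F k)) \<le> - 1 * (L * (d\<^sup>2 * (s - k) / (sabs d (s - k)) ^ 3))"
          using bound[of s] by (simp only: mult_minus_left mult_minus_right mult_1_left minus_divide_left[symmetric])
      qed
      then show ?thesis using nn d2 unfolding s0 by (simp add: P_def norm_minus_commute)
    qed (use L0 d in \<open>simp add: P_def\<close>)
    then show "norm (\<Phi> t - ?e t *\<^sub>R (F t - F k)) \<le> L * d" by (simp add: \<Phi>_def)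
  qed
qed

section \<open>Test functions\<close>

lemma partial_deriv_eq:
  "(g has_derivative D) (at x) \<Longrightarrow> partial_deriv i g x = D (axis i 1)"
  by (simp add: partial_deriv_def frechet_derivative_at[symmetric])

lemma has_derivative_grad:
  fixes g :: "real ^ 'n \<Rightarrow> real"
  assumes "g differentiable (at x)"
  shows "(g has_derivative (\<lambda>h. grad g x \<bullet> h)) (at x)"
proof -
  from assms obtain D where D: "(g has_derivative D) (at x)" by (auto simp: differentiable_def)
  interpret D: bounded_linear D using D by (rule has_derivative_bounded_linear)
  have "D h = grad g x \<bullet> h" for h
  proof -
    have "D h = D (\<Sum>i\<in>UNIV. h $ i *\<^sub>R axis i 1)"
      using basis_expansion[of h] by (simp add: scalar_mult_eq_scaleR)
    also have "\<dots> = (\<Sum>i\<in>UNIV. h $ i * D (axis i 1))" by (simp add: D.sum D.scaleR)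
    finally show ?thesis by (simp add: grad_def partial_deriv_eq[OF D] inner_vec_def mult.commute)
  qed
  then have "D = (\<lambda>h. grad g x \<bullet> h)" by auto
  then show ?thesis using D by simp
qed

lemma C_k_Suc_imp: "C_k (Suc k) g \<Longrightarrow> C_k k g"
proof (induction k arbitrary: g)
  case 0
  then have "\<And>x. isCont g x" by (auto intro: differentiable_imp_continuous_within)
  then show ?case by (simp add: continuous_at_imp_continuous_on)
qed simp

lemma C_k_continuous: "C_k k g \<Longrightarrow> continuous_on UNIV g"
  by (induction k) (use C_k_Suc_imp in auto)

lemma partial_deriv_const: "partial_deriv i (\<lambda>x. c) = (\<lambda>x. 0)"
  by (rule ext) (simp add: partial_deriv_eq[OF has_derivative_const])

lemma C_k_const: "C_k k (\<lambda>x. c)"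
  by (induction k arbitrary: c) (simp_all add: partial_deriv_const)

lemma C_k_component: "C_k k (\<lambda>x :: real ^ 'n. x $ j)"
proof (cases k)
  case (Suc m)
  have D: "((\<lambda>x. x $ j) has_derivative (\<lambda>h. h $ j)) (at x)" for x :: "real ^ 'n"
    by (rule bounded_linear.has_derivative[OF bounded_linear_vec_nth has_derivative_ident])
  have "partial_deriv i (\<lambda>x. x $ j) = (\<lambda>x. axis i 1 $ j)" for i :: 'n
    by (rule ext) (simp add: partial_deriv_eq[OF D])
  then show ?thesis using D by (auto simp: Suc C_k_const differentiable_def)
qed (auto intro!: continuous_intros)

lemma C_k_add: "C_k k f \<Longrightarrow> C_k k g \<Longrightarrow> C_k k (\<lambda>x. f x + g x)"
proof (induction k arbitrary: f g)
  case (Suc k)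
  have "partial_deriv i (\<lambda>x. f x + g x) = (\<lambda>x. partial_deriv i f x + partial_deriv i g x)" for i
  proof
    fix x
    show "partial_deriv i (\<lambda>x. f x + g x) x = partial_deriv i f x + partial_deriv i g x"
      using Suc.prems unfolding partial_deriv_def
      by (subst frechet_derivative_at[symmetric, OF has_derivative_add])
        (auto simp: frechet_derivative_works[symmetric])
  qed
  then show ?case using Suc by (auto intro!: differentiable_add)
qed (auto intro!: continuous_intros)

lemma C_k_mult: "C_k k f \<Longrightarrow> C_k k g \<Longrightarrow> C_k k (\<lambda>x. f x * g x)"
proof (induction k arbitrary: f g)
  case (Suc k)
  have "partial_deriv i (\<lambda>x. f x * g x) = (\<lambda>x. f x * partial_deriv i g x + partial_deriv i f x * g x)" for i
  proof
    fix x
    show "partial_deriv i (\<lambda>x. f x * g x) x = f x * partial_deriv i g x + partial_deriv i f x * g x"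
      using Suc.prems unfolding partial_deriv_def
      by (subst frechet_derivative_at[symmetric, OF has_derivative_mult])
        (auto simp: frechet_derivative_works[symmetric])
  qed
  moreover have "C_k k f" "C_k k g" using Suc.prems C_k_Suc_imp by blast+
  ultimately show ?case using Suc by (auto intro!: differentiable_mult C_k_add)
qed (auto intro!: continuous_intros)

lemma C_k_sum: "(\<And>i. i \<in> A \<Longrightarrow> C_k k (f i)) \<Longrightarrow> C_k k (\<lambda>x. \<Sum>i\<in>A. f i x)"
  by (induction A rule: infinite_finite_induct) (auto intro: C_k_add C_k_const)

lemma partial_deriv_translate:
  "g differentiable (at (x - y)) \<Longrightarrow> partial_deriv i (\<lambda>x. g (x - y)) x = partial_deriv i g (x - y)"
proof -
  assume "g differentiable (at (x - y))"
  then obtain D where D: "(g has_derivative D) (at (x - y))" by (auto simp: differentiable_def)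
  have "((\<lambda>x. x - y) has_derivative (\<lambda>h. h)) (at x)" by (auto intro!: derivative_eq_intros)
  from has_derivative_compose[OF this D] show ?thesis
    by (simp add: partial_deriv_eq[OF D] partial_deriv_eq)
qed

lemma C_k_translate: "C_k k g \<Longrightarrow> C_k k (\<lambda>x. g (x - y))"
proof (induction k arbitrary: g)
  case 0
  then show ?case by (auto intro: continuous_on_compose2[of UNIV] intro!: continuous_intros)
next
  case (Suc k)
  have "(\<lambda>x. g (x - y)) differentiable (at x)" for x
    using Suc.prems by (intro differentiable_compose[of g "\<lambda>x. x - y"]) auto
  moreover have "partial_deriv i (\<lambda>x. g (x - y)) = (\<lambda>x. partial_deriv i g (x - y))" for i
    using Suc.prems by (intro ext partial_deriv_translate) auto
  ultimately show ?case using Suc by auto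
qed

text \<open>
  The functions \<open>P(1/t) exp(-1/t)\<close>, extended by \<open>0\<close> to \<open>t \<le> 0\<close>, are closed under differentiation, which is
  all that smoothness of \<open>exp(-1/t)\<close> amounts to.
\<close>

definition flat_exp :: "real poly \<Rightarrow> real \<Rightarrow> real" where
  "flat_exp P t = (if t > 0 then poly P (1 / t) * exp (- (1 / t)) else 0)"

lemma poly_times_exp_minus_tendsto_0: "((\<lambda>x. poly P x * exp (- x)) \<longlongrightarrow> (0::real)) at_top"
proof -
  have "((\<lambda>x. \<Sum>i\<le>degree P. coeff P i * (x ^ i / exp x)) \<longlongrightarrow> (\<Sum>i\<le>degree P. coeff P i * 0)) at_top"
    by (intro tendsto_intros tendsto_power_div_exp_0)
  then show ?thesis by (simp add: poly_altdef sum_distrib_right sum_divide_distrib exp_minus divide_inverse mult.assoc)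
qed

lemma flat_exp_has_derivative:
  "(flat_exp P has_real_derivative flat_exp ([:0, 0, 1:] * (P - pderiv P)) t) (at t)"
proof (cases t "0 :: real" rule: linorder_cases)
  case greater
  have "((\<lambda>t. poly P (1 / t) * exp (- (1 / t))) has_real_derivative
          flat_exp ([:0, 0, 1:] * (P - pderiv P)) t) (at t)"
    using greater
    by (auto intro!: derivative_eq_intros simp: flat_exp_def power2_eq_square field_simps)
  then show ?thesis
    by (rule has_field_derivative_transform_within_open[of _ _ _ "{0<..}"])
       (use greater in \<open>auto simp: flat_exp_def\<close>)
next
  case less
  have "((\<lambda>t. 0) has_real_derivative flat_exp ([:0, 0, 1:] * (P - pderiv P)) t) (at t)"
    using less by (auto simp: flat_exp_def)
  then show ?thesis
    by (rule has_field_derivative_transform_within_open[of _ _ _ "{..<0}"])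
       (use less in \<open>auto simp: flat_exp_def\<close>)
next
  case equal
  have r: "((\<lambda>h. flat_exp P h / h) \<longlongrightarrow> 0) (at_right 0)"
  proof -
    have "((\<lambda>h::real. poly ([:0, 1:] * P) (inverse h) * exp (- inverse h)) \<longlongrightarrow> 0) (at_right 0)"
      by (rule filterlim_compose[OF poly_times_exp_minus_tendsto_0 filterlim_inverse_at_top_right])
    moreover have "eventually (\<lambda>h. poly ([:0, 1:] * P) (inverse h) * exp (- inverse h) = flat_exp P h / h) (at_right 0)"
      unfolding eventually_at_right_field
      by (intro exI[of _ 1]) (auto simp: flat_exp_def field_simps)
    ultimately show ?thesis by (rule Lim_transform_eventually)
  qed
  have l: "((\<lambda>h. flat_exp P h / h) \<longlongrightarrow> 0) (at_left 0)"
  proof -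
    have "eventually (\<lambda>h. 0 = flat_exp P h / h) (at_left 0)"
      unfolding eventually_at_left_field by (intro exI[of _ "-1"]) (auto simp: flat_exp_def)
    then show ?thesis by (rule Lim_transform_eventually[OF tendsto_const])
  qed
  have "((\<lambda>h. flat_exp P h / h) \<longlongrightarrow> 0) (at 0)" using l r by (rule filterlim_split_at)
  then show ?thesis unfolding equal DERIV_def by (simp add: flat_exp_def)
qed

lemma C_k_flat_exp_compose:
  assumes "\<And>k. C_k k q"
  shows "C_k k (\<lambda>x. flat_exp P (q x))"
proof (induction k arbitrary: P)
  case 0
  have "continuous_on UNIV (flat_exp P)"
    using flat_exp_has_derivative DERIV_isCont continuous_at_imp_continuous_on by blast
  then show ?case using assms[of 0] by (auto intro: continuous_on_compose2)
next
  case (Suc k)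
  let ?Q = "[:0, 0, 1:] * (P - pderiv P)"
  have q: "q differentiable (at x)" for x using assms[of "Suc 0"] by simp
  have D: "((\<lambda>x. flat_exp P (q x)) has_derivative (\<lambda>h. flat_exp ?Q (q x) * frechet_derivative q (at x) h)) (at x)" for x
    using q[of x] has_derivative_compose[OF _ flat_exp_has_derivative[unfolded has_field_derivative_def], of q]
    by (simp add: frechet_derivative_works)
  have "partial_deriv i (\<lambda>x. flat_exp P (q x)) = (\<lambda>x. flat_exp ?Q (q x) * partial_deriv i q x)" for i
    by (rule ext) (simp add: partial_deriv_eq[OF D] partial_deriv_def)
  moreover have "C_k k (partial_deriv i q)" for i using assms[of "Suc k"] by simp
  moreover have "(\<lambda>x. flat_exp P (q x)) differentiable (at x)" for x
    using D unfolding differentiable_def by blast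
  ultimately show ?case using Suc by (auto intro!: C_k_mult)
qed

text \<open>
  Built from \<open>x \<bullet> x\<close> instead of the norm, so that the argument is a polynomial in the coordinates.
\<close>

definition bump :: "real \<Rightarrow> real ^ 'n \<Rightarrow> real" where
  "bump d x = flat_exp 1 (d\<^sup>2 - x \<bullet> x)"

lemma C_k_bump: "C_k k (bump d)"
  unfolding bump_def[abs_def]
proof (rule C_k_flat_exp_compose)
  fix k
  have "C_k k (\<lambda>x. d\<^sup>2 + (- 1) * (\<Sum>i\<in>UNIV. x $ i * x $ i))"
    by (intro C_k_add C_k_mult C_k_const C_k_sum C_k_component)
  then show "C_k k (\<lambda>x. d\<^sup>2 - x \<bullet> x)" by (simp add: inner_vec_def)
qed

lemma bump_nonneg: "bump d x \<ge> 0" by (simp add: bump_def flat_exp_def)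

lemma bump_minus: "bump d (- x) = bump d x" by (simp add: bump_def)

lemma bump_outside: "d > 0 \<Longrightarrow> norm x \<ge> d \<Longrightarrow> bump d x = 0"
  by (simp add: bump_def flat_exp_def dot_square_norm not_less)

lemma bump_pos_at_0: "d > 0 \<Longrightarrow> bump d 0 > 0" by (simp add: bump_def flat_exp_def)

lemma test_function_bump:
  assumes "d > 0"
  shows "test_function (bump d)"
proof -
  have "{x. bump d x \<noteq> 0} \<subseteq> cball 0 d" using bump_outside[OF assms] by force
  then have "bounded {x. bump d x \<noteq> 0}" using bounded_cball bounded_subset by blast
  then show ?thesis by (simp add: test_function_def C_k_bump)
qed

lemma test_function_translate:
  assumes "test_function g"
  shows "test_function (\<lambda>x. g (x - y))"
proof -
  have "bounded {x. g x \<noteq> 0}" using assms compact_closure by (auto simp: test_function_def)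
  moreover have "{x. g (x - y) \<noteq> 0} = (\<lambda>x. y + x) ` {x. g x \<noteq> 0}"
    by (auto simp: image_iff intro!: exI[of _ "_ - y"])
  ultimately have "bounded {x. g (x - y) \<noteq> 0}" by (simp add: bounded_translation)
  then show ?thesis using assms by (simp add: test_function_def C_k_translate)
qed

lemma test_function_differentiable: "test_function g \<Longrightarrow> g differentiable (at x)"
  unfolding test_function_def by (metis C_k.simps(2))

lemma partial_deriv_outside:
  fixes g :: "real ^ 'n \<Rightarrow> real"
  assumes "x \<notin> closure {x. g x \<noteq> 0}"
  shows "partial_deriv i g x = 0"
proof -
  have "((\<lambda>x. 0) has_derivative (\<lambda>h. 0)) (at x)" by simp
  then have "(g has_derivative (\<lambda>h. 0)) (at x)"
    by (rule has_derivative_transform_within_open[of _ _ _ _ "- closure {x. g x \<noteq> 0}"])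
       (use assms closure_subset[of "{x. g x \<noteq> 0}"] in auto)
  then show ?thesis by (simp add: partial_deriv_eq)
qed

lemma test_function_partial_deriv:
  assumes "test_function g"
  shows "test_function (partial_deriv i g)"
proof -
  have "\<And>k. C_k k (partial_deriv i g)" using assms C_k.simps(2) unfolding test_function_def by blast
  moreover have "{x. partial_deriv i g x \<noteq> 0} \<subseteq> closure {x. g x \<noteq> 0}"
    using partial_deriv_outside by blast
  then have "bounded {x. partial_deriv i g x \<noteq> 0}"
    using assms bounded_subset compact_imp_bounded unfolding test_function_def by blast
  ultimately show ?thesis by (simp add: test_function_def)
qed

lemma test_function_bounded:
  fixes g :: "real ^ 'n \<Rightarrow> real"
  assumes "test_function g"
  obtains M where "M \<ge> 0" "\<And>x. \<bar>g x\<bar> \<le> M"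
proof -
  let ?S = "closure {x. g x \<noteq> 0}"
  have "compact ?S" "continuous_on UNIV g"
    using assms C_k_continuous[of 0 g] by (auto simp: test_function_def)
  then have "bounded (g ` ?S)"
    by (meson compact_continuous_image compact_imp_bounded continuous_on_subset top_greatest)
  then obtain M where M: "M > 0" "\<And>x. x \<in> ?S \<Longrightarrow> \<bar>g x\<bar> \<le> M"
    by (auto simp: bounded_pos)
  have "\<bar>g x\<bar> \<le> M" for x
    using M closure_subset[of "{x. g x \<noteq> 0}"] by (cases "g x = 0") auto
  then show ?thesis using M that[of M] by simp
qed

lemma test_function_continuous: "test_function g \<Longrightarrow> continuous_on UNIV g"
  using C_k_continuous unfolding test_function_def by blast

lemma norm_grad_le: "norm (grad g x - grad g y) \<le> (\<Sum>i\<in>UNIV. \<bar>partial_deriv i g x - partial_deriv i g y\<bar>)"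
  using norm_le_l1_cart[of "grad g x - grad g y"] by (simp add: grad_def)

lemma test_function_grad_bounded:
  fixes g :: "real ^ 'n \<Rightarrow> real"
  assumes "test_function g"
  obtains M where "M \<ge> 0" "\<And>x. norm (grad g x) \<le> M"
proof -
  have "\<exists>M. M \<ge> 0 \<and> (\<forall>x. \<bar>partial_deriv i g x\<bar> \<le> M)" for i
    using test_function_bounded[OF test_function_partial_deriv[OF assms, of i]] by metis
  then obtain M where M: "\<And>i. M i \<ge> 0" "\<And>i x. \<bar>partial_deriv i g x\<bar> \<le> M i" by metis
  show ?thesis
  proof (rule that[of "\<Sum>i\<in>UNIV. M i"])
    show "norm (grad g x) \<le> (\<Sum>i\<in>UNIV. M i)" for x
      using norm_le_l1_cart[of "grad g x"] sum_mono[of UNIV "\<lambda>i. \<bar>partial_deriv i g x\<bar>" M] M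
      by (simp add: grad_def)
  qed (simp add: M sum_nonneg)
qed

lemma test_function_Lipschitz:
  fixes g :: "real ^ 'n \<Rightarrow> real"
  assumes "test_function g"
  obtains M where "M \<ge> 0" "\<And>x y. \<bar>g x - g y\<bar> \<le> M * norm (x - y)"
proof -
  obtain M where M: "M \<ge> 0" "\<And>x. norm (grad g x) \<le> M" by (rule test_function_grad_bounded[OF assms]) blast
  have "norm (g x - g y) \<le> M * norm (x - y)" for x y
  proof (rule differentiable_bound[of UNIV g "\<lambda>x h. grad g x \<bullet> h"])
    show "onorm ((\<bullet>) (grad g x)) \<le> M" for x
      using M(2)[of x] by (intro onorm_le) (metis Cauchy_Schwarz_ineq2 mult_right_mono norm_ge_zero order_trans real_norm_def)
  qed (auto intro: has_derivative_grad test_function_differentiable[OF assms])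
  then show ?thesis using that[of M] M by auto
qed

text \<open>
  The gradient is Lipschitz, and on the ball of radius \<open>|z|\<close> the derivative of the remainder is therefore
  at most a multiple of \<open>|z|\<close>.
\<close>

lemma test_function_Taylor:
  fixes g :: "real ^ 'n \<Rightarrow> real"
  assumes "test_function g"
  obtains M where "M \<ge> 0" "\<And>x z. \<bar>g (x + z) - g x - grad g x \<bullet> z\<bar> \<le> M * (norm z)\<^sup>2"
proof -
  have "\<exists>M. M \<ge> 0 \<and> (\<forall>x y. \<bar>partial_deriv i g x - partial_deriv i g y\<bar> \<le> M * norm (x - y))" for i
    using test_function_Lipschitz[OF test_function_partial_deriv[OF assms, of i]] by metis
  then obtain M where M: "\<And>i. M i \<ge> 0"
    "\<And>i x y. \<bar>partial_deriv i g x - partial_deriv i g y\<bar> \<le> M i * norm (x - y)" by metis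
  define K where "K = (\<Sum>i\<in>UNIV. M i)"
  have K0: "K \<ge> 0" by (simp add: K_def M sum_nonneg)
  have K: "norm (grad g x - grad g y) \<le> K * norm (x - y)" for x y
    unfolding K_def sum_distrib_right
    by (rule order_trans[OF norm_grad_le]) (intro sum_mono M)
  have "\<bar>g (x + z) - g x - grad g x \<bullet> z\<bar> \<le> K * (norm z)\<^sup>2" for x z
  proof -
    let ?k = "\<lambda>w. g (x + w) - grad g x \<bullet> w"
    have "norm (?k z - ?k 0) \<le> (K * norm z) * norm (z - 0)"
    proof (rule differentiable_bound[of "cball 0 (norm z)" ?k "\<lambda>w h. (grad g (x + w) - grad g x) \<bullet> h"])
      fix w :: "real ^ 'n" assume w: "w \<in> cball 0 (norm z)"
      have "((\<lambda>w. x + w) has_derivative (\<lambda>h. h)) (at w)" by (auto intro!: derivative_eq_intros)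
      from has_derivative_compose[OF this has_derivative_grad[OF test_function_differentiable[OF assms]]]
      have "(?k has_derivative (\<lambda>h. grad g (x + w) \<bullet> h - grad g x \<bullet> h)) (at w)"
        by (auto intro!: derivative_eq_intros)
      moreover have "(\<lambda>h. grad g (x + w) \<bullet> h - grad g x \<bullet> h) = (\<bullet>) (grad g (x + w) - grad g x)"
        by (simp add: inner_diff_left fun_eq_iff)
      ultimately show "(?k has_derivative (\<bullet>) (grad g (x + w) - grad g x)) (at w within cball 0 (norm z))"
        by (simp add: has_derivative_at_withinI)
      have "norm (grad g (x + w) - grad g x) \<le> K * norm w" using K[of "x + w" x] by simp
      also have "\<dots> \<le> K * norm z" using w K0 by (intro mult_left_mono) auto
      finally show "onorm ((\<bullet>) (grad g (x + w) - grad g x)) \<le> K * norm z"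
        by (intro onorm_le) (metis Cauchy_Schwarz_ineq2 mult_right_mono norm_ge_zero order_trans real_norm_def)
    qed auto
    then show ?thesis by (simp add: power2_eq_square mult.assoc)
  qed
  then show ?thesis using that[of K] K0 by auto
qed

lemma grad_translate:
  assumes "test_function g"
  shows "grad (\<lambda>x. g (x - y)) x = grad g (x - y)"
  by (simp add: grad_def partial_deriv_translate test_function_differentiable[OF assms])

lemma grad_minus:
  assumes g: "test_function g" and even: "\<And>x. g (- x) = g x"
  shows "grad g (- x) = - grad g x"
proof -
  have "(g has_derivative (\<lambda>h. grad g x \<bullet> h)) (at x)"
    using has_derivative_grad[OF test_function_differentiable[OF g]] .
  then have g1: "(g has_derivative (\<lambda>h. grad g x \<bullet> h)) (at (- (- x)))" by simp
  have "(uminus has_derivative uminus) (at (- x))" by (auto intro!: derivative_eq_intros)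
  from has_derivative_compose[OF this g1]
  have "(g has_derivative (\<lambda>h. grad g x \<bullet> (- h))) (at (- x))" by (simp add: even)
  then have "(\<lambda>h. grad g x \<bullet> (- h)) = (\<lambda>h. grad g (- x) \<bullet> h)"
    using has_derivative_grad[OF test_function_differentiable[OF g]] has_derivative_unique by blast
  then have "(- grad g x) \<bullet> h = grad g (- x) \<bullet> h" for h by (metis inner_minus_left inner_minus_right)
  then show ?thesis by (metis vector_eq_rdot)
qed

lemma test_function_measurable: "test_function \<phi> \<Longrightarrow> \<phi> \<in> borel_measurable borel"
  by (intro borel_measurable_continuous_onI test_function_continuous)

lemma test_function_grad_measurable: "test_function \<phi> \<Longrightarrow> grad \<phi> \<in> borel_measurable borel"
  unfolding grad_def[abs_def]
  by (intro borel_measurable_continuous_onI continuous_intros test_function_continuous test_function_partial_deriv)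

lemma integrable_bounded_outside:
  fixes g :: "'a::euclidean_space \<Rightarrow> real"
  assumes [measurable]: "g \<in> borel_measurable borel" and B: "\<And>x. \<bar>g x\<bar> \<le> B"
    and R: "\<And>x. norm x > R \<Longrightarrow> g x = 0"
  shows "integrable lborel g" and "(LINT x|lborel. \<bar>g x\<bar>) \<le> B * measure lborel (cball (0::'a) R)"
proof -
  have iB: "integrable lborel (\<lambda>x::'a. B * indicat_real (cball 0 R) x)"
    using emeasure_compact_finite[of "cball (0::'a) R"] by simp
  have le: "\<bar>g x\<bar> \<le> B * indicat_real (cball 0 R) x" for x
    using B[of x] R[of x] by (auto simp: indicator_def)
  show i: "integrable lborel g"
    by (rule Bochner_Integration.integrable_bound[OF iB])
       (use le in \<open>auto intro!: order_trans[OF _ abs_ge_self]\<close>)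
  have "(LINT x|lborel. \<bar>g x\<bar>) \<le> (LINT x|lborel. B * indicat_real (cball (0::'a) R) x)"
    using i iB le by (intro integral_mono) auto
  then show "(LINT x|lborel. \<bar>g x\<bar>) \<le> B * measure lborel (cball (0::'a) R)" by simp
qed

lemma integrable_mult_bounded:
  fixes g h :: "'a::euclidean_space \<Rightarrow> real"
  assumes "integrable lborel g" and [measurable]: "h \<in> borel_measurable borel" and B: "\<And>x. \<bar>h x\<bar> \<le> B"
  shows "integrable lborel (\<lambda>x. h x * g x)"
proof -
  have "B \<ge> 0" using B[of undefined] by linarith
  have "integrable lborel (\<lambda>x. B * g x)" using assms(1) by simp
  then show ?thesis
    by (rule Bochner_Integration.integrable_bound)
       (use assms(1) B \<open>B \<ge> 0\<close> in \<open>auto simp: abs_mult intro!: mult_right_mono\<close>)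
qed

lemma test_function_outside:
  fixes \<phi> :: "real ^ 'n \<Rightarrow> real"
  assumes "test_function \<phi>"
  obtains R where "\<And>x. norm x > R \<Longrightarrow> \<phi> x = 0" "\<And>x. norm x > R \<Longrightarrow> grad \<phi> x = 0" "R \<ge> 0"
proof -
  let ?S = "closure {x. \<phi> x \<noteq> 0}"
  from assms have "bounded ?S" by (auto simp: test_function_def compact_imp_bounded)
  then obtain R where R: "\<And>x. x \<in> ?S \<Longrightarrow> norm x \<le> R" by (auto simp: bounded_iff)
  show ?thesis
  proof (rule that[of "max R 0"])
    fix x :: "real ^ 'n" assume "norm x > max R 0"
    then have x: "x \<notin> ?S" using R by force
    then show "\<phi> x = 0" using closure_subset[of "{x. \<phi> x \<noteq> 0}"] by auto
    show "grad \<phi> x = 0" using partial_deriv_outside[OF x] by (simp add: grad_def vec_eq_iff)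
  qed simp
qed

lemma integrable_test_function:
  fixes \<phi> :: "real ^ 'n \<Rightarrow> real"
  assumes \<phi>: "test_function \<phi>"
  shows "integrable lborel \<phi>"
proof -
  obtain R where R: "\<And>x. norm x > R \<Longrightarrow> \<phi> x = 0" by (rule test_function_outside[OF \<phi>]) blast
  obtain M where M: "\<And>x. \<bar>\<phi> x\<bar> \<le> M" by (rule test_function_bounded[OF \<phi>]) blast
  show ?thesis by (rule integrable_bounded_outside(1)[OF test_function_measurable[OF \<phi>] M R])
qed

lemma integrable_norm_grad:
  fixes \<phi> :: "real ^ 'n \<Rightarrow> real"
  assumes \<phi>: "test_function \<phi>"
  shows "integrable lborel (\<lambda>x. norm (grad \<phi> x))"
proof -
  note [measurable] = test_function_grad_measurable[OF \<phi>]
  obtain R where R: "\<And>x. norm x > R \<Longrightarrow> grad \<phi> x = 0" by (rule test_function_outside[OF \<phi>]) blast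
  obtain M where M: "\<And>x. norm (grad \<phi> x) \<le> M" by (rule test_function_grad_bounded[OF \<phi>]) blast
  show ?thesis
  proof (rule integrable_bounded_outside(1))
    show "(\<lambda>x. norm (grad \<phi> x)) \<in> borel_measurable borel" by measurable
    show "\<bar>norm (grad \<phi> x)\<bar> \<le> M" for x using M by simp
    show "norm (grad \<phi> x) = 0" if "norm x > R" for x using R that by simp
  qed
qed

section \<open>Translations in the space of integrable functions\<close>

lemma nn_integral_lborel_translate:
  fixes g :: "'a::euclidean_space \<Rightarrow> ennreal"
  assumes [measurable]: "g \<in> borel_measurable borel"
  shows "(\<integral>\<^sup>+x. g (x + h) \<partial>lborel) = (\<integral>\<^sup>+x. g x \<partial>lborel)"
proof -
  have "(\<integral>\<^sup>+x. g x \<partial>lborel) = (\<integral>\<^sup>+x. g x \<partial>distr lborel borel ((+) h))"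
    by (simp add: lborel_distr_plus)
  also have "\<dots> = (\<integral>\<^sup>+x. g (h + x) \<partial>lborel)" by (rule nn_integral_distr) auto
  finally show ?thesis by (simp add: add.commute)
qed

lemma integrable_lborel_translate:
  fixes g :: "'a::euclidean_space \<Rightarrow> 'b::{banach, second_countable_topology}"
  assumes "integrable lborel g"
  shows "integrable lborel (\<lambda>x. g (x + h))"
proof -
  have "integrable (distr lborel borel ((+) h)) g" using assms by (simp add: lborel_distr_plus)
  then have "integrable lborel (\<lambda>x. g (h + x))" by (rule integrable_distr[rotated]) simp
  then show ?thesis by (simp add: add.commute)
qed

lemma integral_lborel_translate:
  fixes g :: "'a::euclidean_space \<Rightarrow> 'b::{banach, second_countable_topology}"
  assumes [measurable]: "g \<in> borel_measurable borel"
  shows "(LINT x|lborel. g (x + h)) = (LINT x|lborel. g x)"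
proof -
  have "(LINT x|lborel. g x) = (LINT x|distr lborel borel ((+) h). g x)"
    by (simp add: lborel_distr_plus)
  also have "\<dots> = (LINT x|lborel. g (h + x))" by (rule integral_distr) auto
  finally show ?thesis by (simp add: add.commute)
qed

lemma L1_translation_continuous_approx:
  fixes g :: "'a::euclidean_space \<Rightarrow> real"
  assumes g: "integrable lborel g"
    and approx: "\<And>e. e > 0 \<Longrightarrow> \<exists>g'. integrable lborel g' \<and> (LINT x|lborel. \<bar>g x - g' x\<bar>) \<le> e \<and>
      ((\<lambda>h. LINT x|lborel. \<bar>g' (x + h) - g' x\<bar>) \<longlongrightarrow> 0) (at 0)"
  shows "((\<lambda>h. LINT x|lborel. \<bar>g (x + h) - g x\<bar>) \<longlongrightarrow> 0) (at 0)"
proof (rule tendstoI)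
  fix e :: real assume e: "e > 0"
  then obtain g' where g': "integrable lborel g'" "(LINT x|lborel. \<bar>g x - g' x\<bar>) \<le> e / 4"
    "((\<lambda>h. LINT x|lborel. \<bar>g' (x + h) - g' x\<bar>) \<longlongrightarrow> 0) (at 0)" using approx[of "e/4"] by auto
  have "eventually (\<lambda>h. dist (LINT x|lborel. \<bar>g' (x + h) - g' x\<bar>) 0 < e / 4) (at 0)"
    using e by (intro tendstoD[OF g'(3)]) auto
  then show "eventually (\<lambda>h. dist (LINT x|lborel. \<bar>g (x + h) - g x\<bar>) 0 < e) (at 0)"
  proof eventually_elim
    case (elim h)
    note [simp] = g g'(1) integrable_lborel_translate
    have i: "integrable lborel (\<lambda>x. \<bar>g x - g' x\<bar>)" by simp
    have "(LINT x|lborel. \<bar>g (x + h) - g x\<bar>) \<le>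
        (LINT x|lborel. \<bar>g (x + h) - g' (x + h)\<bar> + \<bar>g' (x + h) - g' x\<bar> + \<bar>g x - g' x\<bar>)"
      by (intro integral_mono) auto
    also have "\<dots> = (LINT x|lborel. \<bar>g (x + h) - g' (x + h)\<bar>) + (LINT x|lborel. \<bar>g' (x + h) - g' x\<bar>)
        + (LINT x|lborel. \<bar>g x - g' x\<bar>)"
      using integrable_lborel_translate[OF i, of h] by simp
    also have "(LINT x|lborel. \<bar>g (x + h) - g' (x + h)\<bar>) = (LINT x|lborel. \<bar>g x - g' x\<bar>)"
      using borel_measurable_integrable[OF i] integral_lborel_translate[of "\<lambda>x. \<bar>g x - g' x\<bar>" h] by simp
    finally show ?case using g'(2) elim e by (simp add: dist_real_def)
  qed
qed

text \<open>
  For open \<open>U\<close> the set \<open>U\<close> minus its translate shrinks to the empty set pointwise. The other half of the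
  symmetric difference is a translate of the same expression with \<open>-h\<close> in place of \<open>h\<close>.
\<close>

lemma L1_translation_continuous_open:
  fixes U :: "'a::euclidean_space set"
  assumes U: "open U" "emeasure lborel U < \<infinity>"
  shows "((\<lambda>h. LINT x|lborel. \<bar>indicat_real U (x + h) - indicat_real U x\<bar>) \<longlongrightarrow> 0) (at 0)"
proof -
  define J where "J h = (LINT x|lborel. indicat_real U x * (1 - indicat_real U (x + h)))" for h
  have [measurable]: "U \<in> sets borel" using U by auto
  have iU: "integrable lborel (indicat_real U)" using U by simp
  have ii: "integrable lborel (\<lambda>x. indicat_real U x * (1 - indicat_real U (x + h)))" for h
    by (rule Bochner_Integration.integrable_bound[OF iU]) (auto simp: indicator_def)
  have J0: "(J \<longlongrightarrow> 0) (at 0)"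
  proof (subst LIMSEQ_SEQ_conv[symmetric], intro allI impI)
    fix S :: "nat \<Rightarrow> 'a" assume S: "(\<forall>n. S n \<noteq> 0) \<and> S \<longlonglongrightarrow> 0"
    have "(\<lambda>n. LINT x|lborel. indicat_real U x * (1 - indicat_real U (x + S n))) \<longlonglongrightarrow> (LINT x|(lborel::'a measure). (0::real))"
    proof (rule integral_dominated_convergence[where w="indicat_real U"])
      show "AE x in lborel. (\<lambda>n. indicat_real U x * (1 - indicat_real U (x + S n))) \<longlonglongrightarrow> (0::real)"
      proof (rule AE_I2)
        fix x
        show "(\<lambda>n. indicat_real U x * (1 - indicat_real U (x + S n))) \<longlonglongrightarrow> (0::real)"
        proof (cases "x \<in> U")
          case True
          have "(\<lambda>n. x + S n) \<longlonglongrightarrow> x + 0" using S by (intro tendsto_intros) auto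
          then have "eventually (\<lambda>n. x + S n \<in> U) sequentially"
            using U True by (intro topological_tendstoD) auto
          then have "eventually (\<lambda>n. indicat_real U x * (1 - indicat_real U (x + S n)) = 0) sequentially"
            by eventually_elim simp
          then show ?thesis by (rule tendsto_eventually)
        qed simp
      qed
    qed (use iU in \<open>auto simp: indicator_def\<close>)
    then show "(\<lambda>n. J (S n)) \<longlonglongrightarrow> 0" by (simp add: J_def)
  qed
  have "(uminus \<longlongrightarrow> - 0) (at (0::'a))" by (intro tendsto_intros)
  then have "filterlim uminus (at 0) (at (0::'a))"
    by (auto simp: filterlim_at eventually_at_filter)
  then have "((\<lambda>h. J (- h)) \<longlongrightarrow> 0) (at 0)" by (rule filterlim_compose[OF J0])
  then have "((\<lambda>h. J h + J (- h)) \<longlongrightarrow> 0 + 0) (at 0)" using J0 by (intro tendsto_add)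
  moreover have "(LINT x|lborel. \<bar>indicat_real U (x + h) - indicat_real U x\<bar>) = J h + J (- h)" for h
  proof -
    have "J (- h) = (LINT x|lborel. indicat_real U (x + h) * (1 - indicat_real U (x + h + (- h))))"
      unfolding J_def
      by (rule integral_lborel_translate[of "\<lambda>x. indicat_real U x * (1 - indicat_real U (x + (- h)))", symmetric]) measurable
    moreover have "integrable lborel (\<lambda>x. indicat_real U (x + h) * (1 - indicat_real U (x + h + (- h))))"
      by (rule integrable_lborel_translate[OF ii])
    moreover have "\<bar>indicat_real U (x + h) - indicat_real U x\<bar> =
        indicat_real U x * (1 - indicat_real U (x + h)) + indicat_real U (x + h) * (1 - indicat_real U (x + h + (- h)))" for x
      by (auto simp: indicator_def)
    ultimately show ?thesis unfolding J_def using ii by simp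
  qed
  ultimately show ?thesis by simp
qed

text \<open>
  Approximation by open sets of finite measure, then by simple functions.
\<close>

theorem L1_translation_continuous:
  fixes g :: "'a::euclidean_space \<Rightarrow> real"
  assumes "integrable lborel g"
  shows "((\<lambda>h. LINT x|lborel. \<bar>g (x + h) - g x\<bar>) \<longlongrightarrow> 0) (at 0)"
  using assms
proof (induction g rule: integrable_induct)
  case (base A c)
  have iA: "integrable lborel (indicat_real A)" using base by simp
  have "((\<lambda>h. LINT x|lborel. \<bar>indicat_real A (x + h) - indicat_real A x\<bar>) \<longlongrightarrow> 0) (at 0)"
  proof (rule L1_translation_continuous_approx[OF iA])
    fix e :: real assume e: "e > 0"
    obtain U where U: "open U" "A \<subseteq> U" "emeasure lborel (U - A) < ennreal e"
      using outer_regular_lborel[of A e] base e by auto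
    have Us: "U \<in> sets lborel" using U by auto
    have "emeasure lborel U = emeasure lborel A + emeasure lborel (U - A)"
      using U base Us by (subst plus_emeasure) (auto simp: Un_absorb1)
    also have "\<dots> < \<infinity>" using base U(3) by (simp add: order_less_trans[OF _ ennreal_less_top])
    finally have fin: "emeasure lborel U < \<infinity>" .
    have "(LINT x|lborel. \<bar>indicat_real A x - indicat_real U x\<bar>) = (LINT x|lborel. indicat_real (U - A) x)"
      using U by (intro Bochner_Integration.integral_cong) (auto simp: indicator_def)
    also have "\<dots> = measure lborel (U - A)" by simp
    also have "\<dots> \<le> e" using U(3) e by (simp add: measure_def enn2real_leI less_imp_le)
    finally show "\<exists>g'. integrable lborel g' \<and> (LINT x|lborel. \<bar>indicat_real A x - g' x\<bar>) \<le> e \<and>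
      ((\<lambda>h. LINT x|lborel. \<bar>g' (x + h) - g' x\<bar>) \<longlongrightarrow> 0) (at 0)"
      using L1_translation_continuous_open[OF U(1) fin] fin Us
      by (intro exI[of _ "indicat_real U"]) simp
  qed
  then have "((\<lambda>h. \<bar>c\<bar> * (LINT x|lborel. \<bar>indicat_real A (x + h) - indicat_real A x\<bar>)) \<longlongrightarrow> \<bar>c\<bar> * 0) (at 0)"
    by (intro tendsto_intros)
  moreover have "\<bar>c\<bar> * (LINT x|lborel. \<bar>indicat_real A (x + h) - indicat_real A x\<bar>)
     = (LINT x|lborel. \<bar>indicat_real A (x + h) *\<^sub>R c - indicat_real A x *\<^sub>R c\<bar>)" for h
    by (subst integral_mult_right_zero[symmetric])
       (auto simp: right_diff_distrib[symmetric] abs_mult mult.commute intro!: Bochner_Integration.integral_cong)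
  ultimately show ?case by simp
next
  case (add f g)
  note [simp] = add.hyps integrable_lborel_translate
  show ?case
  proof (rule tendsto_sandwich[OF always_eventually always_eventually tendsto_const])
    show "((\<lambda>h. (LINT x|lborel. \<bar>f (x + h) - f x\<bar>) + (LINT x|lborel. \<bar>g (x + h) - g x\<bar>)) \<longlongrightarrow> 0) (at 0)"
      using tendsto_add[OF add.IH] by simp
    show "\<forall>h. (LINT x|lborel. \<bar>f (x + h) + g (x + h) - (f x + g x)\<bar>) \<le>
      (LINT x|lborel. \<bar>f (x + h) - f x\<bar>) + (LINT x|lborel. \<bar>g (x + h) - g x\<bar>)"
    proof
      fix h
      have "(LINT x|lborel. \<bar>f (x + h) + g (x + h) - (f x + g x)\<bar>) \<le>
          (LINT x|lborel. \<bar>f (x + h) - f x\<bar> + \<bar>g (x + h) - g x\<bar>)"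
        by (intro integral_mono) auto
      then show "(LINT x|lborel. \<bar>f (x + h) + g (x + h) - (f x + g x)\<bar>) \<le>
          (LINT x|lborel. \<bar>f (x + h) - f x\<bar>) + (LINT x|lborel. \<bar>g (x + h) - g x\<bar>)"
        by (subst (asm) Bochner_Integration.integral_add) auto
    qed
  qed simp
next
  case (lim f s)
  show ?case
  proof (rule L1_translation_continuous_approx[OF lim.hyps(4)])
    fix e :: real assume e: "e > 0"
    have "(\<lambda>i. LINT x|lborel. \<bar>f x - s i x\<bar>) \<longlonglongrightarrow> (LINT x|(lborel::'a measure). (0::real))"
    proof (rule integral_dominated_convergence[where w="\<lambda>x. 3 * \<bar>f x\<bar>"])
      show "AE x in lborel. (\<lambda>i. \<bar>f x - s i x\<bar>) \<longlonglongrightarrow> 0"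
        using lim.hyps(2) by (intro AE_I2 tendsto_rabs_zero) (auto intro!: tendsto_eq_intros)
      show "AE x in lborel. norm \<bar>f x - s i x\<bar> \<le> 3 * \<bar>f x\<bar>" for i
      proof (rule AE_I2)
        fix x :: 'a
        show "norm \<bar>f x - s i x\<bar> \<le> 3 * \<bar>f x\<bar>" using lim.hyps(3)[of x i] by simp
      qed
    qed (use lim.hyps in auto)
    then have "eventually (\<lambda>i. (LINT x|lborel. \<bar>f x - s i x\<bar>) < e) sequentially"
      using e by (auto dest!: order_tendstoD(2)[where a=e])
    then obtain i where "(LINT x|lborel. \<bar>f x - s i x\<bar>) < e" by (auto simp: eventually_sequentially)
    then show "\<exists>g'. integrable lborel g' \<and> (LINT x|lborel. \<bar>f x - g' x\<bar>) \<le> e \<and>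
      ((\<lambda>h. LINT x|lborel. \<bar>g' (x + h) - g' x\<bar>) \<longlongrightarrow> 0) (at 0)"
      using lim by (intro exI[of _ "s i"]) auto
  qed
qed

lemma lborel_distr_reflect: "distr lborel borel (\<lambda>x. t - x) = (lborel :: 'a::euclidean_space measure)"
  using lborel_affine[of "-1" t] by (simp add: density_1)

lemma nn_integral_lborel_reflect:
  fixes g :: "'a::euclidean_space \<Rightarrow> ennreal"
  assumes [measurable]: "g \<in> borel_measurable borel"
  shows "(\<integral>\<^sup>+x. g (t - x) \<partial>lborel) = (\<integral>\<^sup>+x. g x \<partial>lborel)"
proof -
  have "(\<integral>\<^sup>+x. g x \<partial>lborel) = (\<integral>\<^sup>+x. g x \<partial>distr lborel borel (\<lambda>x. t - x))"
    by (simp add: lborel_distr_reflect)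
  also have "\<dots> = (\<integral>\<^sup>+x. g (t - x) \<partial>lborel)" by (rule nn_integral_distr) auto
  finally show ?thesis by simp
qed

lemma integral_lborel_reflect:
  fixes g :: "'a::euclidean_space \<Rightarrow> real"
  assumes [measurable]: "g \<in> borel_measurable borel"
  shows "(LINT x|lborel. g (t - x)) = (LINT x|lborel. g x)"
proof -
  have "(LINT x|lborel. g x) = (LINT x|distr lborel borel (\<lambda>x. t - x). g x)"
    by (simp add: lborel_distr_reflect)
  also have "\<dots> = (LINT x|lborel. g (t - x))" by (rule integral_distr) auto
  finally show ?thesis by simp
qed

lemma AE_lborel_translate:
  fixes P :: "'a::euclidean_space \<Rightarrow> bool"
  assumes "AE x in lborel. P x"
  shows "AE z in lborel. P (x + z)"
proof -
  obtain N where N: "N \<in> null_sets lborel" "{x. \<not> P x} \<subseteq> N"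
    using assms by (auto elim!: AE_E simp: null_sets_def)
  then have [measurable]: "N \<in> sets borel" by auto
  have "(\<integral>\<^sup>+z. indicator N (z + x) \<partial>lborel) = (\<integral>\<^sup>+z. indicator N z \<partial>lborel)"
    by (rule nn_integral_lborel_translate) measurable
  also have "\<dots> = 0" using N(1) by (simp add: null_sets_def)
  finally have "AE z in lborel. indicator N (z + x) = (0::ennreal)"
    by (subst (asm) nn_integral_0_iff_AE) measurable
  then show ?thesis
  proof eventually_elim
    case (elim z)
    then have "x + z \<notin> N" by (auto simp: add.commute indicator_def split: if_splits)
    then show ?case using N by blast
  qed
qed

section \<open>Integrals over pairs of points\<close>

text \<open>
  The majorant for all integrals over pairs \<open>(x, y)\<close> below: functions of \<open>x\<close> or of \<open>y\<close> that are integrable,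
  times an integrable function of \<open>x - y\<close>. This replaces any cut-off in space.
\<close>

lemma integrable_pair_kernel:
  fixes p q \<kappa> :: "'a::euclidean_space \<Rightarrow> real"
  assumes p: "integrable lborel p" and q: "integrable lborel q" and k: "integrable lborel \<kappa>"
  shows "integrable (lborel \<Otimes>\<^sub>M lborel) (\<lambda>(x, y). (p x + q y) * \<kappa> (x - y))"
proof -
  have [measurable]: "p \<in> borel_measurable borel" "q \<in> borel_measurable borel" "\<kappa> \<in> borel_measurable borel"
    using p q k by (auto dest: borel_measurable_integrable)
  have K: "(\<integral>\<^sup>+h. ennreal \<bar>\<kappa> h\<bar> \<partial>lborel) < \<infinity>" using k by (simp add: integrable_iff_bounded)
  have 1: "integrable (lborel \<Otimes>\<^sub>M lborel) (\<lambda>(x, y). p x * \<kappa> (x - y))"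
  proof (rule integrableI_bounded)
    have "(\<integral>\<^sup>+z. ennreal (norm (case z of (x, y) \<Rightarrow> p x * \<kappa> (x - y))) \<partial>(lborel \<Otimes>\<^sub>M lborel))
        = (\<integral>\<^sup>+x. \<integral>\<^sup>+y. ennreal \<bar>p x\<bar> * ennreal \<bar>\<kappa> (x - y)\<bar> \<partial>lborel \<partial>lborel)"
      by (subst lborel.nn_integral_fst[symmetric]) (auto simp: abs_mult ennreal_mult)
    also have "\<dots> = (\<integral>\<^sup>+x. ennreal \<bar>p x\<bar> * (\<integral>\<^sup>+h. ennreal \<bar>\<kappa> h\<bar> \<partial>lborel) \<partial>lborel)"
      using nn_integral_lborel_reflect[of "\<lambda>h. ennreal \<bar>\<kappa> h\<bar>"] by (simp add: nn_integral_cmult)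
    also have "\<dots> = (\<integral>\<^sup>+x. ennreal \<bar>p x\<bar> \<partial>lborel) * (\<integral>\<^sup>+h. ennreal \<bar>\<kappa> h\<bar> \<partial>lborel)"
      by (rule nn_integral_multc) simp
    also have "\<dots> < \<infinity>" using K p by (simp add: integrable_iff_bounded ennreal_mult_less_top)
    finally show "(\<integral>\<^sup>+z. ennreal (norm (case z of (x, y) \<Rightarrow> p x * \<kappa> (x - y))) \<partial>(lborel \<Otimes>\<^sub>M lborel)) < \<infinity>" .
  qed measurable
  have 2: "integrable (lborel \<Otimes>\<^sub>M lborel) (\<lambda>(x, y). q y * \<kappa> (x - y))"
  proof (rule integrableI_bounded)
    have "(\<integral>\<^sup>+z. ennreal (norm (case z of (x, y) \<Rightarrow> q y * \<kappa> (x - y))) \<partial>(lborel \<Otimes>\<^sub>M lborel))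
        = (\<integral>\<^sup>+y. \<integral>\<^sup>+x. ennreal \<bar>q y\<bar> * ennreal \<bar>\<kappa> (x - y)\<bar> \<partial>lborel \<partial>lborel)"
      by (subst lborel_pair.nn_integral_snd[symmetric]) (auto simp: abs_mult ennreal_mult)
    also have "\<dots> = (\<integral>\<^sup>+y. ennreal \<bar>q y\<bar> * (\<integral>\<^sup>+h. ennreal \<bar>\<kappa> h\<bar> \<partial>lborel) \<partial>lborel)"
      using nn_integral_lborel_translate[of "\<lambda>h. ennreal \<bar>\<kappa> h\<bar>" "- y" for y] by (simp add: nn_integral_cmult)
    also have "\<dots> = (\<integral>\<^sup>+y. ennreal \<bar>q y\<bar> \<partial>lborel) * (\<integral>\<^sup>+h. ennreal \<bar>\<kappa> h\<bar> \<partial>lborel)"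
      by (rule nn_integral_multc) simp
    also have "\<dots> < \<infinity>" using K q by (simp add: integrable_iff_bounded ennreal_mult_less_top)
    finally show "(\<integral>\<^sup>+z. ennreal (norm (case z of (x, y) \<Rightarrow> q y * \<kappa> (x - y))) \<partial>(lborel \<Otimes>\<^sub>M lborel)) < \<infinity>" .
  qed measurable
  from Bochner_Integration.integrable_add[OF 1 2] show ?thesis
    by (simp add: case_prod_beta' distrib_right)
qed

lemma integral_pair_kernel:
  fixes p \<kappa> :: "'a::euclidean_space \<Rightarrow> real"
  assumes p: "integrable lborel p" and q: "integrable lborel q" and k: "integrable lborel \<kappa>"
    and nn: "\<And>x. p x \<ge> 0" "\<And>x. q x \<ge> 0" "\<And>x. \<kappa> x \<ge> 0"
  shows "(LINT z|(lborel \<Otimes>\<^sub>M lborel). (case z of (x, y) \<Rightarrow> (p x + q y) * \<kappa> (x - y)))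
    = ((LINT x|lborel. p x) + (LINT x|lborel. q x)) * (LINT h|lborel. \<kappa> h)"
proof -
  note [measurable] = borel_measurable_integrable[OF p] borel_measurable_integrable[OF q] borel_measurable_integrable[OF k]
  have ip: "integrable (lborel \<Otimes>\<^sub>M lborel) (\<lambda>(x, y). p x * \<kappa> (x - y))"
    using integrable_pair_kernel[OF p _ k, of "\<lambda>_. 0"] by simp
  have iq: "integrable (lborel \<Otimes>\<^sub>M lborel) (\<lambda>(x, y). q y * \<kappa> (x - y))"
    using integrable_pair_kernel[OF _ q k, of "\<lambda>_. 0"] by simp
  have refl: "(LINT y|lborel. \<kappa> (x - y)) = (LINT h|lborel. \<kappa> h)" for x
  proof -
    have "ennreal (LINT y|lborel. \<kappa> (x - y)) = ennreal (LINT h|lborel. \<kappa> h)"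
      using nn_integral_lborel_reflect[of "\<lambda>h. ennreal (\<kappa> h)" x] k nn
      by (subst (1 2) integral_eq_nn_integral) auto
    then show ?thesis using nn by (simp add: integral_nonneg_AE)
  qed
  have 1: "(LINT z|(lborel \<Otimes>\<^sub>M lborel). (case z of (x, y) \<Rightarrow> p x * \<kappa> (x - y))) = (LINT x|lborel. p x) * (LINT h|lborel. \<kappa> h)"
    using lborel_pair.integral_fst'[OF ip] by (simp add: refl)
  have 2: "(LINT z|(lborel \<Otimes>\<^sub>M lborel). (case z of (x, y) \<Rightarrow> q y * \<kappa> (x - y))) = (LINT x|lborel. q x) * (LINT h|lborel. \<kappa> h)"
    using lborel_pair.integral_snd[OF iq] integral_lborel_translate[of \<kappa> "- y" for y] by simp
  have "(LINT z|(lborel \<Otimes>\<^sub>M lborel). (case z of (x, y) \<Rightarrow> (p x + q y) * \<kappa> (x - y))) =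
     (LINT z|(lborel \<Otimes>\<^sub>M lborel). (case z of (x, y) \<Rightarrow> p x * \<kappa> (x - y)) + (case z of (x, y) \<Rightarrow> q y * \<kappa> (x - y)))"
    by (intro Bochner_Integration.integral_cong) (auto simp: algebra_simps)
  also have "\<dots> = (LINT z|(lborel \<Otimes>\<^sub>M lborel). (case z of (x, y) \<Rightarrow> p x * \<kappa> (x - y))) +
      (LINT z|(lborel \<Otimes>\<^sub>M lborel). (case z of (x, y) \<Rightarrow> q y * \<kappa> (x - y)))"
    by (rule Bochner_Integration.integral_add[OF ip iq])
  finally show ?thesis by (simp add: 1 2 distrib_right)
qed

lemma integrable_pair_bounded:
  fixes p q \<kappa> :: "'a::euclidean_space \<Rightarrow> real" and g :: "'a \<times> 'a \<Rightarrow> real"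
  assumes p: "integrable lborel p" and q: "integrable lborel q" and k: "integrable lborel \<kappa>"
    and g: "g \<in> borel_measurable (lborel \<Otimes>\<^sub>M lborel)"
    and le: "\<And>x y. \<bar>g (x, y)\<bar> \<le> (p x + q y) * \<kappa> (x - y)"
  shows "integrable (lborel \<Otimes>\<^sub>M lborel) g"
proof (rule Bochner_Integration.integrable_bound[OF integrable_pair_kernel[OF p q k] g])
  show "AE z in lborel \<Otimes>\<^sub>M lborel. norm (g z) \<le> norm (case z of (x, y) \<Rightarrow> (p x + q y) * \<kappa> (x - y))"
  proof (rule AE_I2)
    fix z :: "'a \<times> 'a"
    show "norm (g z) \<le> norm (case z of (x, y) \<Rightarrow> (p x + q y) * \<kappa> (x - y))"
      using le[of "fst z" "snd z"] by (cases z) auto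
  qed
qed

lemma integrable_pair_diff:
  fixes p q \<kappa> :: "'a::euclidean_space \<Rightarrow> real"
  assumes p: "integrable lborel p" and q: "integrable lborel q" and k: "integrable lborel \<kappa>"
  shows "integrable (lborel \<Otimes>\<^sub>M lborel) (\<lambda>(x, y). \<bar>p x - q y\<bar> * \<kappa> (x - y))"
proof (rule integrable_pair_bounded[of "\<lambda>x. \<bar>p x\<bar>" "\<lambda>x. \<bar>q x\<bar>" "\<lambda>x. \<bar>\<kappa> x\<bar>"])
  note [measurable] = borel_measurable_integrable[OF p] borel_measurable_integrable[OF q] borel_measurable_integrable[OF k]
  show "(\<lambda>(x, y). \<bar>p x - q y\<bar> * \<kappa> (x - y)) \<in> borel_measurable (lborel \<Otimes>\<^sub>M lborel)" by measurable
  show "\<bar>case (x, y) of (x, y) \<Rightarrow> \<bar>p x - q y\<bar> * \<kappa> (x - y)\<bar> \<le> (\<bar>p x\<bar> + \<bar>q y\<bar>) * \<bar>\<kappa> (x - y)\<bar>" for x y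
    by (simp add: abs_mult mult_right_mono)
qed (use p q k in auto)

lemma ennreal_pair_integral:
  fixes p q \<kappa> :: "'a::euclidean_space \<Rightarrow> real"
  assumes p: "integrable lborel p" and q: "integrable lborel q" and k: "integrable lborel \<kappa>"
    and nn: "\<And>x. \<kappa> x \<ge> 0"
  shows "ennreal (LINT z|(lborel \<Otimes>\<^sub>M lborel). (case z of (x, y) \<Rightarrow> \<bar>p x - q y\<bar> * \<kappa> (x - y)))
     = (\<integral>\<^sup>+x. \<integral>\<^sup>+y. ennreal (\<bar>p x - q y\<bar> * \<kappa> (x - y)) \<partial>lborel \<partial>lborel)"
proof -
  note [measurable] = borel_measurable_integrable[OF p] borel_measurable_integrable[OF q] borel_measurable_integrable[OF k]
  have "ennreal (LINT z|(lborel \<Otimes>\<^sub>M lborel). (case z of (x, y) \<Rightarrow> \<bar>p x - q y\<bar> * \<kappa> (x - y)))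
     = (\<integral>\<^sup>+z. ennreal (case z of (x, y) \<Rightarrow> \<bar>p x - q y\<bar> * \<kappa> (x - y)) \<partial>(lborel \<Otimes>\<^sub>M lborel))"
    using nn by (intro nn_integral_eq_integral[symmetric] integrable_pair_diff p q k) auto
  also have "\<dots> = (\<integral>\<^sup>+x. \<integral>\<^sup>+y. ennreal (\<bar>p x - q y\<bar> * \<kappa> (x - y)) \<partial>lborel \<partial>lborel)"
    by (subst lborel.nn_integral_fst[symmetric]) auto
  finally show ?thesis .
qed

lemma integrable_convolution:
  fixes w u :: "'a::euclidean_space \<Rightarrow> real"
  assumes w: "integrable lborel w" and even: "\<And>z. w (- z) = w z" and u: "integrable lborel u"
  shows "integrable lborel (\<lambda>x. LINT z|lborel. w z * u (x + z))"
proof -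
  note [measurable] = borel_measurable_integrable[OF w] borel_measurable_integrable[OF u]
  have "integrable (lborel \<Otimes>\<^sub>M lborel) (\<lambda>(x, y). w y * u (x - y))"
    using integrable_pair_kernel[OF _ w u, of "\<lambda>_. 0"] by simp
  from lborel_pair.integrable_fst'[OF this]
  have "integrable lborel (\<lambda>x. LINT y|lborel. w y * u (x - y))" by simp
  moreover have "(LINT y|lborel. w y * u (x - y)) = (LINT z|lborel. w z * u (x + z))" for x
    using integral_lborel_reflect[of "\<lambda>y. w y * u (x - y)" 0] by (simp add: even)
  ultimately show ?thesis by simp
qed

text \<open>
  After moving the absolute value inside the integral over \<open>z\<close>, translating \<open>x\<close> and \<open>y\<close> by the same
  \<open>z\<close> leaves \<open>\<rho> (x - y)\<close> unchanged, so each \<open>z\<close> contributes \<open>w z\<close> times the same double integral. This is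
  where the sign of the long-range part of the fractional Laplacian comes from.
\<close>

lemma convolution_pair_contraction:
  fixes w u v \<rho> :: "'a::euclidean_space \<Rightarrow> real"
  assumes w: "integrable lborel w" "\<And>z. w (- z) = w z" "\<And>z. w z \<ge> 0"
    and u: "integrable lborel u" "\<And>x. integrable lborel (\<lambda>z. w z * u (x + z))"
    and v: "integrable lborel v" "\<And>x. integrable lborel (\<lambda>z. w z * v (x + z))"
    and \<rho>: "integrable lborel \<rho>" "\<And>x. \<rho> x \<ge> 0"
  shows "(LINT q|(lborel \<Otimes>\<^sub>M lborel). (case q of (x, y) \<Rightarrow>
      \<bar>(LINT z|lborel. w z * u (x + z)) - (LINT z|lborel. w z * v (y + z))\<bar> * \<rho> (x - y)))
    \<le> (LINT z|lborel. w z) * (LINT q|(lborel \<Otimes>\<^sub>M lborel). (case q of (x, y) \<Rightarrow> \<bar>u x - v y\<bar> * \<rho> (x - y)))"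
proof -
  note [measurable] = borel_measurable_integrable[OF w(1)] borel_measurable_integrable[OF u(1)]
    borel_measurable_integrable[OF v(1)] borel_measurable_integrable[OF \<rho>(1)]
  define U V where "U x = (LINT z|lborel. w z * u (x + z))" and "V x = (LINT z|lborel. w z * v (x + z))" for x
  define Q where "Q x = (\<integral>\<^sup>+y. ennreal (\<bar>u x - v y\<bar> * \<rho> (x - y)) \<partial>lborel)" for x
  have Qm [measurable]: "Q \<in> borel_measurable borel" unfolding Q_def[abs_def] by measurable
  have iU: "integrable lborel U" "integrable lborel V"
    unfolding U_def[abs_def] V_def[abs_def] by (intro integrable_convolution w u v)+
  have le: "ennreal \<bar>U x - V y\<bar> \<le> (\<integral>\<^sup>+z. ennreal (w z * \<bar>u (x + z) - v (y + z)\<bar>) \<partial>lborel)" for x y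
  proof -
    have "U x - V y = (LINT z|lborel. w z * u (x + z) - w z * v (y + z))"
      unfolding U_def V_def using u v by simp
    then have "ennreal (norm (U x - V y)) \<le> (\<integral>\<^sup>+z. norm (w z * u (x + z) - w z * v (y + z)) \<partial>lborel)"
      using integral_norm_bound_ennreal[OF Bochner_Integration.integrable_diff[OF u(2) v(2)], of x y] by simp
    also have "(\<lambda>z. norm (w z * u (x + z) - w z * v (y + z))) = (\<lambda>z. w z * \<bar>u (x + z) - v (y + z)\<bar>)"
      using w(3) by (simp add: right_diff_distrib[symmetric] abs_mult)
    finally show ?thesis by simp
  qed
  have tr: "(\<integral>\<^sup>+x. \<integral>\<^sup>+y. ennreal (\<bar>u (x + z) - v (y + z)\<bar> * \<rho> (x - y)) \<partial>lborel \<partial>lborel) = (\<integral>\<^sup>+x. Q x \<partial>lborel)" for z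
  proof -
    have "(\<integral>\<^sup>+y. ennreal (\<bar>u (x + z) - v (y + z)\<bar> * \<rho> (x - y)) \<partial>lborel) = Q (x + z)" for x
      unfolding Q_def
      using nn_integral_lborel_translate[of "\<lambda>y. ennreal (\<bar>u (x + z) - v y\<bar> * \<rho> (x + z - y))" z] by simp
    then show ?thesis by (simp add: nn_integral_lborel_translate)
  qed
  have "ennreal (LINT q|(lborel \<Otimes>\<^sub>M lborel). (case q of (x, y) \<Rightarrow> \<bar>U x - V y\<bar> * \<rho> (x - y)))
    = (\<integral>\<^sup>+x. \<integral>\<^sup>+y. ennreal (\<bar>U x - V y\<bar> * \<rho> (x - y)) \<partial>lborel \<partial>lborel)"
    by (rule ennreal_pair_integral[OF iU \<rho>])
  also have "\<dots> \<le> (\<integral>\<^sup>+x. \<integral>\<^sup>+y. \<integral>\<^sup>+z. ennreal (w z) * ennreal (\<bar>u (x + z) - v (y + z)\<bar> * \<rho> (x - y)) \<partial>lborel \<partial>lborel \<partial>lborel)"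
  proof (intro nn_integral_mono)
    fix x y
    have "ennreal (\<bar>U x - V y\<bar> * \<rho> (x - y)) = ennreal \<bar>U x - V y\<bar> * ennreal (\<rho> (x - y))"
      using \<rho>(2) by (simp add: ennreal_mult)
    also have "\<dots> \<le> (\<integral>\<^sup>+z. ennreal (w z * \<bar>u (x + z) - v (y + z)\<bar>) \<partial>lborel) * ennreal (\<rho> (x - y))"
      by (intro mult_right_mono le) simp
    also have "\<dots> = (\<integral>\<^sup>+z. ennreal (w z * \<bar>u (x + z) - v (y + z)\<bar>) * ennreal (\<rho> (x - y)) \<partial>lborel)"
      by (rule nn_integral_multc[symmetric]) measurable
    also have "\<dots> = (\<integral>\<^sup>+z. ennreal (w z) * ennreal (\<bar>u (x + z) - v (y + z)\<bar> * \<rho> (x - y)) \<partial>lborel)"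
      using w(3) \<rho>(2) by (simp add: ennreal_mult mult.assoc)
    finally show "ennreal (\<bar>U x - V y\<bar> * \<rho> (x - y)) \<le>
      (\<integral>\<^sup>+z. ennreal (w z) * ennreal (\<bar>u (x + z) - v (y + z)\<bar> * \<rho> (x - y)) \<partial>lborel)" .
  qed
  also have "\<dots> = (\<integral>\<^sup>+x. \<integral>\<^sup>+z. \<integral>\<^sup>+y. ennreal (w z) * ennreal (\<bar>u (x + z) - v (y + z)\<bar> * \<rho> (x - y)) \<partial>lborel \<partial>lborel \<partial>lborel)"
    by (intro nn_integral_cong lborel_pair.Fubini') measurable
  also have "\<dots> = (\<integral>\<^sup>+z. \<integral>\<^sup>+x. \<integral>\<^sup>+y. ennreal (w z) * ennreal (\<bar>u (x + z) - v (y + z)\<bar> * \<rho> (x - y)) \<partial>lborel \<partial>lborel \<partial>lborel)"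
    by (intro lborel_pair.Fubini') measurable
  also have "\<dots> = (\<integral>\<^sup>+z. ennreal (w z) * (\<integral>\<^sup>+x. Q x \<partial>lborel) \<partial>lborel)"
    by (intro nn_integral_cong) (simp add: nn_integral_cmult tr)
  also have "\<dots> = (\<integral>\<^sup>+z. ennreal (w z) \<partial>lborel) * (\<integral>\<^sup>+x. Q x \<partial>lborel)"
    by (rule nn_integral_multc) measurable
  also have "(\<integral>\<^sup>+z. ennreal (w z) \<partial>lborel) = ennreal (LINT z|lborel. w z)"
    using w by (intro nn_integral_eq_integral) auto
  also have "(\<integral>\<^sup>+x. Q x \<partial>lborel) = ennreal (LINT q|(lborel \<Otimes>\<^sub>M lborel). (case q of (x, y) \<Rightarrow> \<bar>u x - v y\<bar> * \<rho> (x - y)))"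
    unfolding Q_def by (rule ennreal_pair_integral[OF u(1) v(1) \<rho>, symmetric])
  finally have e: "ennreal (LINT q|(lborel \<Otimes>\<^sub>M lborel). (case q of (x, y) \<Rightarrow> \<bar>U x - V y\<bar> * \<rho> (x - y))) \<le>
    ennreal (LINT z|lborel. w z) * ennreal (LINT q|(lborel \<Otimes>\<^sub>M lborel). (case q of (x, y) \<Rightarrow> \<bar>u x - v y\<bar> * \<rho> (x - y)))" .
  have W: "(LINT z|lborel. w z) \<ge> 0" using w by (intro integral_nonneg_AE) auto
  have I: "(LINT q|(lborel \<Otimes>\<^sub>M lborel). (case q of (x, y) \<Rightarrow> \<bar>u x - v y\<bar> * \<rho> (x - y))) \<ge> 0"
    using \<rho> by (intro integral_nonneg_AE) auto
  from e show ?thesis unfolding U_def V_def ennreal_mult[OF W I, symmetric]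
    using W I by (subst (asm) ennreal_le_iff) auto
qed

text \<open>
  With \<open>h = x - y\<close> the double integral is an average, weighted by \<open>\<rho> h\<close>, of the distance in \<open>L\<^sup>1\<close>
  between \<open>g\<close> and its translate by \<open>h\<close>.
\<close>

lemma pair_translation_bound:
  fixes g \<rho> :: "'a::euclidean_space \<Rightarrow> real"
  assumes g: "integrable lborel g" and \<rho>: "integrable lborel \<rho>" "\<And>h. \<rho> h \<ge> 0"
    and small: "\<And>h. \<rho> h \<noteq> 0 \<Longrightarrow> (LINT x|lborel. \<bar>g (x + h) - g x\<bar>) \<le> e" and e: "e \<ge> 0"
  shows "(LINT z|(lborel \<Otimes>\<^sub>M lborel). (case z of (x, y) \<Rightarrow> \<bar>g x - g y\<bar> * \<rho> (x - y))) \<le> e * (LINT h|lborel. \<rho> h)"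
proof -
  note [measurable] = borel_measurable_integrable[OF g] borel_measurable_integrable[OF \<rho>(1)]
  have "ennreal (LINT z|(lborel \<Otimes>\<^sub>M lborel). (case z of (x, y) \<Rightarrow> \<bar>g x - g y\<bar> * \<rho> (x - y)))
    = (\<integral>\<^sup>+x. \<integral>\<^sup>+y. ennreal (\<bar>g x - g y\<bar> * \<rho> (x - y)) \<partial>lborel \<partial>lborel)"
    by (rule ennreal_pair_integral[OF g g \<rho>])
  also have "\<dots> = (\<integral>\<^sup>+y. \<integral>\<^sup>+x. ennreal (\<bar>g x - g y\<bar> * \<rho> (x - y)) \<partial>lborel \<partial>lborel)"
    by (intro lborel_pair.Fubini'[symmetric]) measurable
  also have "\<dots> = (\<integral>\<^sup>+y. \<integral>\<^sup>+h. ennreal (\<bar>g (y + h) - g y\<bar> * \<rho> h) \<partial>lborel \<partial>lborel)"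
  proof (rule nn_integral_cong)
    fix y
    show "(\<integral>\<^sup>+x. ennreal (\<bar>g x - g y\<bar> * \<rho> (x - y)) \<partial>lborel) = (\<integral>\<^sup>+h. ennreal (\<bar>g (y + h) - g y\<bar> * \<rho> h) \<partial>lborel)"
      using nn_integral_lborel_translate[of "\<lambda>x. ennreal (\<bar>g x - g y\<bar> * \<rho> (x - y))" y]
      by (simp add: add.commute)
  qed
  also have "\<dots> = (\<integral>\<^sup>+h. \<integral>\<^sup>+y. ennreal (\<bar>g (y + h) - g y\<bar> * \<rho> h) \<partial>lborel \<partial>lborel)"
    by (intro lborel_pair.Fubini') measurable
  also have "\<dots> \<le> (\<integral>\<^sup>+h. ennreal (e * \<rho> h) \<partial>lborel)"
  proof (rule nn_integral_mono)
    fix h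
    have "(\<integral>\<^sup>+y. ennreal (\<bar>g (y + h) - g y\<bar> * \<rho> h) \<partial>lborel) = ennreal ((LINT y|lborel. \<bar>g (y + h) - g y\<bar>) * \<rho> h)"
      using g \<rho> integrable_lborel_translate[OF g]
      by (subst nn_integral_eq_integral) auto
    also have "\<dots> \<le> ennreal (e * \<rho> h)"
      using small[of h] \<rho>(2)[of h] by (cases "\<rho> h = 0") (auto intro!: ennreal_leI mult_right_mono)
    finally show "(\<integral>\<^sup>+y. ennreal (\<bar>g (y + h) - g y\<bar> * \<rho> h) \<partial>lborel) \<le> ennreal (e * \<rho> h)" .
  qed
  also have "\<dots> = ennreal (e * (LINT h|lborel. \<rho> h))"
    using e \<rho> by (subst nn_integral_eq_integral) auto
  finally have 1: "ennreal (LINT z|(lborel \<Otimes>\<^sub>M lborel). (case z of (x, y) \<Rightarrow> \<bar>g x - g y\<bar> * \<rho> (x - y)))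
     \<le> ennreal (e * (LINT h|lborel. \<rho> h))" .
  have "e * (LINT h|lborel. \<rho> h) \<ge> 0" using e \<rho> by (intro mult_nonneg_nonneg integral_nonneg_AE) auto
  with 1 show ?thesis by (simp add: ennreal_le_iff)
qed

section \<open>The fractional Laplacian, split into short and long range\<close>

text \<open>
  On the shell \<open>c/2 \<le> |z| \<le> 2c\<close> the integrand is comparable to \<open>c\<close> to the power \<open>-q\<close> and the volume is of
  order \<open>c\<close> to the power \<open>dim\<close>. Summing over \<open>c = a, aB, aB\<^sup>2, ...\<close> gives a geometric series. The ratio
  \<open>B = 1/2\<close> handles a neighbourhood of \<open>0\<close>, the ratio \<open>B = 2\<close> one of infinity.
\<close>

lemma integrable_norm_powr_dyadic:
  fixes S :: "'a::euclidean_space set"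
  assumes a: "a > 0" and B: "B > 0" and conv: "B powr (real DIM('a) - q) < 1"
    and S: "S \<in> sets borel"
    and cover: "\<And>z. z \<in> S \<Longrightarrow> \<exists>k::nat. a * B ^ k \<le> 2 * norm z \<and> norm z \<le> 2 * (a * B ^ k)"
  shows "integrable lborel (\<lambda>z::'a. indicator S z * norm z powr (- q))"
proof (rule integrableI_bounded)
  show "(\<lambda>z::'a. indicator S z * norm z powr (- q)) \<in> borel_measurable lborel"
    using S by measurable
  define c where "c k = a * B ^ k" for k :: nat
  have c: "c k > 0" for k using a B by (simp add: c_def)
  define g where "g k z = ennreal (2 powr \<bar>q\<bar> * c k powr (- q)) * indicator (cball 0 (2 * c k)) z" for k and z :: 'a
  have gm: "g k \<in> borel_measurable lborel" for k
    unfolding g_def by (intro borel_measurable_times_ennreal borel_measurable_const borel_measurable_indicator) auto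
  have le: "ennreal (norm (indicator S z * norm z powr (- q))) \<le> (\<Sum>k. g k z)" for z :: 'a
  proof (cases "z \<in> S")
    case True
    then obtain k where k: "c k \<le> 2 * norm z" "norm z \<le> 2 * c k" using cover unfolding c_def by blast
    \<comment> \<open>the factor \<open>2 powr |q|\<close> bounds \<open>t powr (- q)\<close> for either sign of \<open>q\<close>\<close>
    define t where "t = norm z / c k"
    have t: "1/2 \<le> t" "t \<le> 2" "norm z = t * c k"
      using k c[of k] by (auto simp: t_def field_simps)
    have "t powr (-q) \<le> 2 powr \<bar>q\<bar>"
    proof (cases "q \<ge> 0")
      case True
      have "t powr (-q) \<le> (1/2) powr (-q)" using True t by (intro powr_mono2') auto
      also have "\<dots> = 2 powr q" by (simp add: powr_divide powr_minus_divide)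
      finally show ?thesis using True by simp
    next
      case False
      then show ?thesis using t by (intro order_trans[OF powr_mono2[of "-q" t 2]]) auto
    qed
    then have "norm z powr (-q) \<le> 2 powr \<bar>q\<bar> * c k powr (-q)"
      using t c[of k] by (simp add: powr_mult mult_right_mono)
    then have "ennreal (norm (indicator S z * norm z powr (- q))) \<le> g k z"
      using True k by (simp add: g_def ennreal_leI)
    also have "\<dots> = (\<Sum>i\<in>{k}. g i z)" by simp
    also have "\<dots> \<le> (\<Sum>i. g i z)" by (rule sum_le_suminf) auto
    finally show ?thesis .
  qed simp
  define V where "V = unit_ball_vol (real DIM('a))"
  define K where "K = 2 powr \<bar>q\<bar> * V * 2 ^ DIM('a) * a powr (real DIM('a) - q)"
  have V0: "V \<ge> 0" by (simp add: V_def)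
  have "(\<integral>\<^sup>+ z. ennreal (norm (indicator S z * norm z powr (- q))) \<partial>lborel) \<le> (\<integral>\<^sup>+ z. (\<Sum>k. g k z) \<partial>(lborel::'a measure))"
    by (rule nn_integral_mono) (rule le)
  also have "\<dots> = (\<Sum>k. \<integral>\<^sup>+ z. g k z \<partial>(lborel::'a measure))"
    using gm by (rule nn_integral_suminf)
  also have "(\<lambda>k. \<integral>\<^sup>+ z. g k z \<partial>(lborel::'a measure)) = (\<lambda>k. ennreal (K * (B powr (real DIM('a) - q)) ^ k))"
  proof
    fix k
    have "(\<integral>\<^sup>+ z. g k z \<partial>(lborel::'a measure)) = ennreal (2 powr \<bar>q\<bar> * c k powr (- q)) * emeasure lborel (cball (0::'a) (2 * c k))"
      unfolding g_def by (rule nn_integral_cmult_indicator) simp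
    also have "\<dots> = ennreal (2 powr \<bar>q\<bar> * c k powr (- q) * (V * (2 * c k) ^ DIM('a)))"
      using c[of k] V0 by (subst emeasure_cball) (auto simp: V_def ennreal_mult[symmetric] less_imp_le)
    also have "2 powr \<bar>q\<bar> * c k powr (- q) * (V * (2 * c k) ^ DIM('a))
        = 2 powr \<bar>q\<bar> * V * 2 ^ DIM('a) * c k powr (real DIM('a) - q)"
      using c[of k] by (simp add: power_mult_distrib powr_realpow[symmetric] powr_diff powr_minus field_simps)
    also have "c k powr (real DIM('a) - q) = a powr (real DIM('a) - q) * (B powr (real DIM('a) - q)) ^ k"
    proof -
      have "(B ^ k) powr x = (B powr x) ^ k" for x :: real
        using B by (simp add: powr_realpow[symmetric] powr_powr mult.commute powr_power)
      then show ?thesis unfolding c_def using a B by (simp add: powr_mult)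
    qed
    finally show "(\<integral>\<^sup>+ z. g k z \<partial>(lborel::'a measure)) = ennreal (K * (B powr (real DIM('a) - q)) ^ k)"
      by (simp add: K_def mult_ac)
  qed
  also have "(\<Sum>k. ennreal (K * (B powr (real DIM('a) - q)) ^ k)) < \<infinity>"
  proof -
    have "summable (\<lambda>k. K * (B powr (real DIM('a) - q)) ^ k)"
      using conv by (intro summable_mult summable_geometric) auto
    moreover have "K \<ge> 0" using V0 by (simp add: K_def)
    ultimately show ?thesis using ennreal_suminf_neq_top by (simp add: less_top)
  qed
  finally show "(\<integral>\<^sup>+ z. ennreal (norm (indicator S z * norm z powr (- q))) \<partial>lborel) < \<infinity>" .
qed

lemma integrable_norm_powr_at_0:
  assumes "q < real DIM('a::euclidean_space)"
  shows "integrable lborel (\<lambda>z::'a. indicator (cball 0 1) z * norm z powr (- q))"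
proof -
  have "integrable lborel (\<lambda>z::'a. indicator (cball 0 1 - {0}) z * norm z powr (- q))"
  proof (rule integrable_norm_powr_dyadic[of 1 "1/2"])
    show "(1/2) powr (real DIM('a) - q) < 1"
      using assms gr_one_powr[of 2 "real DIM('a) - q"] by (simp add: powr_divide)
    fix z :: 'a assume "z \<in> cball 0 1 - {0}"
    then have z: "0 < norm z" "norm z \<le> 1" by auto
    \<comment> \<open>\<open>n\<close> gives the first power of \<open>1/2\<close> below \<open>|z|\<close>; the shell of \<open>z\<close> has the index before it\<close>
    define n where "n = (LEAST n. (1/2::real) ^ n < norm z)"
    have "\<exists>n. (1/2::real) ^ n < norm z" using z by (intro real_arch_pow_inv) auto
    then have n: "(1/2::real) ^ n < norm z" unfolding n_def by (rule LeastI_ex)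
    with z obtain k where k: "n = Suc k" by (cases n) auto
    have "\<not> (1/2::real) ^ k < norm z" using not_less_Least[of k "\<lambda>n. (1/2::real) ^ n < norm z"] k by (simp add: n_def)
    then show "\<exists>k. 1 * (1/2) ^ k \<le> 2 * norm z \<and> norm z \<le> 2 * (1 * (1/2) ^ k)"
      using n z unfolding k by (intro exI[of _ k]) auto
  qed auto
  moreover have "indicator (cball 0 1 - {0}) z * norm z powr (- q) = indicator (cball 0 1) z * norm z powr (- q)" for z :: 'a
    by (auto simp: indicator_def)
  ultimately show ?thesis by simp
qed

lemma integrable_norm_powr_at_infinity:
  assumes "real DIM('a::euclidean_space) < q" and r: "r > 0"
  shows "integrable lborel (\<lambda>z::'a. indicator {z. norm z \<ge> r} z * norm z powr (- q))"
proof (rule integrable_norm_powr_dyadic[of r 2])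
  show "2 powr (real DIM('a) - q) < 1"
    using assms powr_less_mono[of "real DIM('a) - q" 0 2] by simp
  show "{z. norm z \<ge> r} \<in> sets (borel::'a measure)" by measurable
  fix z :: 'a assume "z \<in> {z. norm z \<ge> r}"
  then have z: "norm z \<ge> r" by auto
  define n where "n = (LEAST n. norm z < r * 2 ^ n)"
  obtain m where "norm z / r < 2 ^ m" using real_arch_pow[of 2] by auto
  then have "\<exists>n. norm z < r * 2 ^ n" using r by (intro exI[of _ m]) (simp add: field_simps)
  then have n: "norm z < r * 2 ^ n" unfolding n_def by (rule LeastI_ex)
  with z obtain k where k: "n = Suc k" by (cases n) auto
  have "\<not> norm z < r * 2 ^ k" using not_less_Least[of k "\<lambda>n. norm z < r * 2 ^ n"] k by (simp add: n_def)
  then show "\<exists>k. r * 2 ^ k \<le> 2 * norm z \<and> norm z \<le> 2 * (r * 2 ^ k)"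
    using n z unfolding k by (intro exI[of _ k]) auto
qed (use r in auto)

text \<open>
  The domain of integration is split at \<open>|z| = r\<close>. For \<open>|z| \<ge> r\<close> the kernel is integrable and acts on
  merely bounded functions; for \<open>|z| \<le> r\<close> it is not, and it acts on test functions through their second
  order Taylor remainder.
\<close>

definition far_kernel :: "real \<Rightarrow> real \<Rightarrow> real ^ 'n \<Rightarrow> real" where
  "far_kernel s r z = indicator {z. norm z \<ge> r} z / norm z powr (real CARD('n) + s)"

definition far_part :: "real \<Rightarrow> real \<Rightarrow> (real ^ 'n \<Rightarrow> real) \<Rightarrow> real ^ 'n \<Rightarrow> real" where
  "far_part s r u x = (LINT z|lborel. far_kernel s r z * (u (x + z) - u x))"

definition near_kernel :: "real \<Rightarrow> real \<Rightarrow> real ^ 'n \<Rightarrow> real" where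
  "near_kernel s r z = indicator {z. norm z \<le> r} z / norm z powr (real CARD('n) + s)"

definition near_part :: "real \<Rightarrow> real \<Rightarrow> (real ^ 'n \<Rightarrow> real) \<Rightarrow> real ^ 'n \<Rightarrow> real" where
  "near_part s r \<phi> x = (LINT z|lborel. near_kernel s r z * (\<phi> (x + z) - \<phi> x - grad \<phi> x \<bullet> z))"

lemma kernels_measurable [measurable]:
  "far_kernel s r \<in> borel_measurable borel" "near_kernel s r \<in> borel_measurable borel"
  unfolding far_kernel_def[abs_def] near_kernel_def[abs_def] by measurable

lemma far_kernel_nonneg: "far_kernel s r z \<ge> 0" by (simp add: far_kernel_def)

lemma integrable_far_kernel:
  assumes "0 < s" "0 < r"
  shows "integrable lborel (far_kernel s r :: real ^ 'n \<Rightarrow> real)"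
proof -
  have "integrable lborel (\<lambda>z::real^'n. indicator {z. norm z \<ge> r} z * norm z powr (- (real CARD('n) + s)))"
    by (rule integrable_norm_powr_at_infinity) (use assms in auto)
  moreover have "indicator {z. norm z \<ge> r} z * norm z powr (- (real CARD('n) + s)) = far_kernel s r z" for z :: "real ^ 'n"
    by (simp only: far_kernel_def powr_minus_divide times_divide_eq_right mult_1_right)
  ultimately show ?thesis by simp
qed

text \<open>
  The second moment of the singular kernel, which controls the short-range part of the operator on functions
  with a quadratic Taylor remainder.
\<close>

definition near_mass :: "'n::finite itself \<Rightarrow> real \<Rightarrow> real \<Rightarrow> real" where
  "near_mass _ s r = (LINT z|lborel. near_kernel s r (z :: real ^ 'n) * (norm z)\<^sup>2)"

lemma near_kernel_eq:
  "near_kernel s r z * (norm z)\<^sup>2 = indicator {z. norm z \<le> r} z * norm (z :: real ^ 'n) powr (- (real CARD('n) + s - 2))"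
proof (cases "z = 0")
  case False
  have "norm z powr 2 = (norm z)\<^sup>2" using False by simp
  then have "(norm z)\<^sup>2 / norm z powr (real CARD('n) + s) = norm z powr (2 - (real CARD('n) + s))"
    using False by (simp add: powr_diff)
  also have "2 - (real CARD('n) + s) = - (real CARD('n) + s - 2)" by linarith
  finally have "(norm z)\<^sup>2 / norm z powr (real CARD('n) + s) = norm z powr (- (real CARD('n) + s - 2))" .
  then show ?thesis unfolding near_kernel_def by (metis times_divide_eq_left times_divide_eq_right)
qed (simp add: near_kernel_def)

lemma integrable_near_kernel:
  assumes "s < 2" "r \<le> 1"
  shows "integrable lborel (\<lambda>z :: real ^ 'n. near_kernel s r z * (norm z)\<^sup>2)"
proof -
  have "integrable lborel (\<lambda>z::real^'n. indicator (cball 0 1) z * norm z powr (- (real CARD('n) + s - 2)))"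
    by (rule integrable_norm_powr_at_0) (use assms in auto)
  then show ?thesis unfolding near_kernel_eq
    by (rule Bochner_Integration.integrable_bound) (use assms in \<open>auto simp: indicator_def\<close>)
qed

lemma near_mass_tendsto_0:
  assumes "s < 2"
  shows "(\<lambda>n. near_mass TYPE('n::finite) s (1 / real (Suc n))) \<longlonglongrightarrow> 0"
proof -
  have "(\<lambda>n. LINT z|lborel. near_kernel s (1 / real (Suc n)) (z :: real ^ 'n) * (norm z)\<^sup>2) \<longlonglongrightarrow> (LINT z|(lborel :: (real^'n) measure). 0)"
  proof (rule integral_dominated_convergence[where w="\<lambda>z::real^'n. near_kernel s 1 z * (norm z)\<^sup>2"])
    show "integrable lborel (\<lambda>z::real^'n. near_kernel s 1 z * (norm z)\<^sup>2)"
      by (rule integrable_near_kernel) (use assms in auto)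
    show "AE z::real^'n in lborel. (\<lambda>n. near_kernel s (1 / real (Suc n)) z * (norm z)\<^sup>2) \<longlonglongrightarrow> 0"
    proof (rule AE_I2)
      fix z :: "real ^ 'n"
      show "(\<lambda>n. near_kernel s (1 / real (Suc n)) z * (norm z)\<^sup>2) \<longlonglongrightarrow> 0"
      proof (cases "z = 0")
        case False
        then have "eventually (\<lambda>n. 1 / real (Suc n) < norm z) sequentially"
          by (intro order_tendstoD(2)[OF LIMSEQ_Suc[OF lim_1_over_n]]) auto
        then have "eventually (\<lambda>n. near_kernel s (1 / real (Suc n)) z * (norm z)\<^sup>2 = 0) sequentially"
          by eventually_elim (simp add: near_kernel_def)
        then show ?thesis by (rule tendsto_eventually)
      qed simp
    qed
    show "AE z::real^'n in lborel. norm (near_kernel s (1 / real (Suc n)) z * (norm z)\<^sup>2) \<le> near_kernel s 1 z * (norm z)\<^sup>2" for n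
    proof (rule AE_I2)
      fix z :: "real ^ 'n"
      have "norm z \<le> 1 / real (Suc n) \<Longrightarrow> norm z \<le> 1" by (erule order_trans) simp
      then have "indicat_real {z. norm z \<le> 1 / real (Suc n)} z \<le> indicat_real {z. norm z \<le> 1} z"
        by (auto simp: indicator_def)
      then have "near_kernel s (1 / real (Suc n)) z \<le> near_kernel s 1 z"
        unfolding near_kernel_def by (intro divide_right_mono) auto
      moreover have "near_kernel s (1 / real (Suc n)) z \<ge> 0" by (simp add: near_kernel_def)
      ultimately show "norm (near_kernel s (1 / real (Suc n)) z * (norm z)\<^sup>2) \<le> near_kernel s 1 z * (norm z)\<^sup>2"
        by (simp add: abs_mult mult_right_mono)
    qed
  qed measurable
  then show ?thesis by (simp add: near_mass_def)
qed

lemma far_part_measurable [measurable]: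
  assumes [measurable]: "u \<in> borel_measurable borel"
  shows "far_part s r u \<in> borel_measurable borel"
  unfolding far_part_def[abs_def] by measurable

text \<open>
  The long-range part is a convolution minus a multiple of the identity.
\<close>

lemma far_part_eq:
  fixes u :: "real ^ 'n \<Rightarrow> real"
  assumes s: "0 < s" "0 < r" and u: "u \<in> borel_measurable borel" "\<And>x. \<bar>u x\<bar> \<le> K"
  shows "integrable lborel (\<lambda>z. far_kernel s r z * u (x + z))"
    and "far_part s r u x = (LINT z|lborel. far_kernel s r z * u (x + z)) - (LINT z|lborel. far_kernel s r (z :: real ^ 'n)) * u x"
    and "\<bar>far_part s r u x\<bar> \<le> 2 * K * (LINT z|lborel. far_kernel s r (z :: real ^ 'n))"
proof -
  note [measurable] = u(1)
  note i = integrable_far_kernel[OF s, where 'n='n]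
  show 1: "integrable lborel (\<lambda>z. far_kernel s r z * u (x + z))" for x
  proof (rule Bochner_Integration.integrable_bound)
    show "integrable lborel (\<lambda>z :: real ^ 'n. far_kernel s r z * K)" using i by simp
    show "AE z in lborel. norm (far_kernel s r z * u (x + z)) \<le> norm (far_kernel s r z * K)"
      using u(2) far_kernel_nonneg[of s r]
      by (intro AE_I2) (auto simp: abs_mult intro!: mult_left_mono order_trans[OF _ abs_ge_self])
  qed measurable
  show eq: "far_part s r u x = (LINT z|lborel. far_kernel s r z * u (x + z)) - (LINT z|lborel. far_kernel s r (z :: real ^ 'n)) * u x"
    unfolding far_part_def right_diff_distrib using 1 i by simp
  have "\<bar>far_part s r u x\<bar> \<le> (LINT z|lborel. \<bar>far_kernel s r z * (u (x + z) - u x)\<bar>)"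
    unfolding far_part_def by (rule integral_abs_bound)
  also have "\<dots> \<le> (LINT z|lborel. 2 * K * far_kernel s r (z :: real ^ 'n))"
  proof (rule integral_mono)
    show "integrable lborel (\<lambda>z. \<bar>far_kernel s r z * (u (x + z) - u x)\<bar>)"
      unfolding right_diff_distrib using 1 i by auto
    show "\<bar>far_kernel s r z * (u (x + z) - u x)\<bar> \<le> 2 * K * far_kernel s r z" for z
    proof -
      have "\<bar>u (x + z) - u x\<bar> \<le> 2 * K" using u(2)[of x] u(2)[of "x + z"] by linarith
      from mult_left_mono[OF this far_kernel_nonneg[of s r z]] show ?thesis
        by (simp add: abs_mult far_kernel_nonneg mult_ac)
    qed
  qed (use i in simp)
  finally show "\<bar>far_part s r u x\<bar> \<le> 2 * K * (LINT z|lborel. far_kernel s r (z :: real ^ 'n))" by simp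
qed

lemma near_part_measurable:
  assumes "test_function \<phi>"
  shows "near_part s r \<phi> \<in> borel_measurable borel"
proof -
  note [measurable] = test_function_measurable[OF assms] test_function_grad_measurable[OF assms]
  show ?thesis unfolding near_part_def[abs_def] by measurable
qed

lemma near_part_outside:
  fixes \<phi> :: "real ^ 'n \<Rightarrow> real"
  assumes "\<And>x. norm x \<ge> R \<Longrightarrow> \<phi> x = 0" and "norm x > R + r"
  shows "near_part s r \<phi> x = 0"
proof -
  have "near_kernel s r z * (\<phi> (x + z) - \<phi> x - grad \<phi> x \<bullet> z) = 0" for z :: "real ^ 'n"
  proof (cases "norm z \<le> r")
    case True
    have "norm x \<le> norm (x + z) + norm z" using norm_triangle_ineq4[of "x + z" z] by simp
    then have R: "norm (x + z) \<ge> R" "norm x > R"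
      using assms(2) norm_ge_zero[of z] True by linarith+
    have "((\<lambda>x. 0) has_derivative (\<lambda>h. 0)) (at x)" by simp
    then have "(\<phi> has_derivative (\<lambda>h. 0)) (at x)"
      by (rule has_derivative_transform_within_open[of _ _ _ _ "- cball 0 R"])
         (use assms R in auto)
    then have "grad \<phi> x = 0" by (simp add: grad_def partial_deriv_eq vec_eq_iff)
    then show ?thesis using R assms(1) by simp
  qed (simp add: near_kernel_def)
  then show ?thesis unfolding near_part_def by (simp only: integral_zero)
qed

lemma near_part_bound:
  fixes \<phi> :: "real ^ 'n \<Rightarrow> real"
  assumes \<phi>: "test_function \<phi>" and s: "s < 2" "r \<le> 1"
    and M: "\<And>x z. \<bar>\<phi> (x + z) - \<phi> x - grad \<phi> x \<bullet> z\<bar> \<le> M * (norm z)\<^sup>2"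
  shows "\<bar>near_part s r \<phi> x\<bar> \<le> M * near_mass TYPE('n) s r"
proof -
  note [measurable] = test_function_measurable[OF \<phi>]
  have nn: "near_kernel s r z \<ge> 0" for z :: "real ^ 'n" by (simp add: near_kernel_def)
  have le: "\<bar>near_kernel s r z * (\<phi> (x + z) - \<phi> x - grad \<phi> x \<bullet> z)\<bar> \<le> M * (near_kernel s r z * (norm z)\<^sup>2)" for z
    using mult_left_mono[OF M[of x z] nn[of z]] by (simp add: abs_mult nn mult_ac)
  have i: "integrable lborel (\<lambda>z :: real ^ 'n. M * (near_kernel s r z * (norm z)\<^sup>2))"
    by (intro integrable_mult_right integrable_near_kernel s)
  have "\<bar>near_part s r \<phi> x\<bar> \<le> (LINT z|lborel. \<bar>near_kernel s r z * (\<phi> (x + z) - \<phi> x - grad \<phi> x \<bullet> z)\<bar>)"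
    unfolding near_part_def by (rule integral_abs_bound)
  also have "\<dots> \<le> (LINT z|lborel. M * (near_kernel s r (z::real^'n) * (norm z)\<^sup>2))"
  proof (rule integral_mono[OF _ i le])
    show "integrable lborel (\<lambda>z. \<bar>near_kernel s r z * (\<phi> (x + z) - \<phi> x - grad \<phi> x \<bullet> z)\<bar>)"
      by (rule Bochner_Integration.integrable_bound[OF i])
         (use le in \<open>auto intro!: order_trans[OF _ abs_ge_self]\<close>)
  qed
  finally show ?thesis by (simp add: near_mass_def)
qed

lemma integrable_near_part:
  fixes \<phi> :: "real ^ 'n \<Rightarrow> real"
  assumes \<phi>: "test_function \<phi>" and s: "s < 2" "r \<le> 1"
  shows "integrable lborel (near_part s r \<phi>)"
proof -
  obtain R where R: "\<And>x. norm x > R \<Longrightarrow> \<phi> x = 0" by (rule test_function_outside[OF \<phi>]) blast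
  obtain M where M: "\<And>x z. \<bar>\<phi> (x + z) - \<phi> x - grad \<phi> x \<bullet> z\<bar> \<le> M * (norm z)\<^sup>2"
    by (rule test_function_Taylor[OF \<phi>]) blast
  show ?thesis
  proof (rule integrable_bounded_outside(1))
    show "\<bar>near_part s r \<phi> x\<bar> \<le> M * near_mass TYPE('n) s r" for x
      by (rule near_part_bound[OF \<phi> s M])
    show "near_part s r \<phi> x = 0" if "norm x > R + 1 + r" for x
      by (rule near_part_outside[of "R + 1"]) (use R that in auto)
  qed (rule near_part_measurable[OF \<phi>])
qed

lemma near_part_translate:
  assumes "test_function \<rho>"
  shows "near_part s r (\<lambda>x. \<rho> (x - y)) x = near_part s r \<rho> (x - y)"
  unfolding near_part_def grad_translate[OF assms] by (simp add: algebra_simps)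

lemma near_part_minus:
  fixes \<rho> :: "real ^ 'n \<Rightarrow> real"
  assumes \<rho>: "test_function \<rho>" and even: "\<And>x. \<rho> (- x) = \<rho> x"
  shows "near_part s r \<rho> (- h) = near_part s r \<rho> h"
proof -
  note [measurable] = test_function_measurable[OF \<rho>]
  have "near_part s r \<rho> (- h) = (LINT z|lborel. near_kernel s r (0 - z) * (\<rho> (- h + (0 - z)) - \<rho> (- h) - grad \<rho> (- h) \<bullet> (0 - z)))"
    unfolding near_part_def
    by (rule integral_lborel_reflect[of "\<lambda>z. near_kernel s r z * (\<rho> (- h + z) - \<rho> (- h) - grad \<rho> (- h) \<bullet> z)", symmetric]) measurable
  also have "\<dots> = near_part s r \<rho> h"
  proof -
    have "\<rho> (- h + (0 - z)) = \<rho> (h + z)" for z using even[of "h + z"] by simp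
    moreover have "near_kernel s r (0 - z) = near_kernel s r z" for z :: "real ^ 'n"
      by (simp add: near_kernel_def indicator_def)
    ultimately show ?thesis unfolding near_part_def by (simp add: even grad_minus[OF \<rho> even])
  qed
  finally show ?thesis .
qed

text \<open>
  The short-range part of \<open>\<rho>\<close> is uniformly small and vanishes outside a fixed ball.
\<close>

lemma near_error_tendsto_0:
  fixes u v \<rho> :: "real ^ 'n \<Rightarrow> real"
  assumes s: "s < 2" and u: "integrable lborel u" and v: "integrable lborel v" and \<rho>: "test_function \<rho>"
  shows "(\<lambda>n. LINT z|(lborel \<Otimes>\<^sub>M lborel).
      (case z of (x, y) \<Rightarrow> \<bar>u x - v y\<bar> * \<bar>near_part s (1 / real (Suc n)) \<rho> (x - y)\<bar>)) \<longlonglongrightarrow> 0"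
proof -
  obtain R where R: "\<And>x. norm x > R \<Longrightarrow> \<rho> x = 0" by (rule test_function_outside[OF \<rho>]) blast
  obtain M where M: "\<And>x z. \<bar>\<rho> (x + z) - \<rho> x - grad \<rho> x \<bullet> z\<bar> \<le> M * (norm z)\<^sup>2"
    by (rule test_function_Taylor[OF \<rho>]) blast
  define V where "V = measure lborel (cball (0 :: real ^ 'n) (R + 2))"
  define A where "A = (LINT x|lborel. \<bar>u x\<bar>) + (LINT x|lborel. \<bar>v x\<bar>)"
  define r where "r n = 1 / real (Suc n)" for n
  have r: "0 < r n" "r n \<le> 1" for n by (auto simp: r_def)
  have A0: "A \<ge> 0" unfolding A_def by (intro add_nonneg_nonneg integral_nonneg_AE) auto
  let ?I = "\<lambda>n. LINT z|(lborel \<Otimes>\<^sub>M lborel). (case z of (x, y) \<Rightarrow> \<bar>u x - v y\<bar> * \<bar>near_part s (r n) \<rho> (x - y)\<bar>)"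
  have nn: "0 \<le> ?I n" for n by (intro integral_nonneg_AE) auto
  \<comment> \<open>\<open>|u x - v y| \<le> |u x| + |v y|\<close> splits the double integral into products\<close>
  have le: "?I n \<le> A * ((M * near_mass TYPE('n) s (r n)) * V)" for n
  proof -
    have iN: "integrable lborel (\<lambda>x. \<bar>near_part s (r n) \<rho> x\<bar>)"
      using integrable_near_part[OF \<rho> s r(2)] by simp
    have "?I n \<le> (LINT z|(lborel \<Otimes>\<^sub>M lborel). (case z of (x, y) \<Rightarrow> (\<bar>u x\<bar> + \<bar>v y\<bar>) * \<bar>near_part s (r n) \<rho> (x - y)\<bar>))"
      using u v iN
      by (intro integral_mono integrable_pair_diff integrable_pair_kernel) (auto intro!: mult_right_mono)
    also have "\<dots> = A * (LINT h|lborel. \<bar>near_part s (r n) \<rho> h\<bar>)"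
      unfolding A_def using u v iN by (intro integral_pair_kernel) auto
    also have "\<dots> \<le> A * ((M * near_mass TYPE('n) s (r n)) * V)"
      unfolding V_def
    proof (intro mult_left_mono A0 integrable_bounded_outside(2) near_part_measurable[OF \<rho>] near_part_bound[OF \<rho> s r(2) M])
      show "near_part s (r n) \<rho> x = 0" if "R + 2 < norm x" for x
        by (rule near_part_outside[of "R + 1"]) (use R that r[of n] in auto)
    qed
    finally show ?thesis .
  qed
  have "(\<lambda>n. A * ((M * near_mass TYPE('n) s (r n)) * V)) \<longlonglongrightarrow> A * ((M * 0) * V)"
    unfolding r_def by (intro tendsto_intros near_mass_tendsto_0 s)
  then have lim: "(\<lambda>n. A * ((M * near_mass TYPE('n) s (r n)) * V)) \<longlonglongrightarrow> 0" by simp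
  have "?I \<longlonglongrightarrow> 0"
    by (rule tendsto_sandwich[OF _ _ tendsto_const lim]) (use nn le in auto)
  then show ?thesis unfolding r_def .
qed

lemma frac_const_nonneg:
  assumes s: "0 < s" "s \<le> 1"
  shows "frac_const N s \<ge> 0"
proof -
  have 1: "Gamma ((real N + s) / 2) \<ge> 0" using s by (intro Gamma_real_nonneg) simp
  have 2: "Gamma (1 - s / 2) \<ge> 0" using s by (intro Gamma_real_nonneg) simp
  have 3: "s * Gamma ((real N + s) / 2) \<ge> 0" using 1 s by (intro mult_nonneg_nonneg) auto
  have 4: "2 * pi powr (real N / 2 + s) * Gamma (1 - s / 2) \<ge> 0"
    by (rule mult_nonneg_nonneg[OF _ 2]) simp
  show ?thesis unfolding frac_const_def by (rule divide_nonneg_nonneg[OF 3 4])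
qed

section \<open>Entropy inequalities for Borel representatives\<close>

text \<open>
  Fubini's theorem is applied to Borel functions on the product of Borel sigma-algebras; this lemma
  passes from the Lebesgue integrals of the definition of entropy solutions to Borel representatives.
  Measurability of \<open>h\<close> comes from the completeness of Lebesgue measure.
\<close>

lemma integral_lebesgue_AE_eq_borel:
  fixes g h :: "'a::euclidean_space \<Rightarrow> real"
  assumes [measurable]: "g \<in> borel_measurable borel" and eq: "AE x in lborel. h x = g x"
  shows "(LINT x|lebesgue. h x) = (LINT x|lborel. g x)"
proof -
  have g: "g \<in> borel_measurable lebesgue" by (rule measurable_completion) simp
  have h: "h \<in> borel_measurable lebesgue"
  proof (rule borel_measurableI)
    fix S :: "real set" assume S: "open S"
    have P1: "Measurable.pred lebesgue (\<lambda>x. h x \<noteq> g x)"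
      using eq by (intro sets_completion_AE) auto
    have P2: "Measurable.pred lebesgue (\<lambda>x. h x \<noteq> g x \<and> h x \<in> S)"
      using eq by (intro sets_completion_AE) auto
    have P3: "Measurable.pred lebesgue (\<lambda>x. g x \<in> S)"
      using measurable_sets[OF g, of S] S by (simp add: pred_def vimage_def Int_def)
    have "Measurable.pred lebesgue (\<lambda>x. (h x \<noteq> g x \<and> h x \<in> S) \<or> (\<not> (h x \<noteq> g x) \<and> g x \<in> S))"
      by (intro pred_intros_logic P1 P2 P3)
    moreover have "{x \<in> space lebesgue. (h x \<noteq> g x \<and> h x \<in> S) \<or> (\<not> (h x \<noteq> g x) \<and> g x \<in> S)} = h -` S \<inter> space lebesgue"
      by auto
    ultimately show "h -` S \<inter> space lebesgue \<in> sets lebesgue" by (simp add: pred_def)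
  qed
  have "(LINT x|lebesgue. h x) = (LINT x|lebesgue. g x)"
    using eq by (intro integral_cong_AE h g AE_completion) 
  also have "\<dots> = (LINT x|lborel. g x)" by (rule integral_completion) simp
  finally show ?thesis .
qed

lemma entropy_solution_borel:
  fixes u u0 f f0 \<phi> :: "real ^ 'n \<Rightarrow> real" and F \<Phi> :: "real \<Rightarrow> real ^ 'n"
  assumes sol: "entropy_solution b F s f u"
    and u0: "u0 \<in> borel_measurable borel" "AE x in lborel. u x = u0 x"
    and f0: "f0 \<in> borel_measurable borel" "AE x in lborel. f x = f0 x"
    and b: "b \<in> borel_measurable borel"
    and r: "r > 0" and \<phi>: "test_function \<phi>" "\<And>x. \<phi> x \<ge> 0"
    and \<eta>: "convex_on UNIV \<eta>" "C2_real \<eta>" and \<Phi>: "entropy_flux F \<eta> \<Phi>"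
  shows "0 \<le> (LINT x|lborel. (f0 x - b (u0 x)) * deriv \<eta> (u0 x) * \<phi> x + \<Phi> (u0 x) \<bullet> grad \<phi> x)
      + frac_const CARD('n) s * (LINT x|lborel. deriv \<eta> (u0 x) * \<phi> x * far_part s r u0 x)
      + frac_const CARD('n) s * (LINT x|lborel. \<eta> (u0 x) * near_part s r \<phi> x)"
proof -
  have c\<Phi>: "continuous_on UNIV \<Phi>"
    using locally_lipschitz_continuous[of \<Phi>] \<Phi>
    by (simp add: entropy_flux_def continuous_at_imp_continuous_on)
  have c: "continuous_on UNIV (deriv \<eta>)" "continuous_on UNIV \<eta>"
    using \<eta>(2)
    by (auto simp: C2_real_def continuous_at_imp_continuous_on field_differentiable_imp_continuous_at)
  note [measurable] = u0(1) f0(1) b c[THEN borel_measurable_continuous_onI] c\<Phi>[THEN borel_measurable_continuous_onI]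
    test_function_measurable[OF \<phi>(1)] test_function_grad_measurable[OF \<phi>(1)] near_part_measurable[OF \<phi>(1)]
  let ?p = "\<lambda>z :: real ^ 'n. norm z powr (real CARD('n) + s)"
  have 1: "(LINT x|lebesgue. (f x - b (u x)) * deriv \<eta> (u x) * \<phi> x + \<Phi> (u x) \<bullet> grad \<phi> x)
      = (LINT x|lborel. (f0 x - b (u0 x)) * deriv \<eta> (u0 x) * \<phi> x + \<Phi> (u0 x) \<bullet> grad \<phi> x)"
    using u0(2) f0(2) by (intro integral_lebesgue_AE_eq_borel) auto
  have 2: "(LINT x|lebesgue. (LINT z:{z. norm z \<ge> r}|lebesgue. deriv \<eta> (u x) * ((u (x + z) - u x) / ?p z) * \<phi> x))
      = (LINT x|lborel. deriv \<eta> (u0 x) * \<phi> x * far_part s r u0 x)"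
  proof (rule integral_lebesgue_AE_eq_borel)
    show "AE x in lborel. (LINT z:{z. norm z \<ge> r}|lebesgue. deriv \<eta> (u x) * ((u (x + z) - u x) / ?p z) * \<phi> x)
        = deriv \<eta> (u0 x) * \<phi> x * far_part s r u0 x"
      using u0(2)
    proof eventually_elim
      case (elim x)
      have "AE z in lborel. u (x + z) = u0 (x + z)" by (rule AE_lborel_translate[OF u0(2)])
      then have "(LINT z:{z. norm z \<ge> r}|lebesgue. deriv \<eta> (u x) * ((u (x + z) - u x) / ?p z) * \<phi> x)
        = (LINT z|lborel. (deriv \<eta> (u0 x) * \<phi> x) * (far_kernel s r z * (u0 (x + z) - u0 x)))"
        unfolding set_lebesgue_integral_def
        by (intro integral_lebesgue_AE_eq_borel) (measurable, auto simp: elim far_kernel_def)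
      then show ?case by (simp add: far_part_def)
    qed
  qed measurable
  have 3: "(LINT x|lebesgue. (LINT z:{z. norm z \<le> r}|lebesgue. \<eta> (u x) * ((\<phi> (x + z) - \<phi> x - grad \<phi> x \<bullet> z) / ?p z)))
      = (LINT x|lborel. \<eta> (u0 x) * near_part s r \<phi> x)"
  proof (rule integral_lebesgue_AE_eq_borel)
    show "AE x in lborel. (LINT z:{z. norm z \<le> r}|lebesgue. \<eta> (u x) * ((\<phi> (x + z) - \<phi> x - grad \<phi> x \<bullet> z) / ?p z))
        = \<eta> (u0 x) * near_part s r \<phi> x"
      using u0(2)
    proof eventually_elim
      case (elim x)
      have "(LINT z:{z. norm z \<le> r}|lebesgue. \<eta> (u x) * ((\<phi> (x + z) - \<phi> x - grad \<phi> x \<bullet> z) / ?p z))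
        = (LINT z|lborel. \<eta> (u0 x) * (near_kernel s r z * (\<phi> (x + z) - \<phi> x - grad \<phi> x \<bullet> z)))"
        unfolding set_lebesgue_integral_def
        by (intro integral_lebesgue_AE_eq_borel) (measurable, auto simp: elim near_kernel_def)
      then show ?case by (simp add: near_part_def)
    qed
  qed measurable
  have "0 \<le> (LINT x|lebesgue. (f x - b (u x)) * deriv \<eta> (u x) * \<phi> x + \<Phi> (u x) \<bullet> grad \<phi> x)
        + frac_const CARD('n) s *
          (LINT x|lebesgue. (LINT z:{z. norm z \<ge> r}|lebesgue.
             deriv \<eta> (u x) * ((u (x + z) - u x) / norm z powr (real CARD('n) + s)) * \<phi> x))
        + frac_const CARD('n) s *
          (LINT x|lebesgue. (LINT z:{z. norm z \<le> r}|lebesgue.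
             \<eta> (u x) * ((\<phi> (x + z) - \<phi> x - grad \<phi> x \<bullet> z) / norm z powr (real CARD('n) + s))))"
    using sol r \<phi> \<eta> \<Phi> unfolding entropy_solution_def by blast
  then show ?thesis unfolding 1 2 3 .
qed

text \<open>
  Kruzhkov's form of the entropy inequality, with the entropy \<open>|t - k|\<close> and the flux
  \<open>sgn (t - k) (F(t) - F(k))\<close>. It is the limit of the inequalities for \<open>sabs d (t - k)\<close> as \<open>d\<close> tends to \<open>0\<close>;
  all terms are dominated because \<open>u\<close> is bounded and \<open>\<phi>\<close> has compact support.
\<close>

lemma Kruzhkov_inequality:
  fixes u f \<phi> :: "real ^ 'n \<Rightarrow> real" and F :: "real \<Rightarrow> real ^ 'n"
  assumes sol: "entropy_solution b F s f u'" and s: "0 < s" "s \<le> 1"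
    and F: "locally_lipschitz F"
    and u: "u \<in> borel_measurable borel" "AE x in lborel. u' x = u x" "\<And>x. \<bar>u x\<bar> \<le> K"
    and f: "integrable lborel f0" "AE x in lborel. f x = f0 x"
    and b: "b \<in> borel_measurable borel" "integrable lborel (\<lambda>x. b (u x))"
    and r: "0 < r" "r \<le> 1" and \<phi>: "test_function \<phi>" "\<And>x. \<phi> x \<ge> 0" and k: "\<bar>k\<bar> \<le> K"
  shows "0 \<le> (LINT x|lborel. sgn (u x - k) * ((f0 x - b (u x)) * \<phi> x + (F (u x) - F k) \<bullet> grad \<phi> x
      + frac_const CARD('n) s * far_part s r u x * \<phi> x)
      + frac_const CARD('n) s * \<bar>u x - k\<bar> * near_part s r \<phi> x)"
proof -
  let ?C = "frac_const CARD('n) s"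
  have C: "?C \<ge> 0" using frac_const_nonneg[OF s] .
  have K: "K \<ge> 0" using k by linarith
  obtain L where L: "L-lipschitz_on {-K..K} F"
    using locally_lipschitz_imp_lipschitz_on_interval[OF F] .
  have L0: "L \<ge> 0" using L by (rule lipschitz_on_nonneg)
  obtain M where M: "M \<ge> 0" "\<And>x. \<bar>\<phi> x\<bar> \<le> M" by (rule test_function_bounded[OF \<phi>(1)]) blast
  define A where "A = 2 * K * (LINT z|lborel. far_kernel s r (z :: real ^ 'n))"
  have A: "\<bar>far_part s r u x\<bar> \<le> A" for x
    unfolding A_def by (rule far_part_eq(3)[OF s(1) r(1) u(1) u(3)])
  \<comment> \<open>the approximation parameter, along a sequence; \<open>e\<close> is the derivative of the entropy\<close>
  define d where "d n = 1 / real (Suc n)" for n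
  have d: "d n > 0" "d n \<le> 1" for n by (auto simp: d_def)
  have dlim: "d \<longlonglongrightarrow> 0" unfolding d_def[abs_def] by (rule LIMSEQ_Suc[OF lim_1_over_n])
  define e where "e n t = (t - k) / sabs (d n) (t - k)" for n t
  have e1: "\<bar>e n t\<bar> \<le> 1" for n t unfolding e_def by (rule deriv_sabs_le_1[OF d(1)])
  have "\<exists>\<Phi>. entropy_flux F (\<lambda>t. sabs (d n) (t - k)) \<Phi> \<and>
    (\<forall>t. \<bar>t\<bar> \<le> K \<longrightarrow> norm (\<Phi> t - e n t *\<^sub>R (F t - F k)) \<le> L * d n)" for n
    by (rule sabs_entropy_flux[OF F d(1)[of n], of k]) (use k L in \<open>auto simp: e_def\<close>)
  then obtain \<Phi> where \<Phi>: "\<And>n. entropy_flux F (\<lambda>t. sabs (d n) (t - k)) (\<Phi> n)"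
    "\<And>n t. \<bar>t\<bar> \<le> K \<Longrightarrow> norm (\<Phi> n t - e n t *\<^sub>R (F t - F k)) \<le> L * d n" by metis
  have c: "continuous_on UNIV F" "continuous_on UNIV (\<Phi> n)" "continuous_on UNIV (sabs (d n))" for n
    using locally_lipschitz_continuous[OF F] \<Phi>(1)[of n] locally_lipschitz_continuous[of "\<Phi> n"] continuous_sabs
    by (auto simp: entropy_flux_def continuous_at_imp_continuous_on)
  have f0: "f0 \<in> borel_measurable borel" using f by auto
  note [measurable] = u(1) f0 b(1) c[THEN borel_measurable_continuous_onI]
    test_function_measurable[OF \<phi>(1)] test_function_grad_measurable[OF \<phi>(1)] near_part_measurable[OF \<phi>(1)]
  have [measurable]: "e n \<in> borel_measurable borel" for n unfolding e_def[abs_def] by measurable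
  have FL: "norm (F (u x) - F k) \<le> L * (2 * K)" for x
  proof -
    have "norm (F (u x) - F k) \<le> L * \<bar>u x - k\<bar>"
      using lipschitz_onD[OF L, of "u x" k] u(3)[of x] k by (auto simp: dist_norm abs_le_iff)
    also have "\<dots> \<le> L * (2 * K)" using u(3)[of x] k L0 by (intro mult_left_mono) linarith+
    finally show ?thesis .
  qed
  have \<Phi>b: "norm (\<Phi> n (u x)) \<le> L * (2 * K) + L" for n x
  proof -
    have "norm (\<Phi> n (u x)) \<le> norm (\<Phi> n (u x) - e n (u x) *\<^sub>R (F (u x) - F k)) + norm (e n (u x) *\<^sub>R (F (u x) - F k))"
      using norm_triangle_ineq[of "\<Phi> n (u x) - e n (u x) *\<^sub>R (F (u x) - F k)" "e n (u x) *\<^sub>R (F (u x) - F k)"] by simp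
    also have "\<dots> \<le> L * 1 + 1 * (L * (2 * K))"
    proof (intro add_mono)
      show "norm (\<Phi> n (u x) - e n (u x) *\<^sub>R (F (u x) - F k)) \<le> L * 1"
        using \<Phi>(2)[OF u(3), of n x] mult_left_mono[OF d(2) L0, of n] by linarith
      show "norm (e n (u x) *\<^sub>R (F (u x) - F k)) \<le> 1 * (L * (2 * K))"
        unfolding norm_scaleR using e1[of n "u x"] FL[of x] by (intro mult_mono) auto
    qed
    finally show ?thesis by simp
  qed
  have sb: "\<bar>sabs (d n) (u x - k)\<bar> \<le> 2 * K + 1" for n x
    using sabs_le[OF d(1), of n "u x - k"] sabs_pos[OF d(1), of n "u x - k"] d(2)[of n] u(3)[of x] k by linarith
  \<comment> \<open>the three integrals of the entropy inequality under one integral sign, and their pointwise limit \<open>h\<close>\<close>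
  define g where "g n x = e n (u x) * ((f0 x - b (u x)) * \<phi> x) + \<Phi> n (u x) \<bullet> grad \<phi> x
     + ?C * (e n (u x) * (far_part s r u x * \<phi> x)) + ?C * (sabs (d n) (u x - k) * near_part s r \<phi> x)" for n x
  have ifb: "integrable lborel (\<lambda>x. (f0 x - b (u x)) * \<phi> x)"
    using integrable_mult_bounded[OF Bochner_Integration.integrable_diff[OF f(1) b(2)] _ M(2)]
    by (simp add: mult.commute)
  have ig: "integrable lborel (\<lambda>x. norm (grad \<phi> x))" by (rule integrable_norm_grad[OF \<phi>(1)])
  have ifar: "integrable lborel (\<lambda>x. far_part s r u x * \<phi> x)"
    by (rule integrable_mult_bounded[OF integrable_test_function[OF \<phi>(1)] _ A]) measurable
  have inear: "integrable lborel (near_part s r \<phi>)" by (rule integrable_near_part[OF \<phi>(1)]) (use s r in auto)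
  have i1: "integrable lborel (\<lambda>x. e n (u x) * ((f0 x - b (u x)) * \<phi> x))" for n
    by (rule integrable_mult_bounded[OF ifb _ e1]) measurable
  have i2: "integrable lborel (\<lambda>x. \<Phi> n (u x) \<bullet> grad \<phi> x)" for n
  proof (rule Bochner_Integration.integrable_bound)
    show "integrable lborel (\<lambda>x. (L * (2 * K) + L) * norm (grad \<phi> x))" using ig by simp
    show "AE x in lborel. norm (\<Phi> n (u x) \<bullet> grad \<phi> x) \<le> norm ((L * (2 * K) + L) * norm (grad \<phi> x))"
    proof (rule AE_I2)
      fix x
      have "\<bar>\<Phi> n (u x) \<bullet> grad \<phi> x\<bar> \<le> norm (\<Phi> n (u x)) * norm (grad \<phi> x)" by (rule Cauchy_Schwarz_ineq2)
      also have "\<dots> \<le> (L * (2 * K) + L) * norm (grad \<phi> x)" by (intro mult_right_mono \<Phi>b) simp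
      finally show "norm (\<Phi> n (u x) \<bullet> grad \<phi> x) \<le> norm ((L * (2 * K) + L) * norm (grad \<phi> x))" by simp
    qed
  qed measurable
  have i3: "integrable lborel (\<lambda>x. e n (u x) * (far_part s r u x * \<phi> x))" for n
    by (rule integrable_mult_bounded[OF ifar _ e1]) measurable
  have i4: "integrable lborel (\<lambda>x. sabs (d n) (u x - k) * near_part s r \<phi> x)" for n
    by (rule integrable_mult_bounded[OF inear _ sb]) measurable
  have pos: "0 \<le> (LINT x|lborel. g n x)" for n
  proof -
    have de: "deriv (\<lambda>t. sabs (d n) (t - k)) = e n" by (simp add: deriv_sabs[OF d(1)] e_def[abs_def])
    have "0 \<le> (LINT x|lborel. (f0 x - b (u x)) * e n (u x) * \<phi> x + \<Phi> n (u x) \<bullet> grad \<phi> x)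
      + ?C * (LINT x|lborel. e n (u x) * \<phi> x * far_part s r u x)
      + ?C * (LINT x|lborel. sabs (d n) (u x - k) * near_part s r \<phi> x)"
      using entropy_solution_borel[OF sol u(1,2) f0 f(2) b(1) r(1) \<phi> convex_sabs[OF d(1)] C2_real_sabs[OF d(1)] \<Phi>(1)[of n]]
      unfolding de .
    also have "(\<lambda>x. (f0 x - b (u x)) * e n (u x) * \<phi> x + \<Phi> n (u x) \<bullet> grad \<phi> x)
       = (\<lambda>x. e n (u x) * ((f0 x - b (u x)) * \<phi> x) + \<Phi> n (u x) \<bullet> grad \<phi> x)" by (simp add: mult_ac)
    also have "(\<lambda>x. e n (u x) * \<phi> x * far_part s r u x) = (\<lambda>x. e n (u x) * (far_part s r u x * \<phi> x))"
      by (simp add: mult_ac)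
    finally show ?thesis unfolding g_def using i1[of n] i2[of n] i3[of n] i4[of n] by simp
  qed
  define h where "h x = sgn (u x - k) * ((f0 x - b (u x)) * \<phi> x) + (sgn (u x - k) *\<^sub>R (F (u x) - F k)) \<bullet> grad \<phi> x
     + ?C * (sgn (u x - k) * (far_part s r u x * \<phi> x)) + ?C * (\<bar>u x - k\<bar> * near_part s r \<phi> x)" for x
  have "(\<lambda>n. LINT x|lborel. g n x) \<longlonglongrightarrow> (LINT x|lborel. h x)"
  proof (rule integral_dominated_convergence)
    show "h \<in> borel_measurable lborel" unfolding h_def[abs_def] by measurable
    show "g n \<in> borel_measurable lborel" for n unfolding g_def[abs_def] by measurable
    show "integrable lborel (\<lambda>x. \<bar>(f0 x - b (u x)) * \<phi> x\<bar> + (L * (2 * K) + L) * norm (grad \<phi> x)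
      + ?C * \<bar>far_part s r u x * \<phi> x\<bar> + ?C * ((2 * K + 1) * \<bar>near_part s r \<phi> x\<bar>))"
      using ifb ig ifar inear by (intro Bochner_Integration.integrable_add integrable_mult_right integrable_abs)
    show "AE x in lborel. norm (g n x) \<le> \<bar>(f0 x - b (u x)) * \<phi> x\<bar> + (L * (2 * K) + L) * norm (grad \<phi> x)
      + ?C * \<bar>far_part s r u x * \<phi> x\<bar> + ?C * ((2 * K + 1) * \<bar>near_part s r \<phi> x\<bar>)" for n
    proof (rule AE_I2)
      fix x
      have a: "\<bar>e n (u x) * y\<bar> \<le> \<bar>y\<bar>" for y
        using mult_right_mono[OF e1[of n "u x"], of "\<bar>y\<bar>"] by (simp add: abs_mult)
      have 2: "\<bar>\<Phi> n (u x) \<bullet> grad \<phi> x\<bar> \<le> (L * (2 * K) + L) * norm (grad \<phi> x)"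
        by (rule order_trans[OF Cauchy_Schwarz_ineq2]) (intro mult_right_mono \<Phi>b norm_ge_zero)
      have 3: "\<bar>?C * (e n (u x) * (far_part s r u x * \<phi> x))\<bar> \<le> ?C * \<bar>far_part s r u x * \<phi> x\<bar>"
        using mult_left_mono[OF a[of "far_part s r u x * \<phi> x"] C] C by (simp add: abs_mult)
      have 4: "\<bar>?C * (sabs (d n) (u x - k) * near_part s r \<phi> x)\<bar> \<le> ?C * ((2 * K + 1) * \<bar>near_part s r \<phi> x\<bar>)"
        using mult_left_mono[OF mult_right_mono[OF sb] C, of "\<bar>near_part s r \<phi> x\<bar>" n x] C by (simp add: abs_mult)
      show "norm (g n x) \<le> \<bar>(f0 x - b (u x)) * \<phi> x\<bar> + (L * (2 * K) + L) * norm (grad \<phi> x)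
        + ?C * \<bar>far_part s r u x * \<phi> x\<bar> + ?C * ((2 * K + 1) * \<bar>near_part s r \<phi> x\<bar>)"
        using a[of "(f0 x - b (u x)) * \<phi> x"] 2 3 4 unfolding g_def real_norm_def by linarith
    qed
    show "AE x in lborel. (\<lambda>n. g n x) \<longlonglongrightarrow> h x"
    proof (rule AE_I2)
      fix x
      have s1: "(\<lambda>n. sabs (d n) (u x - k)) \<longlonglongrightarrow> \<bar>u x - k\<bar>"
      proof -
        have "(\<lambda>n. sabs (d n) (u x - k)) \<longlonglongrightarrow> sqrt ((u x - k)\<^sup>2 + 0\<^sup>2)"
          unfolding sabs_def by (intro tendsto_intros dlim)
        then show ?thesis by simp
      qed
      have s2: "(\<lambda>n. e n (u x)) \<longlonglongrightarrow> sgn (u x - k)"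
      proof (cases "u x = k")
        case False
        then have "(\<lambda>n. e n (u x)) \<longlonglongrightarrow> (u x - k) / \<bar>u x - k\<bar>"
          unfolding e_def by (intro tendsto_intros s1) auto
        then show ?thesis by (simp add: real_sgn_eq)
      qed (simp add: e_def)
      have s3: "(\<lambda>n. \<Phi> n (u x)) \<longlonglongrightarrow> sgn (u x - k) *\<^sub>R (F (u x) - F k)"
      proof -
        have "(\<lambda>n. L * d n) \<longlonglongrightarrow> L * 0" by (intro tendsto_intros dlim)
        then have "(\<lambda>n. L * d n) \<longlonglongrightarrow> 0" by simp
        then have "(\<lambda>n. \<Phi> n (u x) - e n (u x) *\<^sub>R (F (u x) - F k)) \<longlonglongrightarrow> 0"
          by (rule Lim_null_comparison[rotated]) (use \<Phi>(2)[OF u(3)] in auto)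
        moreover have "(\<lambda>n. e n (u x) *\<^sub>R (F (u x) - F k)) \<longlonglongrightarrow> sgn (u x - k) *\<^sub>R (F (u x) - F k)"
          by (intro tendsto_intros s2)
        ultimately have "(\<lambda>n. \<Phi> n (u x) - e n (u x) *\<^sub>R (F (u x) - F k) + e n (u x) *\<^sub>R (F (u x) - F k))
            \<longlonglongrightarrow> 0 + sgn (u x - k) *\<^sub>R (F (u x) - F k)" by (rule tendsto_add)
        then show ?thesis by simp
      qed
      show "(\<lambda>n. g n x) \<longlonglongrightarrow> h x" unfolding g_def h_def by (intro tendsto_intros s1 s2 s3)
    qed
  qed
  then have "0 \<le> (LINT x|lborel. h x)" by (rule LIMSEQ_le_const) (use pos in auto)
  also have "h = (\<lambda>x. sgn (u x - k) * ((f0 x - b (u x)) * \<phi> x + (F (u x) - F k) \<bullet> grad \<phi> x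
      + ?C * far_part s r u x * \<phi> x) + ?C * \<bar>u x - k\<bar> * near_part s r \<phi> x)"
    by (rule ext) (simp add: h_def algebra_simps)
  finally show ?thesis .
qed

section \<open>Doubling of variables\<close>

text \<open>
  Multiplication by \<open>sgn (u - v)\<close> turns \<open>bu - bv\<close> and \<open>u - v\<close> into absolute values and at most increases
  \<open>f - g\<close> and \<open>Ux - Vy\<close> to theirs. The flux term \<open>a\<close> occurs with both signs and cancels.
\<close>

lemma doubling_pointwise:
  fixes u v bu bv f g fu fv W Ux Vy \<rho> n C a :: real
  assumes \<rho>: "\<rho> \<ge> 0" and C: "C \<ge> 0" and mono: "(u \<le> v \<longrightarrow> bu \<le> bv) \<and> (v \<le> u \<longrightarrow> bv \<le> bu)"
    and fu: "fu = Ux - W * u" and fv: "fv = Vy - W * v"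
  shows "(sgn (u - v) * ((f - bu) * \<rho> + a + C * fu * \<rho>) + C * \<bar>u - v\<bar> * n)
    + (sgn (v - u) * ((g - bv) * \<rho> + a + C * fv * \<rho>) + C * \<bar>v - u\<bar> * n)
    \<le> (\<bar>f - g\<bar> * \<rho> - \<bar>bu - bv\<bar> * \<rho>) + (C * (\<bar>Ux - Vy\<bar> * \<rho>) - C * W * (\<bar>u - v\<bar> * \<rho>)) + 2 * C * (\<bar>u - v\<bar> * \<bar>n\<bar>)"
proof -
  define \<sigma> where "\<sigma> = sgn (u - v)"
  have \<sigma>: "\<bar>\<sigma>\<bar> \<le> 1" "\<sigma> * (u - v) = \<bar>u - v\<bar>" by (auto simp: \<sigma>_def sgn_real_def)
  have b: "\<sigma> * (bu - bv) = \<bar>bu - bv\<bar>"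
    using mono by (cases u v rule: linorder_cases) (auto simp: \<sigma>_def sgn_real_def)
  have le: "\<sigma> * y \<le> \<bar>y\<bar>" for y
  proof -
    have "\<sigma> * y \<le> \<bar>\<sigma>\<bar> * \<bar>y\<bar>" by (metis abs_ge_self abs_mult)
    also have "\<dots> \<le> \<bar>y\<bar>" using mult_right_mono[OF \<sigma>(1), of "\<bar>y\<bar>"] by simp
    finally show ?thesis .
  qed
  have s2: "sgn (v - u) = - \<sigma>" unfolding \<sigma>_def sgn_minus[symmetric] by simp
  have "(sgn (u - v) * ((f - bu) * \<rho> + a + C * fu * \<rho>) + C * \<bar>u - v\<bar> * n)
    + (sgn (v - u) * ((g - bv) * \<rho> + a + C * fv * \<rho>) + C * \<bar>v - u\<bar> * n)
    = \<sigma> * (f - g) * \<rho> - \<sigma> * (bu - bv) * \<rho> + C * (\<sigma> * (Ux - Vy)) * \<rho> - C * W * (\<sigma> * (u - v)) * \<rho> + 2 * C * (\<bar>u - v\<bar> * n)"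
    unfolding s2 \<sigma>_def[symmetric] fu fv abs_minus_commute[of v u] by algebra
  also have "\<dots> \<le> \<bar>f - g\<bar> * \<rho> - \<bar>bu - bv\<bar> * \<rho> + C * \<bar>Ux - Vy\<bar> * \<rho> - C * W * \<bar>u - v\<bar> * \<rho> + 2 * C * (\<bar>u - v\<bar> * \<bar>n\<bar>)"
    unfolding b \<sigma>(2) using le \<rho> C
    by (intro add_mono diff_mono mult_right_mono mult_left_mono order_refl) auto
  finally show ?thesis by (simp add: algebra_simps)
qed

lemma integral_linear_combination:
  fixes p1 p2 p3 p4 p5 :: "'a \<Rightarrow> real"
  assumes "integrable M p1" "integrable M p2" "integrable M p3" "integrable M p4" "integrable M p5"
  shows "(LINT z|M. (p1 z - p2 z) + (c * p3 z - d * p4 z) + e * p5 z)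
    = ((LINT z|M. p1 z) - (LINT z|M. p2 z)) + (c * (LINT z|M. p3 z) - d * (LINT z|M. p4 z)) + e * (LINT z|M. p5 z)"
  using assms by simp

text \<open>
  The two inequalities, for \<open>u\<close> with constant \<open>v y\<close> and test function \<open>\<rho> (x - y)\<close> in \<open>x\<close>, and with the
  roles exchanged, are integrated over the other variable and added. The flux terms cancel because
  the gradient of \<open>\<rho>\<close> is odd, and the long-range parts contribute a nonpositive amount.
\<close>

lemma doubling:
  fixes u v f \<rho> :: "real ^ 'n \<Rightarrow> real" and F :: "real \<Rightarrow> real ^ 'n"
  assumes sol: "entropy_solution b F s f' u'" "entropy_solution b F s f' v'" and s: "0 < s" "s \<le> 1"
    and F: "locally_lipschitz F" and b: "mono b"
    and u: "u \<in> borel_measurable borel" "AE x in lborel. u' x = u x" "\<And>x. \<bar>u x\<bar> \<le> K"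
      "integrable lborel u" "integrable lborel (\<lambda>x. b (u x))"
    and v: "v \<in> borel_measurable borel" "AE x in lborel. v' x = v x" "\<And>x. \<bar>v x\<bar> \<le> K"
      "integrable lborel v" "integrable lborel (\<lambda>x. b (v x))"
    and f: "integrable lborel f" "AE x in lborel. f' x = f x"
    and r: "0 < r" "r \<le> 1"
    and \<rho>: "test_function \<rho>" "\<And>x. \<rho> x \<ge> 0" "\<And>x. \<rho> (- x) = \<rho> x"
  shows "(LINT z|(lborel \<Otimes>\<^sub>M lborel). (case z of (x, y) \<Rightarrow> \<bar>b (u x) - b (v y)\<bar> * \<rho> (x - y)))
    \<le> (LINT z|(lborel \<Otimes>\<^sub>M lborel). (case z of (x, y) \<Rightarrow> \<bar>f x - f y\<bar> * \<rho> (x - y)))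
      + 2 * frac_const CARD('n) s *
        (LINT z|(lborel \<Otimes>\<^sub>M lborel). (case z of (x, y) \<Rightarrow> \<bar>u x - v y\<bar> * \<bar>near_part s r \<rho> (x - y)\<bar>))"
proof -
  let ?P = "lborel \<Otimes>\<^sub>M lborel :: ((real ^ 'n) \<times> (real ^ 'n)) measure"
  define C where "C = frac_const CARD('n) s"
  have C: "C \<ge> 0" unfolding C_def by (rule frac_const_nonneg[OF s])
  have bm: "b \<in> borel_measurable borel" by (rule borel_measurable_mono[OF b])
  have K: "K \<ge> 0" using u(3)[of 0] by linarith
  obtain L where L: "L-lipschitz_on {-K..K} F"
    using locally_lipschitz_imp_lipschitz_on_interval[OF F] .
  have L0: "L \<ge> 0" using L by (rule lipschitz_on_nonneg)
  have Fc: "continuous_on UNIV F"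
    using locally_lipschitz_continuous[OF F] by (simp add: continuous_at_imp_continuous_on)
  let ?N = "near_part s r \<rho>"
  have fm: "f \<in> borel_measurable borel" using f by auto
  note [measurable] = u(1) v(1) fm bm Fc[THEN borel_measurable_continuous_onI]
    test_function_measurable[OF \<rho>(1)] test_function_grad_measurable[OF \<rho>(1)] near_part_measurable[OF \<rho>(1)]
  define w :: "real ^ 'n \<Rightarrow> real" where "w = far_kernel s r"
  have w: "integrable lborel w" "w (- z) = w z" "w z \<ge> 0" for z
    unfolding w_def using integrable_far_kernel[OF s(1) r(1)] far_kernel_nonneg
    by (auto simp: far_kernel_def indicator_def)
  define U V where "U x = (LINT z|lborel. w z * u (x + z))" and "V x = (LINT z|lborel. w z * v (x + z))" for x
  define W where "W = (LINT z|lborel. w z)"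
  have wu: "integrable lborel (\<lambda>z. w z * u (x + z))" and wv: "integrable lborel (\<lambda>z. w z * v (x + z))" for x
    unfolding w_def by (rule far_part_eq(1)[OF s(1) r(1) u(1,3)] far_part_eq(1)[OF s(1) r(1) v(1,3)])+
  have faru: "far_part s r u x = U x - W * u x" and farv: "far_part s r v x = V x - W * v x" for x
    unfolding U_def V_def W_def w_def
    by (rule far_part_eq(2)[OF s(1) r(1) u(1,3)] far_part_eq(2)[OF s(1) r(1) v(1,3)])+
  have iU: "integrable lborel U" "integrable lborel V"
    unfolding U_def[abs_def] V_def[abs_def] by (intro integrable_convolution w u v)+
  have ifar: "integrable lborel (far_part s r u)" "integrable lborel (far_part s r v)"
    unfolding faru[abs_def] farv[abs_def] using iU u v by auto
  have i\<rho>: "integrable lborel \<rho>" by (rule integrable_test_function[OF \<rho>(1)])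
  have ig: "integrable lborel (\<lambda>x. norm (grad \<rho> x))" by (rule integrable_norm_grad[OF \<rho>(1)])
  have iN: "integrable lborel (\<lambda>x. \<bar>?N x\<bar>)"
    using integrable_near_part[OF \<rho>(1), of s r] s r by simp
  \<comment> \<open>a single kernel that dominates everything depending on \<open>x - y\<close>\<close>
  define \<kappa> where "\<kappa> h = \<rho> h + norm (grad \<rho> h) + \<bar>?N h\<bar>" for h
  have i\<kappa>: "integrable lborel \<kappa>" unfolding \<kappa>_def[abs_def] using i\<rho> ig iN by auto
  have \<rho>': "\<rho> (y - x) = \<rho> (x - y)" and g': "grad \<rho> (y - x) = - grad \<rho> (x - y)" and N': "?N (y - x) = ?N (x - y)" for x y
    using \<rho>(3)[of "x - y"] grad_minus[OF \<rho>(1,3), of "x - y"] near_part_minus[OF \<rho>(1,3), of s r "x - y"] by simp_all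
  \<comment> \<open>the integrand of Kruzhkov's inequality for the first function with the second as the constant\<close>
  define G where "G u v x y = sgn (u x - v y) * ((f x - b (u x)) * \<rho> (x - y) + (F (u x) - F (v y)) \<bullet> grad \<rho> (x - y)
      + C * far_part s r u x * \<rho> (x - y)) + C * \<bar>u x - v y\<bar> * ?N (x - y)" for u v x y
  have Gpos: "0 \<le> (LINT x|lborel. G u v x y)"
    if "entropy_solution b F s f' u'" "u \<in> borel_measurable borel" "AE x in lborel. u' x = u x" "\<And>x. \<bar>u x\<bar> \<le> K"
      "integrable lborel (\<lambda>x. b (u x))" "\<And>x. \<bar>v x\<bar> \<le> K" for u u' v y
    using Kruzhkov_inequality[OF that(1) s F that(2-4) f bm that(5) r test_function_translate[OF \<rho>(1)] _ that(6), of y y] \<rho>(2)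
    unfolding G_def near_part_translate[OF \<rho>(1)] grad_translate[OF \<rho>(1)] C_def by simp
  have GB: "\<bar>G u v x y\<bar> \<le> ((\<bar>f x\<bar> + \<bar>b (u x)\<bar> + C * \<bar>far_part s r u x\<bar> + (L + C) * \<bar>u x\<bar>) + (L + C) * \<bar>v y\<bar>) * \<kappa> (x - y)"
    if uv: "\<And>x. \<bar>u x\<bar> \<le> K" "\<And>x. \<bar>v x\<bar> \<le> K" for u v x y
  proof -
    have \<kappa>1: "\<rho> (x - y) \<le> \<kappa> (x - y)" "norm (grad \<rho> (x - y)) \<le> \<kappa> (x - y)" "\<bar>?N (x - y)\<bar> \<le> \<kappa> (x - y)"
      using \<rho>(2)[of "x - y"] by (auto simp: \<kappa>_def)
    have "norm (F (u x) - F (v y)) \<le> L * \<bar>u x - v y\<bar>"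
      using lipschitz_onD[OF L, of "u x" "v y"] uv(1)[of x] uv(2)[of y] by (auto simp: dist_norm abs_le_iff)
    also have "\<dots> \<le> L * (\<bar>u x\<bar> + \<bar>v y\<bar>)" using L0 by (intro mult_left_mono) auto
    finally have FF: "norm (F (u x) - F (v y)) \<le> L * (\<bar>u x\<bar> + \<bar>v y\<bar>)" .
    have 1: "\<bar>(f x - b (u x)) * \<rho> (x - y)\<bar> \<le> (\<bar>f x\<bar> + \<bar>b (u x)\<bar>) * \<kappa> (x - y)"
      using \<rho>(2)[of "x - y"] \<kappa>1(1) unfolding abs_mult by (intro mult_mono) auto
    have 2: "\<bar>(F (u x) - F (v y)) \<bullet> grad \<rho> (x - y)\<bar> \<le> (L * (\<bar>u x\<bar> + \<bar>v y\<bar>)) * \<kappa> (x - y)"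
      using FF \<kappa>1(2) L0 by (intro order_trans[OF Cauchy_Schwarz_ineq2] mult_mono) auto
    have 3: "\<bar>C * far_part s r u x * \<rho> (x - y)\<bar> \<le> (C * \<bar>far_part s r u x\<bar>) * \<kappa> (x - y)"
      using \<rho>(2)[of "x - y"] \<kappa>1(1) C unfolding abs_mult by (intro mult_mono) auto
    have 4: "\<bar>C * \<bar>u x - v y\<bar> * ?N (x - y)\<bar> \<le> (C * (\<bar>u x\<bar> + \<bar>v y\<bar>)) * \<kappa> (x - y)"
      using \<kappa>1(3) C unfolding abs_mult by (intro mult_mono) auto
    have sg: "\<bar>sgn (u x - v y) * z\<bar> \<le> \<bar>z\<bar>" for z by (auto simp: sgn_real_def)
    have "\<bar>G u v x y\<bar> \<le> \<bar>(f x - b (u x)) * \<rho> (x - y)\<bar> + \<bar>(F (u x) - F (v y)) \<bullet> grad \<rho> (x - y)\<bar>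
        + \<bar>C * far_part s r u x * \<rho> (x - y)\<bar> + \<bar>C * \<bar>u x - v y\<bar> * ?N (x - y)\<bar>"
      unfolding G_def using sg[of "(f x - b (u x)) * \<rho> (x - y) + (F (u x) - F (v y)) \<bullet> grad \<rho> (x - y) + C * far_part s r u x * \<rho> (x - y)"]
      by linarith
    also have "\<dots> \<le> (\<bar>f x\<bar> + \<bar>b (u x)\<bar>) * \<kappa> (x - y) + (L * (\<bar>u x\<bar> + \<bar>v y\<bar>)) * \<kappa> (x - y)
        + (C * \<bar>far_part s r u x\<bar>) * \<kappa> (x - y) + (C * (\<bar>u x\<bar> + \<bar>v y\<bar>)) * \<kappa> (x - y)"
      using 1 2 3 4 by linarith
    finally show ?thesis by (simp add: algebra_simps)
  qed
  have iG: "integrable ?P (\<lambda>(x, y). G u v x y)"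
    if "u \<in> borel_measurable borel" "\<And>x. \<bar>u x\<bar> \<le> K" "integrable lborel u" "integrable lborel (\<lambda>x. b (u x))"
      "integrable lborel (far_part s r u)" "v \<in> borel_measurable borel" "\<And>x. \<bar>v x\<bar> \<le> K" "integrable lborel v" for u v
  proof (rule integrable_pair_bounded[OF _ _ i\<kappa>])
    note [measurable] = that(1,6)
    show "integrable lborel (\<lambda>x. \<bar>f x\<bar> + \<bar>b (u x)\<bar> + C * \<bar>far_part s r u x\<bar> + (L + C) * \<bar>u x\<bar>)"
      using f that by (intro Bochner_Integration.integrable_add integrable_mult_right integrable_abs)
    show "integrable lborel (\<lambda>y. (L + C) * \<bar>v y\<bar>)"
      using that by (intro integrable_mult_right integrable_abs)
    show "(\<lambda>(x, y). G u v x y) \<in> borel_measurable ?P" unfolding G_def by measurable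
    show "\<bar>case (x, y) of (x, y) \<Rightarrow> G u v x y\<bar> \<le>
        ((\<bar>f x\<bar> + \<bar>b (u x)\<bar> + C * \<bar>far_part s r u x\<bar> + (L + C) * \<bar>u x\<bar>) + (L + C) * \<bar>v y\<bar>) * \<kappa> (x - y)" for x y
      using GB[OF that(2,7)] by simp
  qed
  have iG1: "integrable ?P (\<lambda>(x, y). G u v x y)"
    by (rule iG[OF u(1,3,4,5) ifar(1) v(1,3,4)])
  have iG2: "integrable ?P (\<lambda>(x, y). G v u y x)"
    using lborel_pair.integrable_product_swap[OF iG[OF v(1,3,4,5) ifar(2) u(1,3,4)]] by (simp add: case_prod_beta')
  have p1: "0 \<le> (LINT z|?P. (case z of (x, y) \<Rightarrow> G u v x y))"
    unfolding lborel_pair.integral_snd[OF iG1, symmetric]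
    by (intro integral_nonneg_AE AE_I2 Gpos[OF sol(1) u(1-3,5) v(3)])
  have p2: "0 \<le> (LINT z|?P. (case z of (x, y) \<Rightarrow> G v u y x))"
    unfolding lborel_pair.integral_fst'[OF iG2, symmetric] split_conv
    by (intro integral_nonneg_AE AE_I2 Gpos[OF sol(2) v(1-3,5) u(3)])
  let ?D = "\<lambda>p q \<kappa>. (\<lambda>(x, y). \<bar>p x - q y :: real\<bar> * \<kappa> (x - y))"
  note iD = integrable_pair_diff[OF f(1) f(1) i\<rho>] integrable_pair_diff[OF u(5) v(5) i\<rho>]
    integrable_pair_diff[OF iU i\<rho>] integrable_pair_diff[OF u(4) v(4) i\<rho>] integrable_pair_diff[OF u(4) v(4) iN]
  have "0 \<le> (LINT z|?P. (case z of (x, y) \<Rightarrow> G u v x y)) + (LINT z|?P. (case z of (x, y) \<Rightarrow> G v u y x))"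
    using p1 p2 by simp
  also have "\<dots> = (LINT z|?P. (case z of (x, y) \<Rightarrow> G u v x y) + (case z of (x, y) \<Rightarrow> G v u y x))"
    by (rule Bochner_Integration.integral_add[OF iG1 iG2, symmetric])
  also have "\<dots> \<le> (LINT z|?P. (?D f f \<rho> z - ?D (\<lambda>x. b (u x)) (\<lambda>x. b (v x)) \<rho> z)
      + (C * ?D U V \<rho> z - C * W * ?D u v \<rho> z) + 2 * C * ?D u v (\<lambda>x. \<bar>?N x\<bar>) z)"
  proof (rule integral_mono)
    show "integrable ?P (\<lambda>z. (case z of (x, y) \<Rightarrow> G u v x y) + (case z of (x, y) \<Rightarrow> G v u y x))"
      by (rule Bochner_Integration.integrable_add[OF iG1 iG2])
    show "integrable ?P (\<lambda>z. (?D f f \<rho> z - ?D (\<lambda>x. b (u x)) (\<lambda>x. b (v x)) \<rho> z)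
      + (C * ?D U V \<rho> z - C * W * ?D u v \<rho> z) + 2 * C * ?D u v (\<lambda>x. \<bar>?N x\<bar>) z)"
      by (intro Bochner_Integration.integrable_add Bochner_Integration.integrable_diff integrable_mult_right iD)
    fix z :: "(real ^ 'n) \<times> (real ^ 'n)"
    obtain x y where z: "z = (x, y)" by (cases z)
    have "(F (v y) - F (u x)) \<bullet> - grad \<rho> (x - y) = (F (u x) - F (v y)) \<bullet> grad \<rho> (x - y)"
      by (simp add: inner_diff_left)
    then have "G v u y x = sgn (v y - u x) * ((f y - b (v y)) * \<rho> (x - y) + (F (u x) - F (v y)) \<bullet> grad \<rho> (x - y)
      + C * far_part s r v y * \<rho> (x - y)) + C * \<bar>v y - u x\<bar> * ?N (x - y)"
      unfolding G_def \<rho>'[of y x] g'[of y x] N'[of y x] by simp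
    moreover have "(u x \<le> v y \<longrightarrow> b (u x) \<le> b (v y)) \<and> (v y \<le> u x \<longrightarrow> b (v y) \<le> b (u x))"
      using monoD[OF b] by blast
    note doubling_pointwise[where u="u x" and v="v y" and W=W and Ux="U x" and Vy="V y",
        OF \<rho>(2)[of "x - y"] C this faru[of x] farv[of y],
        of "f x" "(F (u x) - F (v y)) \<bullet> grad \<rho> (x - y)" "?N (x - y)" "f y"]
    ultimately show "(case z of (x, y) \<Rightarrow> G u v x y) + (case z of (x, y) \<Rightarrow> G v u y x) \<le>
      (?D f f \<rho> z - ?D (\<lambda>x. b (u x)) (\<lambda>x. b (v x)) \<rho> z)
      + (C * ?D U V \<rho> z - C * W * ?D u v \<rho> z) + 2 * C * ?D u v (\<lambda>x. \<bar>?N x\<bar>) z"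
      unfolding z split_conv G_def[of u v x y] by simp
  qed
  also have "\<dots> = ((LINT z|?P. ?D f f \<rho> z) - (LINT z|?P. ?D (\<lambda>x. b (u x)) (\<lambda>x. b (v x)) \<rho> z))
      + (C * (LINT z|?P. ?D U V \<rho> z) - C * W * (LINT z|?P. ?D u v \<rho> z)) + 2 * C * (LINT z|?P. ?D u v (\<lambda>x. \<bar>?N x\<bar>) z)"
    by (rule integral_linear_combination[OF iD])
  finally have main: "0 \<le> ((LINT z|?P. ?D f f \<rho> z) - (LINT z|?P. ?D (\<lambda>x. b (u x)) (\<lambda>x. b (v x)) \<rho> z))
      + (C * (LINT z|?P. ?D U V \<rho> z) - C * W * (LINT z|?P. ?D u v \<rho> z)) + 2 * C * (LINT z|?P. ?D u v (\<lambda>x. \<bar>?N x\<bar>) z)" .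
  have "(LINT z|?P. ?D U V \<rho> z) \<le> W * (LINT z|?P. ?D u v \<rho> z)"
    unfolding U_def V_def W_def
    by (rule convolution_pair_contraction[OF w u(4) wu v(4) wv i\<rho> \<rho>(2)])
  from mult_left_mono[OF this C] have "C * (LINT z|?P. ?D U V \<rho> z) \<le> C * W * (LINT z|?P. ?D u v \<rho> z)"
    by (simp add: mult.assoc)
  with main show ?thesis unfolding C_def by linarith
qed

section \<open>Uniqueness\<close>

lemma integral_bump_pos:
  assumes "d > 0"
  shows "(LINT x|lborel. bump d (x :: real ^ 'n)) > 0"
proof -
  let ?\<rho> = "bump d :: real ^ 'n \<Rightarrow> real"
  have i: "integrable lborel ?\<rho>" by (rule integrable_test_function[OF test_function_bump[OF assms]])
  have ge: "(LINT x|lborel. ?\<rho> x) \<ge> 0" by (intro integral_nonneg_AE AE_I2 bump_nonneg)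
  have "(LINT x|lborel. ?\<rho> x) \<noteq> 0"
  proof
    assume "(LINT x|lborel. ?\<rho> x) = 0"
    then have "AE x in lborel. ?\<rho> x = 0"
      using integral_nonneg_eq_0_iff_AE[OF i] bump_nonneg by auto
    moreover have "open {x. ?\<rho> x \<noteq> 0}"
      using test_function_continuous[OF test_function_bump[OF assms]] by (intro open_Collect_neq) auto
    ultimately have "{x. ?\<rho> x \<noteq> 0} \<in> null_sets lborel"
      by (subst AE_iff_null_sets) auto
    then have "emeasure lborel {x. ?\<rho> x \<noteq> 0} = 0" by (simp add: null_sets_def)
    moreover obtain e where "e > 0" "cball 0 e \<subseteq> {x. ?\<rho> x \<noteq> 0}"
      using \<open>open {x. ?\<rho> x \<noteq> 0}\<close> bump_pos_at_0[OF assms] 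
      by (metis (mono_tags, lifting) less_irrefl mem_Collect_eq open_contains_cball)
    moreover have "emeasure lborel (cball (0 :: real ^ 'n) e) > 0"
      using \<open>e > 0\<close> by (simp add: emeasure_cball)
    ultimately show False
      using emeasure_mono[of "cball 0 e" "{x. ?\<rho> x \<noteq> 0}" lborel] \<open>open {x. ?\<rho> x \<noteq> 0}\<close> by auto
  qed
  with ge show ?thesis by linarith
qed

text \<open>
  As the short-range radius tends to \<open>0\<close>, the doubling inequality becomes a bound of the double
  integral of \<open>|b (u x) - b (v y)| \<rho> (x - y)\<close> by that of \<open>|f x - f y| \<rho> (x - y)\<close>. When \<open>\<rho>\<close> is concentrated near
  \<open>0\<close>, the latter is small, and on the left \<open>y\<close> may be replaced by \<open>x\<close> at a small cost; the mass of \<open>\<rho>\<close> cancels.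
\<close>

lemma L1_contraction:
  fixes u v f :: "real ^ 'n \<Rightarrow> real" and F :: "real \<Rightarrow> real ^ 'n"
  assumes sol: "entropy_solution b F s f' u'" "entropy_solution b F s f' v'" and s: "0 < s" "s \<le> 1"
    and F: "locally_lipschitz F" and b: "mono b"
    and u: "u \<in> borel_measurable borel" "AE x in lborel. u' x = u x" "\<And>x. \<bar>u x\<bar> \<le> K"
      "integrable lborel u" "integrable lborel (\<lambda>x. b (u x))"
    and v: "v \<in> borel_measurable borel" "AE x in lborel. v' x = v x" "\<And>x. \<bar>v x\<bar> \<le> K"
      "integrable lborel v" "integrable lborel (\<lambda>x. b (v x))"
    and f: "integrable lborel f" "AE x in lborel. f' x = f x"
  shows "AE x in lborel. b (u x) = b (v x)"
proof -
  let ?P = "lborel \<Otimes>\<^sub>M lborel :: ((real ^ 'n) \<times> (real ^ 'n)) measure"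
  let ?I = "LINT x|lborel. \<bar>b (u x) - b (v x)\<bar>"
  have iI: "integrable lborel (\<lambda>x. \<bar>b (u x) - b (v x)\<bar>)" using u v by simp
  have "?I \<le> 2 * e" if e: "e > 0" for e
  proof -
    have "eventually (\<lambda>h. (LINT x|lborel. \<bar>f (x + h) - f x\<bar>) < e \<and>
        (LINT x|lborel. \<bar>b (v (x + h)) - b (v x)\<bar>) < e) (at 0)"
      using order_tendstoD(2)[OF L1_translation_continuous[OF f(1)] e]
        order_tendstoD(2)[OF L1_translation_continuous[OF v(5)] e] by (rule eventually_conj)
    then obtain d where d: "d > 0" "\<And>h. h \<noteq> 0 \<Longrightarrow> norm h < d \<Longrightarrow> (LINT x|lborel. \<bar>f (x + h) - f x\<bar>) < e \<and>
        (LINT x|lborel. \<bar>b (v (x + h)) - b (v x)\<bar>) < e"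
      unfolding eventually_at by (auto simp: dist_norm)
    define \<rho> where "\<rho> = (bump d :: real ^ 'n \<Rightarrow> real)"
    have \<rho>: "test_function \<rho>" "\<And>x. \<rho> x \<ge> 0" "\<And>x. \<rho> (- x) = \<rho> x"
      unfolding \<rho>_def by (auto intro: test_function_bump d bump_nonneg simp: bump_minus)
    have i\<rho>: "integrable lborel \<rho>" by (rule integrable_test_function[OF \<rho>(1)])
    define m where "m = (LINT h|lborel. \<rho> h)"
    have m: "m > 0" unfolding m_def \<rho>_def by (rule integral_bump_pos[OF d(1)])
    \<comment> \<open>\<open>h = 0\<close> is separate since the limit at \<open>0\<close> says nothing about the point \<open>0\<close> itself\<close>
    have supp: "h = 0 \<or> (h \<noteq> 0 \<and> norm h < d)" if "\<rho> h \<noteq> 0" for h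
      using that bump_outside[OF d(1), of h] unfolding \<rho>_def by force
    have tf: "(LINT z|?P. (case z of (x, y) \<Rightarrow> \<bar>f x - f y\<bar> * \<rho> (x - y))) \<le> e * m"
      unfolding m_def
    proof (rule pair_translation_bound[OF f(1) i\<rho> \<rho>(2)])
      show "(LINT x|lborel. \<bar>f (x + h) - f x\<bar>) \<le> e" if "\<rho> h \<noteq> 0" for h
        using supp[OF that] d(2)[of h] e by auto
    qed (use e in simp)
    have tv: "(LINT z|?P. (case z of (x, y) \<Rightarrow> \<bar>b (v x) - b (v y)\<bar> * \<rho> (x - y))) \<le> e * m"
      unfolding m_def
    proof (rule pair_translation_bound[OF v(5) i\<rho> \<rho>(2)])
      show "(LINT x|lborel. \<bar>b (v (x + h)) - b (v x)\<bar>) \<le> e" if "\<rho> h \<noteq> 0" for h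
        using supp[OF that] d(2)[of h] e by auto
    qed (use e in simp)
    let ?T = "LINT z|?P. (case z of (x, y) \<Rightarrow> \<bar>b (u x) - b (v y)\<bar> * \<rho> (x - y))"
    let ?E = "\<lambda>n. LINT z|?P. (case z of (x, y) \<Rightarrow> \<bar>u x - v y\<bar> * \<bar>near_part s (1 / real (Suc n)) \<rho> (x - y)\<bar>)"
    have "?T \<le> e * m + 2 * frac_const CARD('n) s * ?E n" for n
      using doubling[OF sol s F b u v f _ _ \<rho>, of "1 / real (Suc n)"] tf by simp
    moreover have "(\<lambda>n. e * m + 2 * frac_const CARD('n) s * ?E n) \<longlonglongrightarrow> e * m + 2 * frac_const CARD('n) s * 0"
      using s by (intro tendsto_intros near_error_tendsto_0 u v \<rho>) auto
    ultimately have T: "?T \<le> e * m"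
      by (intro LIMSEQ_le_const[of "\<lambda>n. e * m + 2 * frac_const CARD('n) s * ?E n" "e * m"]) auto
    have "?I * m = (LINT z|?P. (case z of (x, y) \<Rightarrow> (\<bar>b (u x) - b (v x)\<bar> + 0) * \<rho> (x - y)))"
      unfolding m_def using integral_pair_kernel[OF iI _ i\<rho>, of "\<lambda>_. 0"] \<rho>(2) by simp
    also have "\<dots> \<le> (LINT z|?P. (case z of (x, y) \<Rightarrow> \<bar>b (u x) - b (v y)\<bar> * \<rho> (x - y)) + (case z of (x, y) \<Rightarrow> \<bar>b (v x) - b (v y)\<bar> * \<rho> (x - y)))"
    proof (rule integral_mono)
      fix z :: "(real ^ 'n) \<times> (real ^ 'n)"
      obtain x y where z: "z = (x, y)" by (cases z)
      show "(case z of (x, y) \<Rightarrow> (\<bar>b (u x) - b (v x)\<bar> + 0) * \<rho> (x - y)) \<le>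
        (case z of (x, y) \<Rightarrow> \<bar>b (u x) - b (v y)\<bar> * \<rho> (x - y)) + (case z of (x, y) \<Rightarrow> \<bar>b (v x) - b (v y)\<bar> * \<rho> (x - y))"
        unfolding z split_conv distrib_right[symmetric] by (intro mult_right_mono \<rho>(2)) auto
    qed (intro integrable_pair_kernel Bochner_Integration.integrable_add integrable_pair_diff iI u v i\<rho> integrable_zero)+
    also have "\<dots> = ?T + (LINT z|?P. (case z of (x, y) \<Rightarrow> \<bar>b (v x) - b (v y)\<bar> * \<rho> (x - y)))"
      by (intro Bochner_Integration.integral_add integrable_pair_diff u v i\<rho>)
    also have "\<dots> \<le> (2 * e) * m" using T tv by simp
    finally show ?thesis using m by (simp only: mult_le_cancel_right_pos)
  qed
  then have "?I \<le> 0 + e" if "e > 0" for e using that by (metis add_0 field_sum_of_halves half_gt_zero mult_2)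
  then have "?I \<le> 0" by (rule field_le_epsilon)
  moreover have "?I \<ge> 0" by (intro integral_nonneg_AE) auto
  ultimately have "?I = 0" by linarith
  then have "AE x in lborel. \<bar>b (u x) - b (v x)\<bar> = 0"
    using integral_nonneg_eq_0_iff_AE[OF iI] by simp
  then show ?thesis by eventually_elim simp
qed

lemma L_infty_borel_representative:
  fixes u' :: "'a::euclidean_space \<Rightarrow> real"
  assumes "L_infty u'"
  obtains u K where "u \<in> borel_measurable borel" "AE x in lborel. u' x = u x" "\<And>x. \<bar>u x\<bar> \<le> K"
proof -
  from assms obtain K where K: "u' \<in> borel_measurable lebesgue" "AE x in lebesgue. \<bar>u' x\<bar> \<le> K"
    unfolding L_infty_def by blast
  obtain g where g: "g \<in> borel_measurable lborel" "AE x in lborel. u' x = g x"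
    using completion_ex_borel_measurable_real[OF K(1)] by blast
  define u where "u x = max (- \<bar>K\<bar>) (min \<bar>K\<bar> (g x))" for x
  have "AE x in lborel. \<bar>u' x\<bar> \<le> K" using K(2) by (simp add: AE_completion_iff)
  with g(2) have "AE x in lborel. u' x = u x"
    by eventually_elim (auto simp: u_def)
  moreover have "u \<in> borel_measurable borel" using g(1) unfolding u_def[abs_def] by simp
  moreover have "\<bar>u x\<bar> \<le> \<bar>K\<bar>" for x by (auto simp: u_def)
  ultimately show ?thesis using that by blast
qed

lemma integrable_lebesgue_imp_borel:
  fixes g h :: "'a::euclidean_space \<Rightarrow> real"
  assumes h: "integrable lebesgue h" and g: "g \<in> borel_measurable borel" and eq: "AE x in lborel. h x = g x"
  shows "integrable lborel g"
proof -
  have gl: "g \<in> borel_measurable lebesgue" by (rule measurable_completion) (use g in simp)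
  have "integrable lebesgue g"
    using h by (rule integrable_cong_AE_imp[OF _ gl]) (use eq in \<open>auto intro!: AE_completion elim: eventually_mono\<close>)
  then show ?thesis using g by (simp add: integrable_completion)
qed

theorem mainTheorem4:
  fixes s :: real and b :: "real \<Rightarrow> real" and F :: "real \<Rightarrow> real ^ 'n"
    and f u v :: "real ^ 'n \<Rightarrow> real"
  assumes s: "0 < s" "s \<le> 1"
    and b_lipschitz: "\<exists>L. L-lipschitz_on UNIV b"
    and b_mono: "mono b"
    and b_zero: "b 0 = 0"
    and b_coercive: "\<exists>c>0. \<forall>r. b r * r \<ge> c * \<bar>r\<bar>\<^sup>2"
    and F_lipschitz: "locally_lipschitz F"
    and F_zero: "F 0 = 0"
    and f_L1: "integrable lebesgue f"
    and f_Linf: "L_infty f"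
    and u_sol: "entropy_solution b F s f u"
    and v_sol: "entropy_solution b F s f v"
    and bu_L1: "integrable lebesgue (\<lambda>x. b (u x))"
    and bv_L1: "integrable lebesgue (\<lambda>x. b (v x))"
  shows "(AE x in lebesgue. b (u x) = b (v x)) \<and>
         (strict_mono b \<longrightarrow> (AE x in lebesgue. u x = v x))"
proof -
  have bm [measurable]: "b \<in> borel_measurable borel" by (rule borel_measurable_mono[OF b_mono])
  obtain c where c: "c > 0" "\<And>r. b r * r \<ge> c * \<bar>r\<bar>\<^sup>2" using b_coercive by blast
  have cb: "\<bar>r\<bar> \<le> \<bar>b r\<bar> / c" for r
  proof (cases "r = 0")
    case False
    have "c * \<bar>r\<bar>\<^sup>2 \<le> \<bar>b r\<bar> * \<bar>r\<bar>" using c(2)[of r] by (metis abs_ge_self abs_mult order_trans)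
    then have "(c * \<bar>r\<bar>) * \<bar>r\<bar> \<le> \<bar>b r\<bar> * \<bar>r\<bar>" by (simp only: power2_eq_square mult.assoc)
    then have "c * \<bar>r\<bar> \<le> \<bar>b r\<bar>" by (rule mult_right_le_imp_le) (use False in simp)
    then show ?thesis using c(1) by (simp add: field_simps)
  qed (use c in simp)
  have "L_infty u" "L_infty v" using u_sol v_sol by (auto simp: entropy_solution_def)
  obtain u0 Ku where u0: "u0 \<in> borel_measurable borel" "AE x in lborel. u x = u0 x" "\<And>x. \<bar>u0 x\<bar> \<le> Ku"
    by (rule L_infty_borel_representative[OF \<open>L_infty u\<close>]) blast
  obtain v0 Kv where v0: "v0 \<in> borel_measurable borel" "AE x in lborel. v x = v0 x" "\<And>x. \<bar>v0 x\<bar> \<le> Kv"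
    by (rule L_infty_borel_representative[OF \<open>L_infty v\<close>]) blast
  obtain f0 Kf where f0: "f0 \<in> borel_measurable borel" "AE x in lborel. f x = f0 x" "\<And>x. \<bar>f0 x\<bar> \<le> Kf"
    by (rule L_infty_borel_representative[OF f_Linf]) blast
  note [measurable] = u0(1) v0(1)
  have f: "integrable lborel f0" by (rule integrable_lebesgue_imp_borel[OF f_L1 f0(1,2)])
  have bu: "integrable lborel (\<lambda>x. b (u0 x))"
    by (rule integrable_lebesgue_imp_borel[OF bu_L1]) (use u0(2) in \<open>auto elim: eventually_mono\<close>)
  have bv: "integrable lborel (\<lambda>x. b (v0 x))"
    by (rule integrable_lebesgue_imp_borel[OF bv_L1]) (use v0(2) in \<open>auto elim: eventually_mono\<close>)
  \<comment> \<open>coercivity: integrability of \<open>b (w x)\<close> gives that of \<open>w\<close>\<close>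
  have L1: "integrable lborel w" if "w \<in> borel_measurable borel" "integrable lborel (\<lambda>x. b (w x))" for w :: "real ^ 'n \<Rightarrow> real"
  proof (rule Bochner_Integration.integrable_bound)
    show "integrable lborel (\<lambda>x. \<bar>b (w x)\<bar> / c)" using that(2) by simp
    show "AE x in lborel. norm (w x) \<le> norm (\<bar>b (w x)\<bar> / c)" using cb c(1) by (simp add: abs_divide)
  qed (use that in simp)
  define K where "K = max Ku Kv"
  have K: "\<bar>u0 x\<bar> \<le> K" "\<bar>v0 x\<bar> \<le> K" for x using u0(3)[of x] v0(3)[of x] by (auto simp: K_def)
  have "AE x in lborel. b (u0 x) = b (v0 x)"
    by (rule L1_contraction[OF u_sol v_sol s F_lipschitz b_mono u0(1,2) K(1) L1[OF u0(1) bu] bu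
          v0(1,2) K(2) L1[OF v0(1) bv] bv f f0(2)])
  with u0(2) v0(2) have "AE x in lborel. b (u x) = b (v x)" by eventually_elim simp
  then have 1: "AE x in lebesgue. b (u x) = b (v x)" by (rule AE_completion)
  moreover have "AE x in lebesgue. u x = v x" if "strict_mono b"
    using 1 by eventually_elim (simp add: strict_mono_eq[OF that])
  ultimately show ?thesis by blast
qed

end
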